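(* Let $\psi\colon (V,q)\rightarrow (V',q')$ be a Hodge similarity of polarized Hodge structures of K3-type. Then there exists an isogeny of abelian varieties $\psi_{\mathrm{KS}}\colon \mathrm{KS}(V)\rightarrow\mathrm{KS}(V')$ making the following diagram commute: $$\begin{array}{ccc} V & \xrightarrow{\ \psi\ } & V'\\ {\scriptstyle \kappa_V}\downarrow & & \downarrow{\scriptstyle \kappa_{V'}}\\ H^1(\mathrm{KS}(V),\mathbb{Q})^{\otimes 2} & \xrightarrow{(\psi_{\mathrm{KS}})_*^{\otimes 2}} & H^1(\mathrm{KS}(V'),\mathbb{Q})^{\otimes 2}\end{array}$$ where the (injective) vertical arrows $\kappa_V$ and $\kappa_{V'}$ are the Kuga--Satake correspondences for $(V,q)$ and $(V',q')$.
   Context: A polarized Hodge structure of K3-type is a pair $(V,q)$ where $V$ is a rational Hodge structure of weight two with $\dim_{\mathbb{C}} V^{2,0}=1$ and $V^{a,b}=0$ for $|a-b|>2$, and $q\colon V\otimes V\to\mathbb{Q}(-2)$ is a (symmetric) morphism of Hodge structures whose real extension is negative definite on $(V^{2,0}\oplus V^{0,2})\cap V_{\mathbb{R}}$ and has signature $(\dim V-2,2)$. Write $q(v)=q(v,v)$. A Hodge similarity $\psi\colon (V,q)\to (V',q')$ is an isomorphism of Hodge structures such that, for some non-zero $\lambda_\psi\in\mathbb{Q}$ (the multiplier), $q'(\psi v,\psi w)=\lambda_\psi q(v,w)$ for all $v,w\in V$. Kuga--Satake construction. $\mathrm{Cl}^+(V)$ is the even Clifford algebra, i.e. the even degree part of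 $\bigotimes^*V/I_V$, with $I_V$ the two-sided ideal generated by $v\otimes v-q(v)$, $v\in V$. Left multiplication by $J=e_1\cdot e_2$, where $\{e_1,e_2\}$ is an orthogonal basis of $V_{\mathbb{R}}\cap(V^{2,0}\oplus V^{0,2})$ with $q(e_1)=q(e_2)=-1$ (oriented compatibly with the Hodge structure), is a complex structure on $\mathrm{Cl}^+(V)_{\mathbb{R}}$ which gives $\mathrm{Cl}^+(V)$ a Hodge structure of weight one. The Kuga--Satake variety $\mathrm{KS}(V)$ is (the isogeny class of) the complex torus $\mathrm{Cl}^+(V)_{\mathbb{R}}/\mathrm{Cl}^+(V)$ (quotient by a lattice in $\mathrm{Cl}^+(V)$). For orthogonal $f_1,f_2\in V$ with $q(f_1),q(f_2)<0$, the pairing $Q(v,w)=\mathrm{tr}(f_1\cdot f_2\cdot v^*\cdot w)$ is, up to sign, a polarization of $\mathrm{Cl}^+(V)$, so $\mathrm{KS}(V)$ is an abelian variety; here $\mathrm{tr}(x)$ is the trace of left multiplication by $x$ on $\mathrm{Cl}^+(V)$ and $v\mapsto v^*$ is induced by $v_1\otimes\cdots\otimes v_{2m}\mapsto v_{2m}\otimes\cdots\otimes v_1$. One identifies $H^1(\mathrm{KS}(V),\mathbb{Q})$ with $\mathrm{Cl}^+(V)$ (using $Q$). For $v_0\in V$ with $q(v_0)\neq 0$, the Kuga--Satake correspondence $\kappa_V$ is the embedding of Hodge structures $$V\hookrightarrow \mathrm{End}(\mathrm{Cl}^+(V))\simeq \mathrm{Cl}^+(V)\otimes\mathrm{Cl}^+(V)\simeq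 H^1(\mathrm{KS}(V),\mathbb{Q})^{\otimes 2},\qquad v\mapsto (w\mapsto v\cdot w\cdot v_0),$$ where $\mathrm{End}(\mathrm{Cl}^+(V))\simeq \mathrm{Cl}^+(V)\otimes\mathrm{Cl}^+(V)$ comes from the isomorphism $\mathrm{Cl}^+(V)\simeq\mathrm{Cl}^+(V)^*$ given by $Q$ (Tate twists are suppressed). The construction of $\kappa_V$ involves the choice of the auxiliary elements $v_0,f_1,f_2\in V$. For an isogeny $f\colon A\to B$, $f_*\colon H^1(A,\mathbb{Q})\to H^1(B,\mathbb{Q})$ denotes the induced isomorphism. *)

theory Defs
  imports Complex_Main "HOL-Library.Poly_Mapping" "HOL-Algebra.Coset"
begin

section \<open>Rational vector spaces and algebras\<close>

class rat_vector = ab_group_add +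
  fixes scaleQ :: "rat \<Rightarrow> 'a \<Rightarrow> 'a"  (infixr \<open>*\<^sub>Q\<close> 75)
  assumes scaleQ_add_right: "r *\<^sub>Q (x + y) = r *\<^sub>Q x + r *\<^sub>Q y"
    and scaleQ_add_left: "(r + s) *\<^sub>Q x = r *\<^sub>Q x + s *\<^sub>Q x"
    and scaleQ_scaleQ: "r *\<^sub>Q (s *\<^sub>Q x) = (r * s) *\<^sub>Q x"
    and scaleQ_one: "1 *\<^sub>Q x = x"

global_interpretation rat_vector: vector_space "scaleQ :: rat \<Rightarrow> 'a \<Rightarrow> 'a::rat_vector"
  by unfold_locales (simp_all add: scaleQ_add_right scaleQ_add_left scaleQ_scaleQ scaleQ_one)

abbreviation Q_linear :: "('a::rat_vector \<Rightarrow> 'b::rat_vector) \<Rightarrow> bool" where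
  "Q_linear \<equiv> Vector_Spaces.linear scaleQ scaleQ"

text \<open>Not \<open>ring_1\<close>, which would demand \<open>0 \<noteq> 1\<close> before the quotients below are formed.\<close>

class rat_algebra = rat_vector + ring + monoid_mult +
  assumes scaleQ_mult_left: "(r *\<^sub>Q x) * y = r *\<^sub>Q (x * y)"
    and scaleQ_mult_right: "x * (r *\<^sub>Q y) = r *\<^sub>Q (x * y)"

instantiation rat :: rat_algebra
begin
definition scaleQ_rat :: "rat \<Rightarrow> rat \<Rightarrow> rat" where "scaleQ_rat r x = r * x"
instance by standard (simp_all add: scaleQ_rat_def algebra_simps)
end

instantiation real :: rat_algebra
begin
definition scaleQ_real :: "rat \<Rightarrow> real \<Rightarrow> real" where "scaleQ_real r x = of_rat r * x"
instance by standard (simp_all add: scaleQ_real_def algebra_simps of_rat_add of_rat_mult)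
end

instantiation complex :: rat_algebra
begin
definition scaleQ_complex :: "rat \<Rightarrow> complex \<Rightarrow> complex" where "scaleQ_complex r x = of_rat r * x"
instance by standard (simp_all add: scaleQ_complex_def algebra_simps of_rat_add of_rat_mult)
end

instantiation poly_mapping :: (type, rat_vector) rat_vector
begin
definition scaleQ_poly_mapping :: "rat \<Rightarrow> ('a \<Rightarrow>\<^sub>0 'b) \<Rightarrow> ('a \<Rightarrow>\<^sub>0 'b)" where
  "scaleQ_poly_mapping r p = Poly_Mapping.map (scaleQ r) p"
lemma lookup_scaleQ [simp]:
  "Poly_Mapping.lookup (r *\<^sub>Q p) k = r *\<^sub>Q Poly_Mapping.lookup (p :: 'a \<Rightarrow>\<^sub>0 'b) k"
  by (simp add: scaleQ_poly_mapping_def map.rep_eq when_def)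
instance
  by standard (rule poly_mapping_eqI,
      simp add: lookup_add scaleQ_add_right scaleQ_add_left scaleQ_scaleQ scaleQ_one)+
end

lemma poly_mapping_additive_induct:
  fixes p :: "'a \<Rightarrow>\<^sub>0 'b::monoid_add"
  assumes "P 0" "\<And>k c. P (Poly_Mapping.single k c)" "\<And>p q. P p \<Longrightarrow> P q \<Longrightarrow> P (p + q)"
  shows "P p"
proof (induction p rule: update_induct)
  case const
  show ?case by (rule assms(1))
next
  case (update p k c)
  have "Poly_Mapping.update k c p = p + Poly_Mapping.single k c"
    using update(1)
    by (intro poly_mapping_eqI)
       (auto simp: lookup_update lookup_add lookup_single when_def in_keys_iff)
  then show ?case using assms(2,3) update(3) by simp
qed

lemma scaleQ_single:
  "r *\<^sub>Q Poly_Mapping.single k c = Poly_Mapping.single k (r *\<^sub>Q (c :: 'b::rat_vector))"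
  by (rule poly_mapping_eqI) (simp add: lookup_single when_def)

instance poly_mapping :: (monoid_add, "{rat_algebra, semiring_1}") rat_algebra
proof
  fix r :: rat and x y :: "'a \<Rightarrow>\<^sub>0 'b"
  show "(r *\<^sub>Q x) * y = r *\<^sub>Q (x * y)"
  proof (induction x rule: poly_mapping_additive_induct)
    case (2 k c)
    show ?case
      by (induction y rule: poly_mapping_additive_induct)
         (simp_all add: scaleQ_single mult_single scaleQ_mult_left distrib_left scaleQ_add_right)
  qed (simp_all add: scaleQ_add_right distrib_right)
  show "x * (r *\<^sub>Q y) = r *\<^sub>Q (x * y)"
  proof (induction x rule: poly_mapping_additive_induct)
    case (2 k c)
    show ?case
      by (induction y rule: poly_mapping_additive_induct)
         (simp_all add: scaleQ_single mult_single scaleQ_mult_right distrib_left scaleQ_add_right)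
  qed (simp_all add: scaleQ_add_right distrib_right)
qed

subsection \<open>Dual space and trace\<close>

typedef (overloaded) 'a rat_dual = "{f :: 'a::rat_vector \<Rightarrow> rat. Q_linear f}"
  by (rule exI[of _ "\<lambda>_. 0"])
     (auto simp: Vector_Spaces.linear_iff rat_vector.vector_space_axioms)

setup_lifting type_definition_rat_dual

lemma Q_linear_iff:
  "Q_linear f \<longleftrightarrow> (\<forall>x y. f (x + y) = f x + f y) \<and> (\<forall>c x. f (c *\<^sub>Q x) = c *\<^sub>Q f x)"
  by (auto simp: Vector_Spaces.linear_iff rat_vector.vector_space_axioms)

instantiation rat_dual :: (rat_vector) rat_vector
begin
lift_definition zero_rat_dual :: "'a rat_dual" is "\<lambda>_. 0"
  by (simp add: Q_linear_iff)
lift_definition plus_rat_dual :: "'a rat_dual \<Rightarrow> 'a rat_dual \<Rightarrow> 'a rat_dual" is "\<lambda>f g x. f x + g x"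
  by (simp add: Q_linear_iff scaleQ_add_right)
lift_definition uminus_rat_dual :: "'a rat_dual \<Rightarrow> 'a rat_dual" is "\<lambda>f x. - f x"
  by (simp add: Q_linear_iff)
lift_definition minus_rat_dual :: "'a rat_dual \<Rightarrow> 'a rat_dual \<Rightarrow> 'a rat_dual" is "\<lambda>f g x. f x - g x"
  by (simp add: Q_linear_iff rat_vector.scale_right_diff_distrib)
lift_definition scaleQ_rat_dual :: "rat \<Rightarrow> 'a rat_dual \<Rightarrow> 'a rat_dual" is "\<lambda>r f x. r *\<^sub>Q f x"
  by (simp add: Q_linear_iff scaleQ_add_right scaleQ_scaleQ mult.commute)
instance
  by standard (transfer; simp add: scaleQ_add_right scaleQ_add_left scaleQ_scaleQ scaleQ_one fun_eq_iff)+
end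

definition lin_trace :: "('a::rat_vector \<Rightarrow> 'a) \<Rightarrow> rat" where
  "lin_trace g =
    (let B = (SOME B. rat_vector.independent B \<and> rat_vector.span B = UNIV)
     in \<Sum>b\<in>B. rat_vector.representation B (g b) b)"

section \<open>Tensor products over the rationals\<close>

definition tensor_rels :: "(('a::rat_vector \<times> 'b::rat_vector) \<Rightarrow>\<^sub>0 rat) set" where
  "tensor_rels =
     {Poly_Mapping.single (a + a', b) 1 - Poly_Mapping.single (a, b) 1
        - Poly_Mapping.single (a', b) 1 | a a' b. True}
   \<union> {Poly_Mapping.single (a, b + b') 1 - Poly_Mapping.single (a, b) 1
        - Poly_Mapping.single (a, b') 1 | a b b'. True}
   \<union> {Poly_Mapping.single (r *\<^sub>Q a, b) 1 - Poly_Mapping.single (a, b) r | r a b. True}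
   \<union> {Poly_Mapping.single (a, r *\<^sub>Q b) 1 - Poly_Mapping.single (a, b) r | r a b. True}"

definition tensor_eq ::
  "(('a::rat_vector \<times> 'b::rat_vector) \<Rightarrow>\<^sub>0 rat) \<Rightarrow> (('a \<times> 'b) \<Rightarrow>\<^sub>0 rat) \<Rightarrow> bool" where
  "tensor_eq x y \<longleftrightarrow> x - y \<in> rat_vector.span tensor_rels"

quotient_type (overloaded) ('a, 'b) tensor =
  "('a::rat_vector \<times> 'b::rat_vector) \<Rightarrow>\<^sub>0 rat" / tensor_eq
proof (rule equivpI)
  show "reflp (tensor_eq :: ('a \<times> 'b \<Rightarrow>\<^sub>0 rat) \<Rightarrow> _)"
    by (simp add: reflp_def tensor_eq_def rat_vector.span_zero)
  show "symp (tensor_eq :: ('a \<times> 'b \<Rightarrow>\<^sub>0 rat) \<Rightarrow> _)"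
    unfolding symp_def tensor_eq_def by (auto dest: rat_vector.span_neg)
  show "transp (tensor_eq :: ('a \<times> 'b \<Rightarrow>\<^sub>0 rat) \<Rightarrow> _)"
    unfolding transp_def tensor_eq_def
    by (intro allI impI) (drule (1) rat_vector.span_add, simp)
qed

instantiation tensor :: (rat_vector, rat_vector) rat_vector
begin
lift_definition zero_tensor :: "('a, 'b) tensor" is 0 .
lift_definition plus_tensor :: "('a, 'b) tensor \<Rightarrow> ('a, 'b) tensor \<Rightarrow> ('a, 'b) tensor" is "(+)"
  unfolding tensor_eq_def by (drule (1) rat_vector.span_add) (simp add: algebra_simps)
lift_definition uminus_tensor :: "('a, 'b) tensor \<Rightarrow> ('a, 'b) tensor" is uminus
  unfolding tensor_eq_def by (drule rat_vector.span_neg) simp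
lift_definition minus_tensor :: "('a, 'b) tensor \<Rightarrow> ('a, 'b) tensor \<Rightarrow> ('a, 'b) tensor" is "(-)"
  unfolding tensor_eq_def by (drule (1) rat_vector.span_diff) (simp add: algebra_simps)
lift_definition scaleQ_tensor :: "rat \<Rightarrow> ('a, 'b) tensor \<Rightarrow> ('a, 'b) tensor" is scaleQ
  unfolding tensor_eq_def by (simp add: rat_vector.span_scale flip: rat_vector.scale_right_diff_distrib)
instance
proof
  fix a b c :: "('a, 'b) tensor" and r s :: rat
  have eq: "tensor_eq x y" if "x = y" for x y :: "'a \<times> 'b \<Rightarrow>\<^sub>0 rat"
    using that by (simp add: tensor_eq_def rat_vector.span_zero)
  show "a + b + c = a + (b + c)" by transfer (rule eq, simp add: algebra_simps)
  show "a + b = b + a" by transfer (rule eq, simp add: algebra_simps)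
  show "0 + a = a" by transfer (rule eq, simp)
  show "- a + a = 0" by transfer (rule eq, simp)
  show "a - b = a + - b" by transfer (rule eq, simp)
  show "r *\<^sub>Q (a + b) = r *\<^sub>Q a + r *\<^sub>Q b" by transfer (rule eq, rule scaleQ_add_right)
  show "(r + s) *\<^sub>Q a = r *\<^sub>Q a + s *\<^sub>Q a" by transfer (rule eq, rule scaleQ_add_left)
  show "r *\<^sub>Q (s *\<^sub>Q a) = (r * s) *\<^sub>Q a" by transfer (rule eq, rule scaleQ_scaleQ)
  show "1 *\<^sub>Q a = a" by transfer (rule eq, rule scaleQ_one)
qed
end

lift_definition pure_tensor :: "'a::rat_vector \<Rightarrow> 'b::rat_vector \<Rightarrow> ('a, 'b) tensor"
  is "\<lambda>a b. Poly_Mapping.single (a, b) 1" .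

definition tensor_lift ::
  "('a::rat_vector \<Rightarrow> 'b::rat_vector \<Rightarrow> 'c::rat_vector) \<Rightarrow> ('a, 'b) tensor \<Rightarrow> 'c" where
  "tensor_lift B = (THE h. Q_linear h \<and> (\<forall>a b. h (pure_tensor a b) = B a b))"

definition tensor_map ::
  "('a::rat_vector \<Rightarrow> 'c::rat_vector) \<Rightarrow> ('b::rat_vector \<Rightarrow> 'd::rat_vector)
    \<Rightarrow> ('a, 'b) tensor \<Rightarrow> ('c, 'd) tensor" where
  "tensor_map f g = tensor_lift (\<lambda>a b. pure_tensor (f a) (g b))"

lemma tensor_eqI: "x - y \<in> tensor_rels \<Longrightarrow> tensor_eq x y"
  unfolding tensor_eq_def by (rule rat_vector.span_base)

lemma pure_tensor_add_left: "pure_tensor (a + a') b = pure_tensor a b + pure_tensor a' b"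
  by transfer (rule tensor_eqI, unfold tensor_rels_def diff_diff_eq[symmetric], rule UnI1, rule UnI1, rule UnI1,
      intro CollectI exI conjI TrueI, rule refl)

lemma pure_tensor_add_right: "pure_tensor a (b + b') = pure_tensor a b + pure_tensor a b'"
  by transfer (rule tensor_eqI, unfold tensor_rels_def diff_diff_eq[symmetric], rule UnI1, rule UnI1, rule UnI2,
      intro CollectI exI conjI TrueI, rule refl)

lemma scaleQ_single_1: "r *\<^sub>Q Poly_Mapping.single k (1::rat) = Poly_Mapping.single k r"
  by (simp add: scaleQ_single scaleQ_rat_def)

lemma pure_tensor_scaleQ_left: "pure_tensor (r *\<^sub>Q a) b = r *\<^sub>Q pure_tensor a b"
  by transfer (rule tensor_eqI, unfold tensor_rels_def scaleQ_single_1, rule UnI1, rule UnI2,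
      intro CollectI exI conjI TrueI, rule refl)

lemma pure_tensor_scaleQ_right: "pure_tensor a (r *\<^sub>Q b) = r *\<^sub>Q pure_tensor a b"
  by transfer (rule tensor_eqI, unfold tensor_rels_def scaleQ_single_1, rule UnI2,
      intro CollectI exI conjI TrueI, rule refl)

lemma tensor_induct [case_names pure add]:
  fixes t :: "('a::rat_vector, 'b::rat_vector) tensor"
  assumes pure: "\<And>a b. P (pure_tensor a b)" and add: "\<And>s t. P s \<Longrightarrow> P t \<Longrightarrow> P (s + t)"
  shows "P t"
proof -
  have "P (abs_tensor p)" for p :: "'a \<times> 'b \<Rightarrow>\<^sub>0 rat"
  proof (induction p rule: poly_mapping_additive_induct)
    case 1
    have "abs_tensor 0 = pure_tensor (0 *\<^sub>Q 0 :: 'a) (0 :: 'b)"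
      unfolding pure_tensor_scaleQ_left by (simp add: zero_tensor_def)
    then show ?case using pure by simp
  next
    case (2 k c)
    have "abs_tensor (Poly_Mapping.single k c) = c *\<^sub>Q pure_tensor (fst k) (snd k)"
      by (simp add: pure_tensor.abs_eq scaleQ_tensor.abs_eq scaleQ_single scaleQ_rat_def)
    then show ?case using pure by (simp flip: pure_tensor_scaleQ_left)
  next
    case (3 p q)
    then show ?case using add by (simp flip: plus_tensor.abs_eq)
  qed
  from this[of "rep_tensor t"] show ?thesis
    by (simp only: Quotient_abs_rep[OF Quotient_tensor])
qed

definition Q_bilinear :: "('a::rat_vector \<Rightarrow> 'b::rat_vector \<Rightarrow> 'c::rat_vector) \<Rightarrow> bool" where
  "Q_bilinear B \<longleftrightarrow> (\<forall>a. Q_linear (B a)) \<and> (\<forall>b. Q_linear (\<lambda>a. B a b))"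

lemma tensor_universal:
  fixes B :: "'a::rat_vector \<Rightarrow> 'b::rat_vector \<Rightarrow> 'c::rat_vector"
  assumes "Q_bilinear B"
  shows "\<exists>!h. Q_linear h \<and> (\<forall>a b. h (pure_tensor a b) = B a b)"
proof -
  define h0 :: "('a \<times> 'b \<Rightarrow>\<^sub>0 rat) \<Rightarrow> 'c" where
    "h0 p = (\<Sum>k\<in>Poly_Mapping.keys p. Poly_Mapping.lookup p k *\<^sub>Q B (fst k) (snd k))" for p
  have h0_eq: "h0 p = (\<Sum>k\<in>K. Poly_Mapping.lookup p k *\<^sub>Q B (fst k) (snd k))"
    if "finite K" "Poly_Mapping.keys p \<subseteq> K" for p K
    unfolding h0_def using that by (intro sum.mono_neutral_left) (auto simp: in_keys_iff)
  have add: "h0 (p + q) = h0 p + h0 q" for p q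
  proof -
    let ?K = "Poly_Mapping.keys p \<union> Poly_Mapping.keys q"
    show ?thesis
      using Poly_Mapping.keys_add[of p q] h0_eq[of ?K p] h0_eq[of ?K q] h0_eq[of ?K "p + q"]
      by (simp add: lookup_add scaleQ_add_left sum.distrib)
  qed
  have scale: "h0 (r *\<^sub>Q p) = r *\<^sub>Q h0 p" for r p
  proof -
    have "Poly_Mapping.keys (r *\<^sub>Q p) \<subseteq> Poly_Mapping.keys p"
      by (auto simp: in_keys_iff)
    then show ?thesis
      using h0_eq[of "Poly_Mapping.keys p" "r *\<^sub>Q p"]
      by (simp add: h0_def rat_vector.scale_sum_right scaleQ_rat_def)
  qed
  have lin: "Q_linear h0" using add scale by (simp add: Q_linear_iff)
  interpret h0: Vector_Spaces.linear "scaleQ" "scaleQ" h0 by (fact lin)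
  have single: "h0 (Poly_Mapping.single k c) = c *\<^sub>Q B (fst k) (snd k)" for k c
    by (simp add: h0_def)
  have rels: "h0 p = 0" if "p \<in> tensor_rels" for p
    using that assms
    by (auto simp: tensor_rels_def h0.diff single Q_bilinear_def Q_linear_iff scaleQ_add_right)
  have "h0 p = 0" if "p \<in> rat_vector.span tensor_rels" for p
    using that by (induction rule: rat_vector.span_induct_alt) (simp_all add: add scale rels h0.zero)
  then have resp: "h0 p = h0 q" if "tensor_eq p q" for p q
    using that h0.diff[of p q] by (simp add: tensor_eq_def)
  define h where "h t = h0 (rep_tensor t)" for t :: "('a, 'b) tensor"
  have h_abs: "h (abs_tensor p) = h0 p" for p
    unfolding h_def
    by (rule resp)
       (rule Quotient_rep_abs[OF Quotient_tensor], simp add: tensor_eq_def rat_vector.span_zero)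
  have surj: "\<exists>p. t = abs_tensor p" for t :: "('a, 'b) tensor"
    by (rule exI[of _ "rep_tensor t"]) (simp only: Quotient_abs_rep[OF Quotient_tensor])
  have "h (s + t) = h s + h t" for s t
    using surj[of s] surj[of t] by (auto simp: plus_tensor.abs_eq h_abs add)
  moreover have "h (r *\<^sub>Q t) = r *\<^sub>Q h t" for r t
    using surj[of t] by (auto simp: scaleQ_tensor.abs_eq h_abs scale)
  moreover have "h (pure_tensor a b) = B a b" for a b
    by (simp add: pure_tensor.abs_eq h_abs single)
  ultimately have "Q_linear h \<and> (\<forall>a b. h (pure_tensor a b) = B a b)"
    by (simp add: Q_linear_iff)
  moreover have "g = g'"
    if "Q_linear g \<and> (\<forall>a b. g (pure_tensor a b) = B a b)"
      "Q_linear g' \<and> (\<forall>a b. g' (pure_tensor a b) = B a b)" for g g'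
  proof
    fix t show "g t = g' t"
      using that by (induction t rule: tensor_induct) (auto simp: Q_linear_iff)
  qed
  ultimately show ?thesis by blast
qed

lemma tensor_lift:
  assumes "Q_bilinear B"
  shows Q_linear_tensor_lift: "Q_linear (tensor_lift B)"
    and tensor_lift_pure: "tensor_lift B (pure_tensor a b) = B a b"
  using theI'[OF tensor_universal[OF assms]] unfolding tensor_lift_def by blast+

lemma tensor_map:
  assumes "Q_linear f" "Q_linear g"
  shows Q_linear_tensor_map: "Q_linear (tensor_map f g)"
    and tensor_map_pure: "tensor_map f g (pure_tensor a b) = pure_tensor (f a) (g b)"
proof -
  have "Q_bilinear (\<lambda>a b. pure_tensor (f a) (g b))"
    using assms
    by (simp add: Q_bilinear_def Q_linear_iff pure_tensor_add_left pure_tensor_add_right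
        pure_tensor_scaleQ_left pure_tensor_scaleQ_right)
  then show "Q_linear (tensor_map f g)"
    and "tensor_map f g (pure_tensor a b) = pure_tensor (f a) (g b)"
    unfolding tensor_map_def by (rule tensor_lift)+
qed

subsection \<open>Extension of scalars\<close>

type_synonym 'a real_ext = "('a, real) tensor"
type_synonym 'a complex_ext = "('a, complex) tensor"

definition ext_scale ::
  "'k::rat_algebra \<Rightarrow> ('a::rat_vector, 'k) tensor \<Rightarrow> ('a, 'k) tensor" where
  "ext_scale c = tensor_map id ((*) c)"

lemma ext_scale_linear:
  fixes c :: "'k::rat_algebra"
  shows Q_linear_ext_scale: "Q_linear (ext_scale c :: ('a::rat_vector, 'k) tensor \<Rightarrow> _)"
    and ext_scale_pure: "ext_scale c (pure_tensor (a :: 'a) b) = pure_tensor a (c * b)"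
proof -
  have "Q_linear (id :: 'a \<Rightarrow> 'a)" "Q_linear ((*) c)"
    by (simp_all add: Q_linear_iff distrib_left scaleQ_mult_right)
  from tensor_map[OF this] show "Q_linear (ext_scale c :: ('a, 'k) tensor \<Rightarrow> _)"
    and "ext_scale c (pure_tensor (a :: 'a) b) = pure_tensor a (c * b)"
    by (simp_all add: ext_scale_def)
qed

lemma vector_space_ext_scale:
  "vector_space (ext_scale :: 'k::{rat_algebra,field} \<Rightarrow> ('a::rat_vector, 'k) tensor \<Rightarrow> _)"
proof
  fix c d :: 'k and x y :: "('a, 'k) tensor"
  show add: "ext_scale c (x + y) = ext_scale c x + ext_scale c y"
    for c :: 'k and x y :: "('a, 'k) tensor"
    using Q_linear_ext_scale[of c, where 'a = 'a] by (simp add: Q_linear_iff)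
  show "ext_scale (c + d) x = ext_scale c x + ext_scale d x"
    by (induction x rule: tensor_induct)
       (simp_all add: ext_scale_pure distrib_right pure_tensor_add_right add)
  show "ext_scale c (ext_scale d x) = ext_scale (c * d) x"
    by (induction x rule: tensor_induct) (simp_all add: ext_scale_pure mult.assoc add)
  show "ext_scale 1 x = x"
    by (induction x rule: tensor_induct) (simp_all add: ext_scale_pure add)
qed

definition ext_bilin ::
  "('a::rat_vector \<Rightarrow> 'b::rat_vector \<Rightarrow> 'c::rat_vector)
    \<Rightarrow> ('a, 'k::rat_algebra) tensor \<Rightarrow> ('b, 'k) tensor \<Rightarrow> ('c, 'k) tensor" where
  "ext_bilin B x y =
     tensor_lift (\<lambda>a r. tensor_lift (\<lambda>b s. pure_tensor (B a b) (r * s)) y) x"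

definition ext_form ::
  "('a::rat_vector \<Rightarrow> 'b::rat_vector \<Rightarrow> rat)
    \<Rightarrow> ('a, 'k::rat_algebra) tensor \<Rightarrow> ('b, 'k) tensor \<Rightarrow> 'k" where
  "ext_form B x y = tensor_lift (\<lambda>a r. tensor_lift (\<lambda>b s. B a b *\<^sub>Q (r * s)) y) x"

definition real_to_complex :: "'a::rat_vector real_ext \<Rightarrow> 'a complex_ext" where
  "real_to_complex = tensor_map id complex_of_real"

definition ext_cnj :: "'a::rat_vector complex_ext \<Rightarrow> 'a complex_ext" where
  "ext_cnj = tensor_map id cnj"

section \<open>Hodge structures of K3 type\<close>

class quadratic_space = rat_vector +
  fixes qform :: "'a \<Rightarrow> 'a \<Rightarrow> rat"
  assumes qform_sym: "qform x y = qform y x"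
    and qform_add_left: "qform (x + y) z = qform x z + qform y z"
    and qform_scaleQ_left: "qform (r *\<^sub>Q x) y = r * qform x y"

definition hodge_structure ::
  "int \<Rightarrow> (int \<Rightarrow> int \<Rightarrow> 'v::rat_vector complex_ext set) \<Rightarrow> bool" where
  "hodge_structure n H \<longleftrightarrow>
     (\<exists>B :: 'v set. finite B \<and> rat_vector.span B = UNIV) \<and>
     (\<forall>a b. module.subspace ext_scale (H a b)) \<and>
     (\<forall>a b. a + b \<noteq> n \<longrightarrow> H a b = {0}) \<and>
     (\<forall>a b. ext_cnj ` H a b = H b a) \<and>
     (\<forall>x. \<exists>!c. (\<forall>a. c a \<in> H a (n - a)) \<and> finite {a. c a \<noteq> 0} \<and> x = (\<Sum>a | c a \<noteq> 0. c a))"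

definition hodge_morphism ::
  "(int \<Rightarrow> int \<Rightarrow> 'v::rat_vector complex_ext set) \<Rightarrow> (int \<Rightarrow> int \<Rightarrow> 'w::rat_vector complex_ext set)
    \<Rightarrow> ('v \<Rightarrow> 'w) \<Rightarrow> bool" where
  "hodge_morphism H H' f \<longleftrightarrow> Q_linear f \<and> (\<forall>a b. tensor_map f id ` H a b \<subseteq> H' a b)"

text \<open>The component of type \<open>(a, b)\<close> of \<open>\<rat>(k)\<close>, as a subset of \<open>\<rat>(k) \<otimes> \<complex> = \<complex>\<close>.\<close>

definition tate :: "int \<Rightarrow> int \<Rightarrow> int \<Rightarrow> complex set" where
  "tate k a b = (if a = - k \<and> b = - k then UNIV else {0})"

text \<open>A bilinear form is a morphism \<open>V \<otimes> V \<rightarrow> \<rat>(k)\<close>: recall that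
  \<open>(V \<otimes> V)\<^bsup>m,n\<^esup>\<close> is the sum of the \<open>V\<^bsup>a,b\<^esup> \<otimes> V\<^bsup>c,d\<^esup>\<close> with \<open>a + c = m\<close> and \<open>b + d = n\<close>.\<close>

definition hodge_pairing ::
  "(int \<Rightarrow> int \<Rightarrow> 'v::rat_vector complex_ext set) \<Rightarrow> int \<Rightarrow> ('v \<Rightarrow> 'v \<Rightarrow> rat) \<Rightarrow> bool" where
  "hodge_pairing H k B \<longleftrightarrow>
     (\<forall>a b c d. \<forall>x \<in> H a b. \<forall>y \<in> H c d. ext_form B x y \<in> tate k (a + c) (b + d))"

definition has_signature ::
  "('v::rat_vector real_ext \<Rightarrow> 'v real_ext \<Rightarrow> real) \<Rightarrow> nat \<Rightarrow> nat \<Rightarrow> bool" where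
  "has_signature B m n \<longleftrightarrow>
     (\<exists>P N. finite P \<and> finite N \<and> P \<inter> N = {} \<and> card P = m \<and> card N = n \<and>
        \<not> module.dependent ext_scale (P \<union> N) \<and> module.span ext_scale (P \<union> N) = UNIV \<and>
        (\<forall>x \<in> P \<union> N. \<forall>y \<in> P \<union> N. x \<noteq> y \<longrightarrow> B x y = 0) \<and>
        (\<forall>x \<in> P. B x x > 0) \<and> (\<forall>x \<in> N. B x x < 0))"

definition hodge_plane ::
  "(int \<Rightarrow> int \<Rightarrow> 'v::rat_vector complex_ext set) \<Rightarrow> 'v real_ext set" where
  "hodge_plane H = {x. \<exists>s \<in> H 2 0. \<exists>t \<in> H 0 2. real_to_complex x = s + t}"

definition polarized_K3_type ::
  "(int \<Rightarrow> int \<Rightarrow> 'v::quadratic_space complex_ext set) \<Rightarrow> bool" where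
  "polarized_K3_type H \<longleftrightarrow>
     hodge_structure 2 H \<and>
     vector_space.dim ext_scale (H 2 0) = 1 \<and>
     (\<forall>a b. \<bar>a - b\<bar> > 2 \<longrightarrow> H a b = {0}) \<and>
     hodge_pairing H (- 2) qform \<and>
     (\<forall>x \<in> hodge_plane H. x \<noteq> 0 \<longrightarrow> ext_form qform x x < 0) \<and>
     has_signature (ext_form qform :: 'v real_ext \<Rightarrow> _) (rat_vector.dim (UNIV :: 'v set) - 2) 2"

definition hodge_similarity ::
  "(int \<Rightarrow> int \<Rightarrow> 'v::quadratic_space complex_ext set)
    \<Rightarrow> (int \<Rightarrow> int \<Rightarrow> 'w::quadratic_space complex_ext set) \<Rightarrow> ('v \<Rightarrow> 'w) \<Rightarrow> bool" where
  "hodge_similarity H H' \<psi> \<longleftrightarrow>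
     bij \<psi> \<and> hodge_morphism H H' \<psi> \<and> hodge_morphism H' H (inv_into UNIV \<psi>) \<and>
     (\<exists>\<mu>. \<mu> \<noteq> 0 \<and> (\<forall>v w. qform (\<psi> v) (\<psi> w) = \<mu> * qform v w))"

section \<open>Tensor algebra and even Clifford algebra\<close>

inductive_set ideal_gen :: "'a::ring set \<Rightarrow> 'a set" for S where
  zero: "0 \<in> ideal_gen S"
| add: "s \<in> S \<Longrightarrow> x \<in> ideal_gen S \<Longrightarrow> a * s * b + x \<in> ideal_gen S"

lemma ideal_gen_plus: "x \<in> ideal_gen S \<Longrightarrow> y \<in> ideal_gen S \<Longrightarrow> x + y \<in> ideal_gen S"
  by (induction rule: ideal_gen.induct) (auto simp: add.assoc intro: ideal_gen.add)

lemma ideal_gen_mult_left: "x \<in> ideal_gen S \<Longrightarrow> c * x \<in> ideal_gen S"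
proof (induction rule: ideal_gen.induct)
  case (add s x a b)
  have "c * (a * s * b + x) = (c * a) * s * b + c * x" by (simp add: algebra_simps)
  then show ?case using add by (simp only: ideal_gen.add)
qed (simp add: ideal_gen.zero)

lemma ideal_gen_mult_right: "x \<in> ideal_gen S \<Longrightarrow> x * c \<in> ideal_gen S"
proof (induction rule: ideal_gen.induct)
  case (add s x a b)
  have "(a * s * b + x) * c = a * s * (b * c) + x * c" by (simp add: algebra_simps)
  then show ?case using add by (simp only: ideal_gen.add)
qed (simp add: ideal_gen.zero)

lemma ideal_gen_minus: "x \<in> ideal_gen S \<Longrightarrow> - x \<in> ideal_gen S"
proof (induction rule: ideal_gen.induct)
  case (add s x a b)
  have "- (a * s * b + x) = (- a) * s * b + - x" by simp
  then show ?case using add by (simp only: ideal_gen.add)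
qed (simp add: ideal_gen.zero)

lemma ideal_gen_diff: "x \<in> ideal_gen S \<Longrightarrow> y \<in> ideal_gen S \<Longrightarrow> x - y \<in> ideal_gen S"
  using ideal_gen_plus[of x S "- y"] ideal_gen_minus[of y S] by simp

lemma ideal_gen_mult_cong:
  assumes "x - x' \<in> ideal_gen S" "y - y' \<in> ideal_gen S"
  shows "x * y - x' * y' \<in> ideal_gen S"
proof -
  have "x * y - x' * y' = (x - x') * y + x' * (y - y')" by (simp add: algebra_simps)
  with assms show ?thesis
    by (simp only: ideal_gen_plus ideal_gen_mult_left ideal_gen_mult_right)
qed

lemma equivp_ideal_gen: "equivp (\<lambda>x y. x - y \<in> ideal_gen S)"
proof (rule equivpI)
  show "reflp (\<lambda>x y. x - y \<in> ideal_gen S)" by (simp add: reflp_def ideal_gen.zero)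
  show "symp (\<lambda>x y. x - y \<in> ideal_gen S)"
    unfolding symp_def by (auto dest: ideal_gen_minus)
  show "transp (\<lambda>x y. x - y \<in> ideal_gen S)"
    unfolding transp_def by (intro allI impI) (drule (1) ideal_gen_plus, simp)
qed

datatype 'v word = Word (letters: "'v list")

instantiation word :: (type) monoid_add
begin
definition "0 = Word []"
definition "u + w = Word (letters u @ letters w)"
instance by standard (simp_all add: zero_word_def plus_word_def)
end

lemma ideal_gen_scaleQ:
  fixes x :: "'a::rat_algebra"
  shows "x \<in> ideal_gen S \<Longrightarrow> r *\<^sub>Q x \<in> ideal_gen S"
  using ideal_gen_mult_left[of x S "r *\<^sub>Q 1"] by (simp add: scaleQ_mult_left)

definition letter :: "'v \<Rightarrow> ('v word \<Rightarrow>\<^sub>0 rat)" where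
  "letter v = Poly_Mapping.single (Word [v]) 1"

definition linearity_rels :: "('v::rat_vector word \<Rightarrow>\<^sub>0 rat) set" where
  "linearity_rels = {letter (v + w) - letter v - letter w | v w. True}
     \<union> {letter (r *\<^sub>Q v) - r *\<^sub>Q letter v | r v. True}"

definition tensor_alg_eq ::
  "('v::rat_vector word \<Rightarrow>\<^sub>0 rat) \<Rightarrow> ('v word \<Rightarrow>\<^sub>0 rat) \<Rightarrow> bool" where
  "tensor_alg_eq x y \<longleftrightarrow> x - y \<in> ideal_gen linearity_rels"

text \<open>The free rational vector space on the words of length \<open>n\<close> modulo multilinearity is the
  \<open>n\<close>-th tensor power of \<open>V\<close>; concatenation of words is the tensor product of tensors.\<close>

quotient_type (overloaded) 'v tensor_alg = "'v::rat_vector word \<Rightarrow>\<^sub>0 rat" / tensor_alg_eq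
  unfolding tensor_alg_eq_def[abs_def] by (rule equivp_ideal_gen)

instantiation tensor_alg :: (rat_vector) rat_algebra
begin
lift_definition zero_tensor_alg :: "'a tensor_alg" is 0 .
lift_definition one_tensor_alg :: "'a tensor_alg" is 1 .
lift_definition plus_tensor_alg :: "'a tensor_alg \<Rightarrow> 'a tensor_alg \<Rightarrow> 'a tensor_alg" is "(+)"
  unfolding tensor_alg_eq_def by (drule (1) ideal_gen_plus) (simp add: algebra_simps)
lift_definition uminus_tensor_alg :: "'a tensor_alg \<Rightarrow> 'a tensor_alg" is uminus
  unfolding tensor_alg_eq_def by (drule ideal_gen_minus) simp
lift_definition minus_tensor_alg :: "'a tensor_alg \<Rightarrow> 'a tensor_alg \<Rightarrow> 'a tensor_alg" is "(-)"
  unfolding tensor_alg_eq_def by (drule (1) ideal_gen_diff) (simp add: algebra_simps)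
lift_definition times_tensor_alg :: "'a tensor_alg \<Rightarrow> 'a tensor_alg \<Rightarrow> 'a tensor_alg" is "(*)"
  unfolding tensor_alg_eq_def by (rule ideal_gen_mult_cong)
lift_definition scaleQ_tensor_alg :: "rat \<Rightarrow> 'a tensor_alg \<Rightarrow> 'a tensor_alg" is scaleQ
  unfolding tensor_alg_eq_def by (simp add: ideal_gen_scaleQ flip: rat_vector.scale_right_diff_distrib)
instance
proof
  fix a b c :: "'a tensor_alg" and r s :: rat
  have eq: "tensor_alg_eq x y" if "x = y" for x y :: "'a word \<Rightarrow>\<^sub>0 rat"
    using that by (simp add: tensor_alg_eq_def ideal_gen.zero)
  show "a + b + c = a + (b + c)" by transfer (rule eq, simp add: algebra_simps)
  show "a + b = b + a" by transfer (rule eq, simp add: algebra_simps)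
  show "0 + a = a" by transfer (rule eq, simp)
  show "- a + a = 0" by transfer (rule eq, simp)
  show "a - b = a + - b" by transfer (rule eq, simp)
  show "r *\<^sub>Q (a + b) = r *\<^sub>Q a + r *\<^sub>Q b" by transfer (rule eq, rule scaleQ_add_right)
  show "(r + s) *\<^sub>Q a = r *\<^sub>Q a + s *\<^sub>Q a" by transfer (rule eq, rule scaleQ_add_left)
  show "r *\<^sub>Q (s *\<^sub>Q a) = (r * s) *\<^sub>Q a" by transfer (rule eq, rule scaleQ_scaleQ)
  show "1 *\<^sub>Q a = a" by transfer (rule eq, rule scaleQ_one)
  show "a * b * c = a * (b * c)" by transfer (rule eq, rule mult.assoc)
  show "1 * a = a" by transfer (rule eq, simp)
  show "a * 1 = a" by transfer (rule eq, simp)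
  show "(a + b) * c = a * c + b * c" by transfer (rule eq, rule distrib_right)
  show "a * (b + c) = a * b + a * c" by transfer (rule eq, rule distrib_left)
  show "(r *\<^sub>Q a) * b = r *\<^sub>Q (a * b)" by transfer (rule eq, rule scaleQ_mult_left)
  show "a * (r *\<^sub>Q b) = r *\<^sub>Q (a * b)" by transfer (rule eq, rule scaleQ_mult_right)
qed
end

lift_definition tensor_gen :: "'v::rat_vector \<Rightarrow> 'v tensor_alg" is letter .

definition clifford_rels :: "'v::quadratic_space tensor_alg set" where
  "clifford_rels = {tensor_gen v * tensor_gen v - qform v v *\<^sub>Q 1 | v. True}"

definition clifford_eq :: "'v::quadratic_space tensor_alg \<Rightarrow> 'v tensor_alg \<Rightarrow> bool" where
  "clifford_eq x y \<longleftrightarrow> x - y \<in> ideal_gen clifford_rels"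

quotient_type (overloaded) 'v clifford = "'v::quadratic_space tensor_alg" / clifford_eq
  unfolding clifford_eq_def[abs_def] by (rule equivp_ideal_gen)

instantiation clifford :: (quadratic_space) rat_algebra
begin
lift_definition zero_clifford :: "'a clifford" is 0 .
lift_definition one_clifford :: "'a clifford" is 1 .
lift_definition plus_clifford :: "'a clifford \<Rightarrow> 'a clifford \<Rightarrow> 'a clifford" is "(+)"
  unfolding clifford_eq_def by (drule (1) ideal_gen_plus) (simp add: algebra_simps)
lift_definition uminus_clifford :: "'a clifford \<Rightarrow> 'a clifford" is uminus
  unfolding clifford_eq_def by (drule ideal_gen_minus) simp
lift_definition minus_clifford :: "'a clifford \<Rightarrow> 'a clifford \<Rightarrow> 'a clifford" is "(-)"
  unfolding clifford_eq_def by (drule (1) ideal_gen_diff) (simp add: algebra_simps)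
lift_definition times_clifford :: "'a clifford \<Rightarrow> 'a clifford \<Rightarrow> 'a clifford" is "(*)"
  unfolding clifford_eq_def by (rule ideal_gen_mult_cong)
lift_definition scaleQ_clifford :: "rat \<Rightarrow> 'a clifford \<Rightarrow> 'a clifford" is scaleQ
  unfolding clifford_eq_def by (simp add: ideal_gen_scaleQ flip: rat_vector.scale_right_diff_distrib)
instance
proof
  fix a b c :: "'a clifford" and r s :: rat
  have eq: "clifford_eq x y" if "x = y" for x y :: "'a tensor_alg"
    using that by (simp add: clifford_eq_def ideal_gen.zero)
  show "a + b + c = a + (b + c)" by transfer (rule eq, simp add: algebra_simps)
  show "a + b = b + a" by transfer (rule eq, simp add: algebra_simps)
  show "0 + a = a" by transfer (rule eq, simp)
  show "- a + a = 0" by transfer (rule eq, simp)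
  show "a - b = a + - b" by transfer (rule eq, simp)
  show "r *\<^sub>Q (a + b) = r *\<^sub>Q a + r *\<^sub>Q b" by transfer (rule eq, rule scaleQ_add_right)
  show "(r + s) *\<^sub>Q a = r *\<^sub>Q a + s *\<^sub>Q a" by transfer (rule eq, rule scaleQ_add_left)
  show "r *\<^sub>Q (s *\<^sub>Q a) = (r * s) *\<^sub>Q a" by transfer (rule eq, rule scaleQ_scaleQ)
  show "1 *\<^sub>Q a = a" by transfer (rule eq, rule scaleQ_one)
  show "a * b * c = a * (b * c)" by transfer (rule eq, rule mult.assoc)
  show "1 * a = a" by transfer (rule eq, simp)
  show "a * 1 = a" by transfer (rule eq, simp)
  show "(a + b) * c = a * c + b * c" by transfer (rule eq, rule distrib_right)
  show "a * (b + c) = a * b + a * c" by transfer (rule eq, rule distrib_left)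
  show "(r *\<^sub>Q a) * b = r *\<^sub>Q (a * b)" by transfer (rule eq, rule scaleQ_mult_left)
  show "a * (r *\<^sub>Q b) = r *\<^sub>Q (a * b)" by transfer (rule eq, rule scaleQ_mult_right)
qed
end

lift_definition clifford_gen :: "'v::quadratic_space \<Rightarrow> 'v clifford" is tensor_gen .

definition clifford_word :: "'v::quadratic_space list \<Rightarrow> 'v clifford" where
  "clifford_word vs = prod_list (map clifford_gen vs)"

lemma clifford_word_append: "clifford_word (us @ vs) = clifford_word us * clifford_word vs"
  by (simp add: clifford_word_def)

definition even_part :: "'v::quadratic_space clifford set" where
  "even_part = rat_vector.span (clifford_word ` {vs. even (length vs)})"

lemma even_part_word: "even (length vs) \<Longrightarrow> clifford_word vs \<in> even_part"
  unfolding even_part_def by (rule rat_vector.span_base) simp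

lemma even_part_one: "1 \<in> even_part"
  using even_part_word[of "[]"] by (simp add: clifford_word_def)

lemma even_part_conj:
  assumes "even (length us + length vs)" "y \<in> even_part"
  shows "clifford_word us * y * clifford_word vs \<in> even_part"
  using assms(2) unfolding even_part_def
proof (induction rule: rat_vector.span_induct_alt)
  case base
  then show ?case by (simp add: rat_vector.span_zero)
next
  case (step c x y)
  then obtain ws where ws: "x = clifford_word ws" "even (length ws)" by auto
  have "clifford_word us * x * clifford_word vs \<in> even_part"
    using even_part_word[of "us @ ws @ vs"] assms(1) ws
    by (simp add: clifford_word_append mult.assoc)
  then show ?case using step
    by (simp add: even_part_def algebra_simps scaleQ_mult_left scaleQ_mult_right
        rat_vector.span_add rat_vector.span_scale)
qed

lemma even_part_mult:
  assumes "x \<in> even_part" "y \<in> even_part"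
  shows "x * y \<in> even_part"
  using assms(1) unfolding even_part_def
proof (induction rule: rat_vector.span_induct_alt)
  case base
  then show ?case by (simp add: rat_vector.span_zero)
next
  case (step c x z)
  then obtain ws where ws: "x = clifford_word ws" "even (length ws)" by auto
  have "x * y \<in> even_part"
    using even_part_conj[of ws "[]" y] assms(2) ws by (simp add: clifford_word_def)
  then show ?case using step
    by (simp add: even_part_def algebra_simps scaleQ_mult_left
        rat_vector.span_add rat_vector.span_scale)
qed

typedef (overloaded) 'v even_clifford = "even_part :: 'v::quadratic_space clifford set"
  using even_part_one by blast

setup_lifting type_definition_even_clifford

instantiation even_clifford :: (quadratic_space) rat_algebra
begin
lift_definition zero_even_clifford :: "'a even_clifford" is 0
  by (simp add: even_part_def rat_vector.span_zero)
lift_definition one_even_clifford :: "'a even_clifford" is 1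
  by (rule even_part_one)
lift_definition plus_even_clifford :: "'a even_clifford \<Rightarrow> 'a even_clifford \<Rightarrow> 'a even_clifford" is "(+)"
  by (simp add: even_part_def rat_vector.span_add)
lift_definition uminus_even_clifford :: "'a even_clifford \<Rightarrow> 'a even_clifford" is uminus
  by (simp add: even_part_def rat_vector.span_neg)
lift_definition minus_even_clifford :: "'a even_clifford \<Rightarrow> 'a even_clifford \<Rightarrow> 'a even_clifford" is "(-)"
  by (simp add: even_part_def rat_vector.span_diff)
lift_definition times_even_clifford :: "'a even_clifford \<Rightarrow> 'a even_clifford \<Rightarrow> 'a even_clifford" is "(*)"
  by (rule even_part_mult)
lift_definition scaleQ_even_clifford :: "rat \<Rightarrow> 'a even_clifford \<Rightarrow> 'a even_clifford" is scaleQ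
  by (simp add: even_part_def rat_vector.span_scale)
instance
  by standard (transfer; simp add: algebra_simps scaleQ_add_right scaleQ_add_left scaleQ_scaleQ
      scaleQ_one scaleQ_mult_left scaleQ_mult_right)+
end

lift_definition vec_mult :: "'v::quadratic_space \<Rightarrow> 'v \<Rightarrow> 'v even_clifford"
  is "\<lambda>v w. clifford_gen v * clifford_gen w"
  subgoal for v w using even_part_word[of "[v, w]"] by (simp add: clifford_word_def) .

lift_definition vec_sandwich :: "'v::quadratic_space \<Rightarrow> 'v even_clifford \<Rightarrow> 'v \<Rightarrow> 'v even_clifford"
  is "\<lambda>v x u. clifford_gen v * x * clifford_gen u"
  subgoal for v x u using even_part_conj[of "[v]" "[u]" x] by (simp add: clifford_word_def) .

definition even_word :: "'v::quadratic_space list \<Rightarrow> 'v even_clifford" where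
  "even_word vs = Abs_even_clifford (clifford_word vs)"

definition even_rev :: "'v::quadratic_space even_clifford \<Rightarrow> 'v even_clifford" where
  "even_rev = (THE g. Q_linear g \<and>
     (\<forall>vs. even (length vs) \<longrightarrow> g (even_word vs) = even_word (rev vs)))"

section \<open>Complex tori and isogenies\<close>

text \<open>A torus is given by a rational vector space, a lattice \<open>L\<close> in it and a complex structure \<open>J\<close>
  on its real extension.\<close>

definition rat_lattice :: "'a::rat_vector set \<Rightarrow> bool" where
  "rat_lattice L \<longleftrightarrow> (\<exists>B. finite B \<and> rat_vector.independent B \<and> rat_vector.span B = UNIV \<and>
     L = {\<Sum>b\<in>B. of_int (n b) *\<^sub>Q b | n :: 'a \<Rightarrow> int. True})"

definition additive_group :: "'a::ab_group_add monoid" where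
  "additive_group = \<lparr>carrier = UNIV, monoid.mult = (+), one = 0\<rparr>"

definition lattice_image :: "'a::rat_vector set \<Rightarrow> 'a real_ext set" where
  "lattice_image L = (\<lambda>x. pure_tensor x 1) ` L"

definition torus :: "'a::rat_vector set \<Rightarrow> 'a real_ext set monoid" where
  "torus L = additive_group Mod lattice_image L"

definition torus_proj :: "'a::rat_vector set \<Rightarrow> 'a real_ext \<Rightarrow> 'a real_ext set" where
  "torus_proj L x = r_coset additive_group (lattice_image L) x"

text \<open>Holomorphic homomorphisms are those that lift to complex linear maps of universal covers.\<close>

definition torus_lift ::
  "'a::rat_vector set \<Rightarrow> ('a real_ext \<Rightarrow> 'a real_ext) \<Rightarrow>
   'b::rat_vector set \<Rightarrow> ('b real_ext \<Rightarrow> 'b real_ext) \<Rightarrow>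
   ('a real_ext set \<Rightarrow> 'b real_ext set) \<Rightarrow> ('a real_ext \<Rightarrow> 'b real_ext) \<Rightarrow> bool" where
  "torus_lift L J L' J' f F \<longleftrightarrow>
     Vector_Spaces.linear ext_scale ext_scale F \<and> (\<forall>x. F (J x) = J' (F x)) \<and>
     (\<forall>x. f (torus_proj L x) = torus_proj L' (F x))"

definition isogeny ::
  "'a::rat_vector set \<Rightarrow> ('a real_ext \<Rightarrow> 'a real_ext) \<Rightarrow>
   'b::rat_vector set \<Rightarrow> ('b real_ext \<Rightarrow> 'b real_ext) \<Rightarrow>
   ('a real_ext set \<Rightarrow> 'b real_ext set) \<Rightarrow> bool" where
  "isogeny L J L' J' f \<longleftrightarrow>
     f \<in> hom (torus L) (torus L') \<and> (\<exists>F. torus_lift L J L' J' f F) \<and>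
     f ` carrier (torus L) = carrier (torus L') \<and>
     finite (kernel (torus L) (torus L') f)"

text \<open>\<open>H\<^sub>1(T, \<rat>) = L \<otimes> \<rat>\<close> is the ambient rational vector space, and \<open>H\<^sup>1(T, \<rat>)\<close> is its dual.
  The isomorphism \<open>f\<^sub>*\<close> on \<open>H\<^sup>1\<close> induced by an isogeny \<open>f\<close> is the inverse of the pullback.\<close>

definition H1_homology_map ::
  "'a::rat_vector set \<Rightarrow> ('a real_ext \<Rightarrow> 'a real_ext) \<Rightarrow>
   'b::rat_vector set \<Rightarrow> ('b real_ext \<Rightarrow> 'b real_ext) \<Rightarrow>
   ('a real_ext set \<Rightarrow> 'b real_ext set) \<Rightarrow> 'a \<Rightarrow> 'b" where
  "H1_homology_map L J L' J' f =
     (THE g. Q_linear g \<and>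
        (\<forall>x. pure_tensor (g x) 1 = (THE F. torus_lift L J L' J' f F) (pure_tensor x 1)))"

definition dual_map :: "('a::rat_vector \<Rightarrow> 'b::rat_vector) \<Rightarrow> 'b rat_dual \<Rightarrow> 'a rat_dual" where
  "dual_map g h = Abs_rat_dual (\<lambda>x. Rep_rat_dual h (g x))"

definition H1_push ::
  "'a::rat_vector set \<Rightarrow> ('a real_ext \<Rightarrow> 'a real_ext) \<Rightarrow>
   'b::rat_vector set \<Rightarrow> ('b real_ext \<Rightarrow> 'b real_ext) \<Rightarrow>
   ('a real_ext set \<Rightarrow> 'b real_ext set) \<Rightarrow> 'a rat_dual \<Rightarrow> 'b rat_dual" where
  "H1_push L J L' J' f = inv_into UNIV (dual_map (H1_homology_map L J L' J' f))"

section \<open>The Kuga--Satake construction\<close>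

text \<open>Orientation: \<open>e\<^sub>1 + \<i> e\<^sub>2\<close> lies in \<open>V\<^bsup>2,0\<^esup>\<close>.\<close>

definition hodge_frame ::
  "(int \<Rightarrow> int \<Rightarrow> 'v::quadratic_space complex_ext set) \<Rightarrow> 'v real_ext \<Rightarrow> 'v real_ext \<Rightarrow> bool" where
  "hodge_frame H e1 e2 \<longleftrightarrow>
     module.span ext_scale {e1, e2} = hodge_plane H \<and>
     ext_form qform e1 e2 = 0 \<and> ext_form qform e1 e1 = - 1 \<and> ext_form qform e2 e2 = - 1 \<and>
     real_to_complex e1 + ext_scale \<i> (real_to_complex e2) \<in> H 2 0"

definition KS_J ::
  "(int \<Rightarrow> int \<Rightarrow> 'v::quadratic_space complex_ext set) \<Rightarrow> 'v even_clifford real_ext" where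
  "KS_J H = (THE j. \<exists>e1 e2. hodge_frame H e1 e2 \<and> j = ext_bilin vec_mult e1 e2)"

definition KS_complex_structure ::
  "(int \<Rightarrow> int \<Rightarrow> 'v::quadratic_space complex_ext set)
    \<Rightarrow> 'v even_clifford real_ext \<Rightarrow> 'v even_clifford real_ext" where
  "KS_complex_structure H x = ext_bilin (*) (KS_J H) x"

definition KS_auxiliary :: "'v::quadratic_space \<Rightarrow> 'v \<Rightarrow> 'v \<Rightarrow> bool" where
  "KS_auxiliary v0 f1 f2 \<longleftrightarrow>
     qform v0 v0 \<noteq> 0 \<and> qform f1 f2 = 0 \<and> qform f1 f1 < 0 \<and> qform f2 f2 < 0"

definition KS_form ::
  "'v::quadratic_space \<Rightarrow> 'v \<Rightarrow> 'v even_clifford \<Rightarrow> 'v even_clifford \<Rightarrow> rat" where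
  "KS_form f1 f2 v w = lin_trace (\<lambda>x. (vec_mult f1 f2 * even_rev v * w) * x)"

definition KS_form_dual ::
  "'v::quadratic_space \<Rightarrow> 'v \<Rightarrow> 'v even_clifford \<Rightarrow> 'v even_clifford rat_dual" where
  "KS_form_dual f1 f2 v = Abs_rat_dual (KS_form f1 f2 v)"

text \<open>The isomorphism \<open>x \<otimes> y \<mapsto> Q(x, -) y\<close> from \<open>Cl\<^sup>+ \<otimes> Cl\<^sup>+\<close> to \<open>End(Cl\<^sup>+)\<close>, and then the
  correspondence \<open>V \<rightarrow> End(Cl\<^sup>+) \<simeq> Cl\<^sup>+ \<otimes> Cl\<^sup>+ \<simeq> H\<^sup>1 \<otimes> H\<^sup>1\<close>.\<close>

definition tensor_to_end ::
  "'v::quadratic_space \<Rightarrow> 'v \<Rightarrow> ('v even_clifford, 'v even_clifford) tensor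
    \<Rightarrow> 'v even_clifford \<Rightarrow> 'v even_clifford" where
  "tensor_to_end f1 f2 t w = tensor_lift (\<lambda>x y. KS_form f1 f2 x w *\<^sub>Q y) t"

definition kuga_satake ::
  "'v::quadratic_space \<Rightarrow> 'v \<Rightarrow> 'v \<Rightarrow> 'v
    \<Rightarrow> ('v even_clifford rat_dual, 'v even_clifford rat_dual) tensor" where
  "kuga_satake v0 f1 f2 v =
     tensor_map (KS_form_dual f1 f2) (KS_form_dual f1 f2)
       (THE t. tensor_to_end f1 f2 t = (\<lambda>w. vec_sandwich v w v0))"

end

theory Submission
  imports Defs "HOL-Library.Function_Algebras"
begin

text \<open>Let \<open>\<mu>\<close> be the multiplier of \<open>\<psi>\<close>. The rule \<open>v\<^sub>1 \<cdots> v\<^sub>2\<^sub>m \<mapsto> \<mu>\<^sup>-\<^sup>m \<psi>(v\<^sub>1) \<cdots> \<psi>(v\<^sub>2\<^sub>m)\<close> is an isomorphism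
  \<open>\<Phi>\<close> of even Clifford algebras that commutes with reversal and traces and satisfies
  \<open>\<Phi>(v w v\<^sub>0) = \<mu>\<^sup>-\<^sup>1 \<psi>(v) \<Phi>(w) \<psi>(v\<^sub>0)\<close>. Since \<open>\<mu> > 0\<close>, the vectors \<open>\<psi>(e\<^sub>i) / \<surd>\<mu>\<close> form a Hodge frame of the target, so
  \<open>\<Phi>\<close> maps the one complex structure to the other. A multiple \<open>N \<Phi>\<close> maps \<open>L\<close> into \<open>L'\<close> and induces the
  isogeny, and the diagram commutes for the auxiliary elements \<open>\<mu>\<^sup>-\<^sup>1 N\<^sup>-\<^sup>2 \<psi>(v\<^sub>0)\<close>,
  \<open>\<mu>\<^sup>-\<^sup>1 \<psi>(f\<^sub>1)\<close> and \<open>\<psi>(f\<^sub>2)\<close>.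

  The correspondence is well defined because the trace form on the even Clifford algebra is perfect.
  Conjugation by a vector \<open>e\<close> of an orthogonal frame negates every even word in which \<open>e\<close> occurs an
  odd number of times, so the trace of such a word vanishes; hence the ordered products of even
  length are orthogonal up to reversal, with non-zero norms as soon as \<open>1 \<noteq> 0\<close>. That follows from an
  explicit Clifford module.\<close>

section \<open>Linear algebra\<close>

text \<open>Several notions of the statement are definite descriptions: reversal,
  \<open>KS_J\<close>, the lift of an isogeny, its map on first homology, the tensor behind
  \<open>kuga_satake\<close>. Each needs existence and uniqueness before anything can be computed
  with it, which shapes most of the development. The scalars are forced. Two letters of a word cost
  one factor 1/\<mu>; this fixes \<open>\<Phi>\<close> and the factor on \<open>\<psi> f1\<close>.
  Under N times \<open>\<Phi>\<close> the form Q grows by N^2, so identifying the even Clifford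
  algebra with its dual costs N^-2 in each of two tensor factors; reading the tensor as an
  endomorphism returns one N^2, and the outer letters of v w v0 contribute 1/\<mu>. What remains is
  absorbed into \<open>v0\<close>. Positivity of \<mu> holds because the period planes of both sides
  are negative definite. It serves twice: for the real square root in the frame, and to keep the new
  f1, f2 negative.\<close>

lemma Q_linear_props:
  assumes "Q_linear f"
  shows Q_linear_add: "f (x + y) = f x + f y"
    and Q_linear_scaleQ: "f (c *\<^sub>Q x) = c *\<^sub>Q f x"
    and Q_linear_zero: "f 0 = 0"
    and Q_linear_diff: "f (x - y) = f x - f y"
    and Q_linear_sum: "f (sum h S) = (\<Sum>i\<in>S. f (h i))"
proof -
  interpret Vector_Spaces.linear scaleQ scaleQ f by fact
  show "f (x + y) = f x + f y" "f (c *\<^sub>Q x) = c *\<^sub>Q f x" "f 0 = 0" "f (x - y) = f x - f y"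
    "f (sum h S) = (\<Sum>i\<in>S. f (h i))"
    by (simp_all add: add scale zero diff sum)
qed

lemma Q_linear_comp:
  assumes "Q_linear f" "Q_linear g"
  shows "Q_linear (\<lambda>x. f (g x))"
  using assms by (simp add: Q_linear_iff)

lemma Q_linear_inv:
  assumes "Q_linear f" "bij f"
  shows "Q_linear (inv_into UNIV f)"
  unfolding Q_linear_iff
proof (intro conjI allI)
  fix x y and c :: rat
  have *: "f (inv_into UNIV f z) = z" for z
    using assms(2) by (simp add: bij_is_surj surj_f_inv_f)
  have "f (inv_into UNIV f x + inv_into UNIV f y) = x + y" "f (c *\<^sub>Q inv_into UNIV f x) = c *\<^sub>Q x"
    using assms(1) * by (simp_all add: Q_linear_iff)
  then show "inv_into UNIV f (x + y) = inv_into UNIV f x + inv_into UNIV f y"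
    "inv_into UNIV f (c *\<^sub>Q x) = c *\<^sub>Q inv_into UNIV f x"
    using assms(2) by (metis bij_is_inj inv_f_f)+
qed

lemma Q_linear_eq_on_span:
  assumes "Q_linear f" "Q_linear g" "\<And>x. x \<in> S \<Longrightarrow> f x = g x" "x \<in> rat_vector.span S"
  shows "f x = g x"
  using assms(4)
  by (induction rule: rat_vector.span_induct_alt)
     (simp_all add: Q_linear_props[OF assms(1)] Q_linear_props[OF assms(2)] assms(3))

text \<open>The Clifford modules constructed below are function spaces with pointwise operations:
  functions on \<open>bool\<close> are pairs, functions on \<open>nat set\<close> are families of
  coordinates.\<close>

instantiation "fun" :: (type, rat_vector) rat_vector
begin
definition scaleQ_fun :: "rat \<Rightarrow> ('a \<Rightarrow> 'b) \<Rightarrow> 'a \<Rightarrow> 'b" where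
  "scaleQ_fun r f = (\<lambda>x. r *\<^sub>Q f x)"
instance
  by standard (simp_all add: scaleQ_fun_def fun_eq_iff scaleQ_add_right scaleQ_add_left
      scaleQ_scaleQ scaleQ_one)
end

text \<open>Extend the vector to a basis and take its own coordinate. This later detects that
  \<open>pure_tensor v 1\<close> is non-zero.\<close>

lemma ex_Q_functional:
  fixes x :: "'a::rat_vector"
  assumes "x \<noteq> 0"
  shows "\<exists>\<phi> :: 'a \<Rightarrow> rat. Q_linear \<phi> \<and> \<phi> x = 1"
proof -
  have ind: "rat_vector.independent {x}"
    using assms by (simp add: rat_vector.dependent_single)
  define B where "B = rat_vector.extend_basis {x}"
  have B: "rat_vector.independent B" "rat_vector.span B = UNIV" "x \<in> B"
    unfolding B_def using rat_vector.independent_extend_basis[OF ind]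
      rat_vector.span_extend_basis[OF ind] rat_vector.extend_basis_superset[OF ind] by auto
  have "Q_linear (\<lambda>y. rat_vector.representation B y x)"
    using B by (simp add: Q_linear_iff rat_vector.representation_add
        rat_vector.representation_scale scaleQ_rat_def)
  moreover have "rat_vector.representation B x x = 1"
    using B by (simp add: rat_vector.representation_basis)
  ultimately show ?thesis by (intro exI[of _ "\<lambda>y. rat_vector.representation B y x"]) simp
qed

section \<open>Finite dimension and traces\<close>

definition finite_dimensional :: "'a::rat_vector itself \<Rightarrow> bool" where
  "finite_dimensional _ \<longleftrightarrow> (\<exists>B :: 'a set. finite B \<and> rat_vector.span B = UNIV)"

lemma finite_dimensional_basis:
  fixes B :: "'a::rat_vector set"
  assumes "finite_dimensional TYPE('a)" "rat_vector.independent B"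
  shows "finite B"
proof -
  obtain C :: "'a set" where "finite C" "rat_vector.span C = UNIV"
    using assms(1) by (auto simp: finite_dimensional_def)
  then show ?thesis using rat_vector.independent_span_bound[of C B] assms(2) by simp
qed

definition trace_basis :: "'a::rat_vector itself \<Rightarrow> 'a set" where
  "trace_basis _ = (SOME B. rat_vector.independent B \<and> rat_vector.span B = UNIV)"

lemma trace_basis:
  shows independent_trace_basis: "rat_vector.independent (trace_basis TYPE('a::rat_vector))"
    and span_trace_basis: "rat_vector.span (trace_basis TYPE('a)) = UNIV"
proof -
  have "\<exists>B :: 'a set. rat_vector.independent B \<and> rat_vector.span B = UNIV"
    using rat_vector.independent_extend_basis[OF rat_vector.independent_empty]
      rat_vector.span_extend_basis[OF rat_vector.independent_empty] by blast
  from someI_ex[OF this] show "rat_vector.independent (trace_basis TYPE('a::rat_vector))"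
    and "rat_vector.span (trace_basis TYPE('a)) = UNIV"
    by (simp_all add: trace_basis_def)
qed

lemma lin_trace_eq:
  fixes g :: "'a::rat_vector \<Rightarrow> 'a"
  shows "lin_trace g =
    (\<Sum>b\<in>trace_basis TYPE('a). rat_vector.representation (trace_basis TYPE('a)) (g b) b)"
  by (simp add: lin_trace_def trace_basis_def Let_def)

text \<open>Both sides expand to the same double sum of products of matrix entries. Allowing two
  different spaces covers cyclicity inside one algebra as well as invariance of the trace under an
  isomorphism.\<close>

lemma lin_trace_commute:
  fixes f :: "'b::rat_vector \<Rightarrow> 'a::rat_vector" and h :: "'a \<Rightarrow> 'b"
  assumes fin: "finite_dimensional TYPE('a)" "finite_dimensional TYPE('b)"
    and lin: "Q_linear f" "Q_linear h"
  shows "lin_trace (\<lambda>x. f (h x)) = lin_trace (\<lambda>y. h (f y))"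
proof -
  define B where "B = trace_basis TYPE('a)"
  define C where "C = trace_basis TYPE('b)"
  have B: "rat_vector.independent B" "rat_vector.span B = UNIV" "finite B"
    unfolding B_def using trace_basis finite_dimensional_basis fin(1) by blast+
  have C: "rat_vector.independent C" "rat_vector.span C = UNIV" "finite C"
    unfolding C_def using trace_basis finite_dimensional_basis fin(2) by blast+
  have expB: "x = (\<Sum>b\<in>B. rat_vector.representation B x b *\<^sub>Q b)" for x
    using rat_vector.sum_representation_eq[of B x B] B by simp
  have expC: "y = (\<Sum>c\<in>C. rat_vector.representation C y c *\<^sub>Q c)" for y
    using rat_vector.sum_representation_eq[of C y C] C by simp
  have rep: "rat_vector.representation B (f y) b =
      (\<Sum>c\<in>C. rat_vector.representation C y c * rat_vector.representation B (f c) b)" for y b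
  proof -
    have "f y = (\<Sum>c\<in>C. rat_vector.representation C y c *\<^sub>Q f c)"
      by (subst expC[of y]) (simp only: Q_linear_sum[OF lin(1)] Q_linear_scaleQ[OF lin(1)])
    then show ?thesis
      using B by (simp add: rat_vector.representation_sum rat_vector.representation_scale)
  qed
  have rep': "rat_vector.representation C (h x) c =
      (\<Sum>b\<in>B. rat_vector.representation B x b * rat_vector.representation C (h b) c)" for x c
  proof -
    have "h x = (\<Sum>b\<in>B. rat_vector.representation B x b *\<^sub>Q h b)"
      by (subst expB[of x]) (simp only: Q_linear_sum[OF lin(2)] Q_linear_scaleQ[OF lin(2)])
    then show ?thesis
      using C by (simp add: rat_vector.representation_sum rat_vector.representation_scale)
  qed
  have "lin_trace (\<lambda>x. f (h x)) =
      (\<Sum>b\<in>B. \<Sum>c\<in>C. rat_vector.representation C (h b) c * rat_vector.representation B (f c) b)"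
    unfolding lin_trace_eq B_def[symmetric] by (intro sum.cong refl rep)
  also have "\<dots> =
      (\<Sum>c\<in>C. \<Sum>b\<in>B. rat_vector.representation B (f c) b * rat_vector.representation C (h b) c)"
    by (subst sum.swap) (simp add: mult.commute)
  also have "\<dots> = lin_trace (\<lambda>y. h (f y))"
    unfolding lin_trace_eq C_def[symmetric] by (intro sum.cong refl rep'[symmetric])
  finally show ?thesis .
qed

lemma lin_trace_add: "lin_trace (\<lambda>x. f x + g x) = lin_trace f + lin_trace g"
  unfolding lin_trace_eq by (simp add: rat_vector.representation_add trace_basis sum.distrib)

lemma lin_trace_scaleQ: "lin_trace (\<lambda>x. c *\<^sub>Q f x) = c * lin_trace f"
  unfolding lin_trace_eq
  by (simp add: rat_vector.representation_scale trace_basis sum_distrib_left)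

text \<open>The trace of the identity is the size of a basis, and in characteristic zero a positive
  integer stays non-zero.\<close>

lemma lin_trace_id_neq_0:
  assumes "finite_dimensional TYPE('a)" "(x :: 'a::rat_vector) \<noteq> 0"
  shows "lin_trace (\<lambda>x :: 'a. x) \<noteq> 0"
proof -
  have "finite (trace_basis TYPE('a))"
    by (rule finite_dimensional_basis[OF assms(1) independent_trace_basis])
  moreover have "trace_basis TYPE('a) \<noteq> {}"
    using assms(2) span_trace_basis[where 'a = 'a] by (metis UNIV_I rat_vector.span_empty singletonD)
  ultimately show ?thesis
    by (simp add: lin_trace_eq rat_vector.representation_basis trace_basis)
qed

section \<open>Linear maps out of the Clifford algebra\<close>

lemma clifford_word_simps [simp]:
  "clifford_word [] = 1"
  "clifford_word (v # vs) = clifford_gen v * clifford_word vs"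
  by (simp_all add: clifford_word_def)

lemma clifford_gen_square: "clifford_gen v * clifford_gen v = qform v v *\<^sub>Q 1"
proof transfer
  fix v :: 'a
  have "1 * (tensor_gen v * tensor_gen v - qform v v *\<^sub>Q 1) * 1 + 0 \<in> ideal_gen clifford_rels"
    by (rule ideal_gen.add) (auto simp: clifford_rels_def ideal_gen.zero)
  then show "clifford_eq (tensor_gen v * tensor_gen v) (qform v v *\<^sub>Q 1)"
    by (simp add: clifford_eq_def)
qed

lemma tensor_gen_add: "tensor_gen (v + w) = tensor_gen v + tensor_gen w"
proof transfer
  fix v w :: 'a
  have "1 * (letter (v + w) - letter v - letter w) * 1 + 0 \<in> ideal_gen linearity_rels"
    by (rule ideal_gen.add) (auto simp: linearity_rels_def ideal_gen.zero)
  then show "tensor_alg_eq (letter (v + w)) (letter v + letter w)"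
    by (simp add: tensor_alg_eq_def algebra_simps)
qed

lemma tensor_gen_scaleQ: "tensor_gen (r *\<^sub>Q v) = r *\<^sub>Q tensor_gen v"
proof transfer
  fix v :: 'a and r
  have "1 * (letter (r *\<^sub>Q v) - r *\<^sub>Q letter v) * 1 + 0 \<in> ideal_gen linearity_rels"
    by (rule ideal_gen.add) (auto simp: linearity_rels_def ideal_gen.zero)
  then show "tensor_alg_eq (letter (r *\<^sub>Q v)) (r *\<^sub>Q letter v)"
    by (simp add: tensor_alg_eq_def)
qed

lemma Q_linear_clifford_gen: "Q_linear clifford_gen"
  by (simp add: Q_linear_iff clifford_gen.abs_eq tensor_gen_add tensor_gen_scaleQ
      plus_clifford.abs_eq scaleQ_clifford.abs_eq)

text \<open>The universal property, phrased for Clifford modules so that reversal and the even parts of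
  similarities, which are not algebra homomorphisms of the full Clifford algebra, are covered.\<close>

lemma clifford_module_action:
  fixes R :: "'v::quadratic_space \<Rightarrow> 'm::rat_vector \<Rightarrow> 'm"
  assumes bil: "Q_bilinear R" and sq: "\<And>v m. R v (R v m) = qform v v *\<^sub>Q m"
  shows "\<exists>\<rho>. Q_linear \<rho> \<and> (\<forall>vs. \<rho> (clifford_word vs) = foldr R vs m)"
proof -
  have lin_R: "Q_linear (R v)" "Q_linear (\<lambda>v. R v m)" for v m
    using bil by (auto simp: Q_bilinear_def)
  have lin_foldr: "Q_linear (foldr R vs)" for vs
    by (induction vs) (use lin_R in \<open>simp_all add: Q_linear_iff\<close>)
  \<comment> \<open>The free algebra on the vectors acts first, a word applying its last letter
    first. The action then descends through the two quotients in turn.\<close>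
  define h where "h p m = (\<Sum>k\<in>Poly_Mapping.keys p. Poly_Mapping.lookup p k *\<^sub>Q foldr R (letters k) m)"
    for p :: "'v word \<Rightarrow>\<^sub>0 rat" and m
  have h_eq: "h p m = (\<Sum>k\<in>K. Poly_Mapping.lookup p k *\<^sub>Q foldr R (letters k) m)"
    if "finite K" "Poly_Mapping.keys p \<subseteq> K" for p K m
    unfolding h_def using that by (intro sum.mono_neutral_left) (auto simp: in_keys_iff)
  have h_add: "h (p + q) m = h p m + h q m" for p q m
  proof -
    let ?K = "Poly_Mapping.keys p \<union> Poly_Mapping.keys q"
    show ?thesis
      using Poly_Mapping.keys_add[of p q] h_eq[of ?K p] h_eq[of ?K q] h_eq[of ?K "p + q"]
      by (simp add: lookup_add scaleQ_add_left sum.distrib)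
  qed
  have h_scale: "h (r *\<^sub>Q p) m = r *\<^sub>Q h p m" for r p m
  proof -
    have "Poly_Mapping.keys (r *\<^sub>Q p) \<subseteq> Poly_Mapping.keys p" by (auto simp: in_keys_iff)
    then show ?thesis
      using h_eq[of "Poly_Mapping.keys p" "r *\<^sub>Q p"]
      by (simp add: h_def rat_vector.scale_sum_right scaleQ_rat_def)
  qed
  have lin_h1: "Q_linear (\<lambda>p. h p m)" for m using h_add h_scale by (simp add: Q_linear_iff)
  have lin_h2: "Q_linear (h p)" for p
    unfolding Q_linear_iff h_def
    by (auto simp: Q_linear_add[OF lin_foldr] Q_linear_scaleQ[OF lin_foldr] scaleQ_add_right
        sum.distrib rat_vector.scale_sum_right mult.commute)
  have h_single: "h (Poly_Mapping.single k c) m = c *\<^sub>Q foldr R (letters k) m" for k c m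
    by (simp add: h_def)
  have h_mult: "h (p * q) m = h p (h q m)" for p q m
  proof (induction p rule: poly_mapping_additive_induct)
    case 1
    show ?case by (simp add: Q_linear_zero[OF lin_h1])
  next
    case (2 k c)
    show ?case
    proof (induction q rule: poly_mapping_additive_induct)
      case 1
      show ?case by (simp add: Q_linear_zero[OF lin_h1] Q_linear_zero[OF lin_h2])
    next
      case (2 k' c')
      show ?case
        by (simp add: mult_single h_single plus_word_def Q_linear_scaleQ[OF lin_foldr])
    next
      case (3 p q)
      then show ?case by (simp add: distrib_left h_add Q_linear_add[OF lin_h2])
    qed
  next
    case (3 p q)
    then show ?case by (simp add: distrib_right h_add)
  qed
  have h_rels: "h s m = 0" if "s \<in> linearity_rels" for s m
  proof -
    have "h (letter v) m = R v m" for v by (simp add: letter_def h_single)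
    then show ?thesis using that
      by (auto simp: linearity_rels_def Q_linear_diff[OF lin_h1] h_scale
          Q_linear_add[OF lin_R(2)] Q_linear_scaleQ[OF lin_R(2)])
  qed
  \<comment> \<open>By \<open>h_mult\<close> the elements that act as zero on every vector form a
    two-sided ideal, so checking the generators is enough.\<close>
  have "h s m = 0" if "s \<in> ideal_gen linearity_rels" for s m
    using that by (induction rule: ideal_gen.induct)
      (simp_all add: h_rels Q_linear_zero[OF lin_h1] h_add h_mult Q_linear_zero[OF lin_h2])
  then have resp: "h p m = h q m" if "tensor_alg_eq p q" for p q m
    using that Q_linear_diff[OF lin_h1, of p q m] by (simp add: tensor_alg_eq_def)
  define h1 where "h1 t m = h (rep_tensor_alg t) m" for t m
  have h1_abs: "h1 (abs_tensor_alg p) m = h p m" for p m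
    unfolding h1_def by (rule resp) (rule Quotient3_rep_abs[OF Quotient3_tensor_alg], simp add: tensor_alg_eq_def ideal_gen.zero)
  have surj1: "\<exists>p. t = abs_tensor_alg p" for t :: "'v tensor_alg"
    by (rule exI[of _ "rep_tensor_alg t"]) (simp only: Quotient_abs_rep[OF Quotient_tensor_alg])
  have h1_add: "h1 (s + t) m = h1 s m + h1 t m" for s t m
    using surj1[of s] surj1[of t] by (auto simp: plus_tensor_alg.abs_eq h1_abs h_add)
  have h1_scale: "h1 (r *\<^sub>Q t) m = r *\<^sub>Q h1 t m" for r t m
    using surj1[of t] by (auto simp: scaleQ_tensor_alg.abs_eq h1_abs h_scale)
  have h1_mult: "h1 (s * t) m = h1 s (h1 t m)" for s t m
    using surj1[of s] surj1[of t] by (auto simp: times_tensor_alg.abs_eq h1_abs h_mult)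
  have h1_one: "h1 1 m = m" for m
  proof -
    have "h 1 m = m" unfolding single_one[symmetric] h_single
      by (simp add: zero_word_def scaleQ_one)
    then show ?thesis by (simp add: one_tensor_alg.abs_eq h1_abs)
  qed
  have h1_gen: "h1 (tensor_gen v) m = R v m" for v m
    by (simp add: tensor_gen.abs_eq h1_abs letter_def h_single)
  have lin_h11: "Q_linear (\<lambda>p. h1 p m)" for m using h1_add h1_scale by (simp add: Q_linear_iff)
  have h1_zero: "h1 t 0 = 0" for t by (simp add: h1_def Q_linear_zero[OF lin_h2])
  \<comment> \<open>Here \<open>sq\<close> enters: it says that v v - q(v) acts as zero.\<close>
  have h1_rels: "h1 s m = 0" if "s \<in> clifford_rels" for s m
    using that by (auto simp: clifford_rels_def Q_linear_diff[OF lin_h11] h1_scale h1_mult h1_gen h1_one sq)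
  have "h1 s m = 0" if "s \<in> ideal_gen clifford_rels" for s m
    using that by (induction rule: ideal_gen.induct)
      (simp_all add: h1_rels Q_linear_zero[OF lin_h11] h1_add h1_mult h1_zero)
  then have resp1: "h1 p m = h1 q m" if "clifford_eq p q" for p q m
    using that Q_linear_diff[OF lin_h11, of p q m] by (simp add: clifford_eq_def)
  define h2 where "h2 t m = h1 (rep_clifford t) m" for t m
  have h2_abs: "h2 (abs_clifford p) m = h1 p m" for p m
    unfolding h2_def by (rule resp1) (rule Quotient3_rep_abs[OF Quotient3_clifford], simp add: clifford_eq_def ideal_gen.zero)
  have surj2: "\<exists>p. t = abs_clifford p" for t :: "'v clifford"
    by (rule exI[of _ "rep_clifford t"]) (simp only: Quotient_abs_rep[OF Quotient_clifford])
  have h2_add: "h2 (s + t) m = h2 s m + h2 t m" for s t m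
    using surj2[of s] surj2[of t] by (auto simp: plus_clifford.abs_eq h2_abs h1_add)
  have h2_scale: "h2 (r *\<^sub>Q t) m = r *\<^sub>Q h2 t m" for r t m
    using surj2[of t] by (auto simp: scaleQ_clifford.abs_eq h2_abs h1_scale)
  have h2_mult: "h2 (s * t) m = h2 s (h2 t m)" for s t m
    using surj2[of s] surj2[of t] by (auto simp: times_clifford.abs_eq h2_abs h1_mult)
  have h2_one: "h2 1 m = m" for m by (simp add: one_clifford.abs_eq h2_abs h1_one)
  have h2_gen: "h2 (clifford_gen v) m = R v m" for v m
    by (simp add: clifford_gen.abs_eq h2_abs h1_gen)
  have "h2 (clifford_word vs) m = foldr R vs m" for vs
    by (induction vs) (simp_all add: h2_one h2_mult h2_gen)
  moreover have "Q_linear (\<lambda>x. h2 x m)" using h2_add h2_scale by (simp add: Q_linear_iff)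
  ultimately show ?thesis by (intro exI[of _ "\<lambda>x. h2 x m"]) simp
qed

text \<open>Polarization of the defining relation: expand the square of
  \<open>v + w\<close>.\<close>

lemma clifford_gen_anticommute:
  "clifford_gen v * clifford_gen w + clifford_gen w * clifford_gen v = (2 * qform v w) *\<^sub>Q 1"
proof -
  let ?v = "clifford_gen v" and ?w = "clifford_gen w"
  have "?v * ?v + (?v * ?w + ?w * ?v) + ?w * ?w = clifford_gen (v + w) * clifford_gen (v + w)"
    by (simp add: Q_linear_add[OF Q_linear_clifford_gen] algebra_simps)
  also have "\<dots> = (qform v v + 2 * qform v w + qform w w) *\<^sub>Q 1"
    by (simp add: clifford_gen_square qform_add_left qform_sym[of v "v + w"] qform_sym[of w "v + w"]
        qform_sym[of w v])
  finally show ?thesis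
    by (simp add: clifford_gen_square scaleQ_add_left algebra_simps)
qed

section \<open>The even Clifford algebra\<close>

lemma Rep_even_word: "even (length vs) \<Longrightarrow> Rep_even_clifford (even_word vs) = clifford_word vs"
  unfolding even_word_def by (rule Abs_even_clifford_inverse) (rule even_part_word)

lemma Q_linear_Rep_even: "Q_linear Rep_even_clifford"
  by (simp add: Q_linear_iff plus_even_clifford.rep_eq scaleQ_even_clifford.rep_eq)

lemma span_even_word: "rat_vector.span (even_word ` {vs. even (length vs)}) = UNIV"
proof -
  have "x \<in> Rep_even_clifford ` rat_vector.span (even_word ` {vs. even (length vs)})"
    if "x \<in> even_part" for x :: "'a clifford"
    using that unfolding even_part_def
  proof (induction rule: rat_vector.span_induct_alt)
    case base
    show ?case
      by (rule image_eqI[of _ _ 0]) (simp_all add: zero_even_clifford.rep_eq rat_vector.span_zero)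
  next
    case (step c x y)
    then obtain vs z where "x = Rep_even_clifford (even_word vs)" "even (length vs)"
      "y = Rep_even_clifford z" "z \<in> rat_vector.span (even_word ` {vs. even (length vs)})"
      by (auto simp: Rep_even_word)
    then show ?case
      by (intro image_eqI[of _ _ "c *\<^sub>Q even_word vs + z"])
         (auto simp: plus_even_clifford.rep_eq scaleQ_even_clifford.rep_eq
           intro!: rat_vector.span_add rat_vector.span_scale intro: rat_vector.span_base)
  qed
  then have "y \<in> rat_vector.span (even_word ` {vs. even (length vs)})" for y :: "'a even_clifford"
    using Rep_even_clifford[of y] by (metis (no_types, lifting) imageE Rep_even_clifford_inject)
  then show ?thesis by blast
qed

lemma even_clifford_linear_eqI:
  assumes "Q_linear f" "Q_linear g"
    and "\<And>vs. even (length vs) \<Longrightarrow> f (even_word vs) = g (even_word vs)"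
  shows "f = g"
proof
  fix x
  show "f x = g x"
    by (rule Q_linear_eq_on_span[OF assms(1,2), of "even_word ` {vs. even (length vs)}"])
       (auto simp: span_even_word assms(3))
qed

lemma even_word_append:
  "even (length us) \<Longrightarrow> even (length vs) \<Longrightarrow> even_word (us @ vs) = even_word us * even_word vs"
  by (simp add: Rep_even_clifford_inject[symmetric] times_even_clifford.rep_eq Rep_even_word
      clifford_word_append)

lemma vec_mult_eq_even_word: "vec_mult v w = even_word [v, w]"
  by (simp add: Rep_even_clifford_inject[symmetric] vec_mult.rep_eq Rep_even_word)

lemma vec_sandwich_even_word:
  "even (length vs) \<Longrightarrow> vec_sandwich v (even_word vs) u = even_word (v # vs @ [u])"
  by (simp add: Rep_even_clifford_inject[symmetric] vec_sandwich.rep_eq Rep_even_word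
      clifford_word_append mult.assoc)

lemma vec_sandwich_linear:
  shows Q_linear_vec_sandwich: "Q_linear (\<lambda>x. vec_sandwich v x u)"
    and Q_linear_vec_sandwich_right: "Q_linear (\<lambda>u. vec_sandwich v x u)"
  by (simp_all add: Q_linear_iff Rep_even_clifford_inject[symmetric] vec_sandwich.rep_eq
      plus_even_clifford.rep_eq scaleQ_even_clifford.rep_eq algebra_simps scaleQ_mult_left
      scaleQ_mult_right Q_linear_add[OF Q_linear_clifford_gen] Q_linear_scaleQ[OF Q_linear_clifford_gen])

lemma Q_bilinear_vec_mult: "Q_bilinear vec_mult"
  by (simp add: Q_bilinear_def Q_linear_iff Rep_even_clifford_inject[symmetric] vec_mult.rep_eq
      plus_even_clifford.rep_eq scaleQ_even_clifford.rep_eq algebra_simps scaleQ_mult_left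
      scaleQ_mult_right Q_linear_add[OF Q_linear_clifford_gen] Q_linear_scaleQ[OF Q_linear_clifford_gen])

lemma vec_mult_anticommute: "vec_mult v w + vec_mult w v = (2 * qform v w) *\<^sub>Q 1"
  by (simp add: Rep_even_clifford_inject[symmetric] vec_mult.rep_eq one_even_clifford.rep_eq
      plus_even_clifford.rep_eq scaleQ_even_clifford.rep_eq clifford_gen_anticommute)

subsection \<open>Reversal\<close>

text \<open>Right multiplication makes the Clifford algebra a Clifford module over itself, and the
  orbit map of 1 in it reverses words. It preserves the even part, and even words span, hence
  uniqueness.\<close>

lemma even_rev_ex1:
  "\<exists>!g :: 'v::quadratic_space even_clifford \<Rightarrow> _. Q_linear g \<and>
     (\<forall>vs. even (length vs) \<longrightarrow> g (even_word vs) = even_word (rev vs))"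
proof -
  have "Q_bilinear (\<lambda>(v :: 'v) m. m * clifford_gen v)"
    by (simp add: Q_bilinear_def Q_linear_iff algebra_simps scaleQ_mult_left scaleQ_mult_right
        Q_linear_add[OF Q_linear_clifford_gen] Q_linear_scaleQ[OF Q_linear_clifford_gen])
  moreover have "m * clifford_gen v * clifford_gen v = qform v v *\<^sub>Q m" for m and v :: 'v
    by (simp add: mult.assoc clifford_gen_square scaleQ_mult_right)
  ultimately obtain \<rho> :: "'v clifford \<Rightarrow> 'v clifford" where \<rho>: "Q_linear \<rho>"
    "\<And>vs. \<rho> (clifford_word vs) = foldr (\<lambda>v m. m * clifford_gen v) vs 1"
    using clifford_module_action[of "\<lambda>v m. m * clifford_gen v" 1] by blast
  have \<rho>_word: "\<rho> (clifford_word vs) = clifford_word (rev vs)" for vs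
    unfolding \<rho>(2) by (induction vs) (simp_all add: clifford_word_append)
  have \<rho>_even: "\<rho> x \<in> even_part" if "x \<in> even_part" for x
    using that unfolding even_part_def
    by (induction rule: rat_vector.span_induct_alt)
       (auto simp: Q_linear_props[OF \<rho>(1)] \<rho>_word rat_vector.span_zero
         intro!: rat_vector.span_add rat_vector.span_scale intro: rat_vector.span_base)
  define g where "g x = Abs_even_clifford (\<rho> (Rep_even_clifford x))" for x
  have Rep_g: "Rep_even_clifford (g x) = \<rho> (Rep_even_clifford x)" for x
    unfolding g_def by (rule Abs_even_clifford_inverse) (rule \<rho>_even[OF Rep_even_clifford])
  have "Q_linear g"
    by (simp add: Q_linear_iff Rep_even_clifford_inject[symmetric] Rep_g Q_linear_props[OF \<rho>(1)]
        plus_even_clifford.rep_eq scaleQ_even_clifford.rep_eq)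
  moreover have "g (even_word vs) = even_word (rev vs)" if "even (length vs)" for vs
    using that by (simp add: Rep_even_clifford_inject[symmetric] Rep_g Rep_even_word \<rho>_word)
  ultimately show ?thesis
    by (intro ex1I[of _ g]) (auto intro: even_clifford_linear_eqI)
qed

lemma even_rev:
  shows Q_linear_even_rev: "Q_linear even_rev"
    and even_rev_word: "even (length vs) \<Longrightarrow> even_rev (even_word vs) = even_word (rev vs)"
  using theI'[OF even_rev_ex1] unfolding even_rev_def[symmetric] by auto

lemma even_rev_even_rev: "even_rev (even_rev x) = x"
proof -
  have "(\<lambda>x. even_rev (even_rev x)) = (\<lambda>x :: 'a even_clifford. x)"
    by (rule even_clifford_linear_eqI)
       (simp_all add: Q_linear_comp Q_linear_even_rev even_rev_word Q_linear_iff[of "\<lambda>x. x"])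
  then show ?thesis by meson
qed

subsection \<open>Functoriality for similarities\<close>

text \<open>The square root of the multiplier need not be rational, so a similarity does not act on the
  full Clifford algebra. The even part is recovered from the action
  \<open>v \<cdot> (a, b) = (\<psi>(v) b, \<mu>\<^sup>-\<^sup>1 \<psi>(v) a)\<close> on two copies of the target.\<close>

lemma even_clifford_similarity:
  fixes \<psi> :: "'v::quadratic_space \<Rightarrow> 'w::quadratic_space"
  assumes \<psi>: "Q_linear \<psi>" and sim: "\<And>v w. qform (\<psi> v) (\<psi> w) = \<mu> * qform v w" and \<mu>: "\<mu> \<noteq> 0"
  shows "\<exists>\<Phi> :: 'v even_clifford \<Rightarrow> 'w even_clifford. Q_linear \<Phi> \<and>
    (\<forall>vs. even (length vs) \<longrightarrow>
       \<Phi> (even_word vs) = (inverse \<mu> ^ (length vs div 2)) *\<^sub>Q even_word (map \<psi> vs))"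
proof -
  \<comment> \<open>The index \<open>True\<close> is the first copy a and \<open>False\<close> the
    second copy b, so the weight 1/\<mu> is met on every other letter.\<close>
  define c where "c i = (if i then 1 else inverse \<mu>)" for i
  define R :: "'v \<Rightarrow> (bool \<Rightarrow> 'w clifford) \<Rightarrow> bool \<Rightarrow> 'w clifford"
    where "R v m i = c i *\<^sub>Q (clifford_gen (\<psi> v) * m (\<not> i))" for v m i
  have "Q_bilinear R"
    by (simp add: Q_bilinear_def Q_linear_iff R_def fun_eq_iff scaleQ_fun_def algebra_simps
        scaleQ_mult_left scaleQ_mult_right Q_linear_props[OF \<psi>] scaleQ_add_right scaleQ_scaleQ mult.commute
        Q_linear_add[OF Q_linear_clifford_gen] Q_linear_scaleQ[OF Q_linear_clifford_gen])
  moreover have "R v (R v m) = qform v v *\<^sub>Q m" for v m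
  proof
    fix i
    have "R v (R v m) i = (c i * c (\<not> i)) *\<^sub>Q ((clifford_gen (\<psi> v) * clifford_gen (\<psi> v)) * m i)"
      by (simp add: R_def scaleQ_mult_right scaleQ_scaleQ mult.assoc)
    also have "\<dots> = (qform v v *\<^sub>Q m) i"
      using \<mu> by (simp add: clifford_gen_square sim scaleQ_fun_def scaleQ_mult_left scaleQ_scaleQ c_def)
    finally show "R v (R v m) i = (qform v v *\<^sub>Q m) i" .
  qed
  ultimately obtain \<rho> where \<rho>: "Q_linear \<rho>"
    "\<And>vs. \<rho> (clifford_word vs) = foldr R vs (\<lambda>_. 1)"
    using clifford_module_action[of R "\<lambda>_. 1"] by blast
  \<comment> \<open>The first component collects one factor for every second letter, which rounds
    half the length down; the second component starts with a factor and rounds up. On even words the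
    first component gives the required exponent.\<close>
  have fold: "foldr R vs (\<lambda>_. 1) i =
      (inverse \<mu> ^ ((length vs + (if i then 0 else 1)) div 2)) *\<^sub>Q clifford_word (map \<psi> vs)" for vs i
    by (induction vs arbitrary: i)
       (auto simp: R_def c_def scaleQ_one scaleQ_mult_right scaleQ_scaleQ)
  define \<rho>' where "\<rho>' x = \<rho> x True" for x
  have \<rho>'_lin: "Q_linear \<rho>'"
    using \<rho>(1) by (simp add: Q_linear_iff \<rho>'_def scaleQ_fun_def)
  have \<rho>'_word: "\<rho>' (clifford_word vs) = (inverse \<mu> ^ (length vs div 2)) *\<^sub>Q clifford_word (map \<psi> vs)" for vs
    by (simp add: \<rho>'_def \<rho>(2) fold)
  have \<rho>'_even: "\<rho>' x \<in> even_part" if "x \<in> even_part" for x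
    using that unfolding even_part_def
    by (induction rule: rat_vector.span_induct_alt)
       (auto simp: Q_linear_props[OF \<rho>'_lin] \<rho>'_word rat_vector.span_zero
         intro!: rat_vector.span_add rat_vector.span_scale even_part_word[unfolded even_part_def])
  define g where "g x = Abs_even_clifford (\<rho>' (Rep_even_clifford x))" for x
  have Rep_g: "Rep_even_clifford (g x) = \<rho>' (Rep_even_clifford x)" for x
    unfolding g_def by (rule Abs_even_clifford_inverse) (rule \<rho>'_even[OF Rep_even_clifford])
  have "Q_linear g"
    by (simp add: Q_linear_iff Rep_even_clifford_inject[symmetric] Rep_g Q_linear_props[OF \<rho>'_lin]
        plus_even_clifford.rep_eq scaleQ_even_clifford.rep_eq)
  moreover have "g (even_word vs) = (inverse \<mu> ^ (length vs div 2)) *\<^sub>Q even_word (map \<psi> vs)"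
    if "even (length vs)" for vs
    using that by (simp add: Rep_even_clifford_inject[symmetric] Rep_g Rep_even_word \<rho>'_word
        scaleQ_even_clifford.rep_eq)
  ultimately show ?thesis by blast
qed

definition even_similarity ::
  "rat \<Rightarrow> ('v::quadratic_space \<Rightarrow> 'w::quadratic_space) \<Rightarrow> 'v even_clifford \<Rightarrow> 'w even_clifford" where
  "even_similarity \<mu> \<psi> = (SOME \<Phi>. Q_linear \<Phi> \<and>
    (\<forall>vs. even (length vs) \<longrightarrow>
       \<Phi> (even_word vs) = (inverse \<mu> ^ (length vs div 2)) *\<^sub>Q even_word (map \<psi> vs)))"

locale quadratic_similarity =
  fixes \<psi> :: "'v::quadratic_space \<Rightarrow> 'w::quadratic_space" and \<mu> :: rat
  assumes linear: "Q_linear \<psi>" and bij: "bij \<psi>" and multiplier_neq_0: "\<mu> \<noteq> 0"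
    and qform_image: "\<And>v w. qform (\<psi> v) (\<psi> w) = \<mu> * qform v w"
begin

abbreviation \<Phi> where "\<Phi> \<equiv> even_similarity \<mu> \<psi>"

lemma linear_\<Phi>: "Q_linear \<Phi>"
  and \<Phi>_word: "even (length vs) \<Longrightarrow>
    \<Phi> (even_word vs) = (inverse \<mu> ^ (length vs div 2)) *\<^sub>Q even_word (map \<psi> vs)"
  using someI_ex[OF even_clifford_similarity[OF linear qform_image multiplier_neq_0]]
  unfolding even_similarity_def[symmetric] by auto

text \<open>Halving the length is additive on even words, so the powers of 1/\<mu> multiply
  correctly; linearity in each argument does the rest.\<close>

lemma \<Phi>_mult: "\<Phi> (x * y) = \<Phi> x * \<Phi> y"
proof -
  have "(\<lambda>y. \<Phi> (even_word us * y)) = (\<lambda>y. \<Phi> (even_word us) * \<Phi> y)" if "even (length us)" for us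
    by (rule even_clifford_linear_eqI)
       (use that in \<open>auto simp: Q_linear_iff Q_linear_props[OF linear_\<Phi>] distrib_left scaleQ_mult_left
         scaleQ_mult_right scaleQ_scaleQ scaleQ_add_right \<Phi>_word even_word_append[symmetric] power_add elim!: evenE\<close>)
  then have "(\<lambda>x. \<Phi> (x * y)) = (\<lambda>x. \<Phi> x * \<Phi> y)" for y
    by (intro even_clifford_linear_eqI)
       (auto simp: Q_linear_iff Q_linear_props[OF linear_\<Phi>] distrib_right scaleQ_mult_left
         scaleQ_mult_right dest: fun_cong)
  then show ?thesis by meson
qed

lemma \<Phi>_even_rev: "\<Phi> (even_rev x) = even_rev (\<Phi> x)"
proof -
  have "(\<lambda>x. \<Phi> (even_rev x)) = (\<lambda>x. even_rev (\<Phi> x))"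
    by (rule even_clifford_linear_eqI)
       (auto simp: Q_linear_comp linear_\<Phi> Q_linear_even_rev even_rev_word \<Phi>_word
         Q_linear_scaleQ[OF Q_linear_even_rev] rev_map)
  then show ?thesis by meson
qed

lemma \<Phi>_vec_mult: "\<Phi> (vec_mult v w) = inverse \<mu> *\<^sub>Q vec_mult (\<psi> v) (\<psi> w)"
  by (simp add: vec_mult_eq_even_word \<Phi>_word)

text \<open>The outer letters v and u lengthen an even word by two, which accounts for exactly one
  further factor 1/\<mu>.\<close>

lemma \<Phi>_vec_sandwich: "\<Phi> (vec_sandwich v x u) = inverse \<mu> *\<^sub>Q vec_sandwich (\<psi> v) (\<Phi> x) (\<psi> u)"
proof -
  have "(\<lambda>x. \<Phi> (vec_sandwich v x u)) = (\<lambda>x. inverse \<mu> *\<^sub>Q vec_sandwich (\<psi> v) (\<Phi> x) (\<psi> u))"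
    by (rule even_clifford_linear_eqI)
       (auto simp: Q_linear_iff Q_linear_props[OF linear_\<Phi>] Q_linear_props[OF Q_linear_vec_sandwich]
         scaleQ_add_right scaleQ_scaleQ mult.commute vec_sandwich_even_word \<Phi>_word)
  then show ?thesis by meson
qed

text \<open>The construction thus applies to the inverse as well, and comparing values on even words
  makes the two maps of even Clifford algebras mutually inverse.\<close>

lemma inverse_similarity: "quadratic_similarity (inv_into UNIV \<psi>) (inverse \<mu>)"
proof (rule quadratic_similarity.intro)
  show "Q_linear (inv_into UNIV \<psi>)" "bij (inv_into UNIV \<psi>)" "inverse \<mu> \<noteq> 0"
    using Q_linear_inv[OF linear bij] bij_imp_bij_inv[OF bij] multiplier_neq_0 by auto
  fix v w
  show "qform (inv_into UNIV \<psi> v) (inv_into UNIV \<psi> w) = inverse \<mu> * qform v w"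
    using qform_image[of "inv_into UNIV \<psi> v" "inv_into UNIV \<psi> w"] multiplier_neq_0
    by (simp add: bij bij_is_surj surj_f_inv_f)
qed

lemma \<Phi>_inverse: "even_similarity (inverse \<mu>) (inv_into UNIV \<psi>) (\<Phi> x) = x"
proof -
  interpret inv: quadratic_similarity "inv_into UNIV \<psi>" "inverse \<mu>" by (rule inverse_similarity)
  have "(\<lambda>x. inv.\<Phi> (\<Phi> x)) = (\<lambda>x. x)"
    using multiplier_neq_0 by (intro even_clifford_linear_eqI)
       (auto simp: Q_linear_iff Q_linear_props[OF linear_\<Phi>] Q_linear_props[OF inv.linear_\<Phi>]
         \<Phi>_word inv.\<Phi>_word scaleQ_scaleQ scaleQ_one bij bij_is_inj power_mult_distrib[symmetric] map_idI)
  then show ?thesis by meson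
qed

lemma bij_\<Phi>: "bij \<Phi>"
proof -
  interpret inv: quadratic_similarity "inv_into UNIV \<psi>" "inverse \<mu>" by (rule inverse_similarity)
  have "\<Phi> (inv.\<Phi> y) = y" for y
    using inv.\<Phi>_inverse[of y] by (simp add: bij inv_inv_eq)
  then show ?thesis using \<Phi>_inverse by (metis bijI')
qed

end

section \<open>Orthogonal frames\<close>

lemma qform_add_right: "qform x (y + z) = qform x y + qform x z"
  by (simp add: qform_sym[of x] qform_add_left)

lemma qform_scaleQ_right: "qform x (r *\<^sub>Q y) = r * qform x y"
  by (simp add: qform_sym[of x] qform_scaleQ_left)

lemma Q_linear_qform: "Q_linear (qform x)" "Q_linear (\<lambda>x. qform x y)"
  by (simp_all add: Q_linear_iff qform_add_left qform_add_right qform_scaleQ_left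
      qform_scaleQ_right scaleQ_rat_def)

definition toggle :: "'a \<Rightarrow> 'a set \<Rightarrow> 'a set" where
  "toggle i S = (if i \<in> S then S - {i} else insert i S)"

lemma toggle_toggle: "toggle i (toggle i S) = S"
  by (auto simp: toggle_def)

lemma toggle_commute: "toggle i (toggle j S) = toggle j (toggle i S)"
  by (auto simp: toggle_def)

lemma mem_toggle: "j \<in> toggle i S \<longleftrightarrow> (if j = i then j \<notin> S else j \<in> S)"
  by (auto simp: toggle_def)

lemma count_list_distinct: "distinct xs \<Longrightarrow> count_list xs x = (if x \<in> set xs then 1 else 0)"
  by (induction xs) auto

lemma clifford_word_rev_mult:
  "clifford_word (rev vs) * clifford_word vs =
     prod_list (map (\<lambda>v. qform v v) vs) *\<^sub>Q 1"
proof (induction vs)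
  case Nil
  show ?case by simp
next
  case (Cons v vs)
  have "clifford_word (rev (v # vs)) * clifford_word (v # vs) =
      clifford_word (rev vs) * (clifford_gen v * clifford_gen v) * clifford_word vs"
    by (simp add: clifford_word_append mult.assoc)
  then show ?case
    using Cons by (simp add: clifford_gen_square scaleQ_mult_left scaleQ_mult_right)
qed

text \<open>Vectors cannot be normalized over the rationals, so arbitrary non-zero norms are carried
  along. The numbering of the frame supplies the order in the ordered products.\<close>

locale orthogonal_frame =
  fixes e :: "nat \<Rightarrow> 'v::quadratic_space" and n :: nat
  assumes orthogonal: "i < n \<Longrightarrow> j < n \<Longrightarrow> i \<noteq> j \<Longrightarrow> qform (e i) (e j) = 0"
    and anisotropic: "i < n \<Longrightarrow> qform (e i) (e i) \<noteq> 0"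
    and span_frame: "rat_vector.span (e ` {..<n}) = UNIV"
begin

definition coord :: "nat \<Rightarrow> 'v \<Rightarrow> rat" where
  "coord i v = qform v (e i) / qform (e i) (e i)"

lemma coord_linear:
  "coord i (v + w) = coord i v + coord i w" "coord i (r *\<^sub>Q v) = r * coord i v"
  by (simp_all add: coord_def qform_add_left qform_scaleQ_left add_divide_distrib)

lemma coord_expansion: "v = (\<Sum>i<n. coord i v *\<^sub>Q e i)"
proof (rule Q_linear_eq_on_span[of "\<lambda>v. v" _ "e ` {..<n}"])
  show "Q_linear (\<lambda>v. \<Sum>i<n. coord i v *\<^sub>Q e i)"
    by (simp add: Q_linear_iff coord_linear scaleQ_add_left sum.distrib rat_vector.scale_sum_right)
  fix x assume "x \<in> e ` {..<n}"
  then obtain j where j: "j < n" "x = e j" by auto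
  have "coord i x = (if i = j then 1 else 0)" if "i < n" for i
    using j that orthogonal[of j i] anisotropic[of j] by (auto simp: coord_def)
  then have "(\<Sum>i<n. coord i x *\<^sub>Q e i) = (\<Sum>i<n. if i = j then e i else 0)"
    by (intro sum.cong) auto
  then show "x = (\<Sum>i<n. coord i x *\<^sub>Q e i)" using j by simp
qed (simp_all add: Q_linear_iff span_frame)

lemma qform_coord: "qform v v = (\<Sum>i<n. coord i v * coord i v * qform (e i) (e i))"
proof -
  have "qform v v = qform v (\<Sum>i<n. coord i v *\<^sub>Q e i)" using coord_expansion[of v] by simp
  also have "\<dots> = (\<Sum>i<n. coord i v * qform v (e i))"
    by (simp add: Q_linear_sum[OF Q_linear_qform(1)] qform_scaleQ_right)
  also have "\<dots> = (\<Sum>i<n. coord i v * coord i v * qform (e i) (e i))"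
    by (intro sum.cong refl) (simp add: coord_def anisotropic)
  finally show ?thesis .
qed

subsection \<open>The Clifford algebra is not zero\<close>

text \<open>Left multiplication by \<open>e i\<close> in coordinates with respect to the (still hypothetical) basis
  of ordered products \<open>e\<^sub>S\<close>, used to define a non-zero Clifford module.\<close>

definition coord_op :: "nat \<Rightarrow> (nat set \<Rightarrow> rat) \<Rightarrow> nat set \<Rightarrow> rat" where
  "coord_op i f S = (- 1) ^ card (S \<inter> {..<i}) *
     (if i \<in> S then 1 else qform (e i) (e i)) * f (toggle i S)"

text \<open>Toggling i leaves the indices below i alone, so the two signs coincide and cancel.
  Exactly one of the two applications meets a set without i and contributes the norm.\<close>

lemma coord_op_square: "coord_op i (coord_op i f) S = qform (e i) (e i) * f S"
proof -
  have "toggle i S \<inter> {..<i} = S \<inter> {..<i}" by (auto simp: toggle_def)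
  then show ?thesis
    by (simp add: coord_op_def toggle_toggle mem_toggle power_mult_distrib[symmetric]
        flip: mult.assoc power_add)
qed

text \<open>Toggling the larger index j does not change the number of indices below i, while
  toggling i changes the number below j by one; this is the single sign.\<close>

lemma coord_op_anticommute_less:
  assumes "i < j"
  shows "coord_op i (coord_op j f) S = - coord_op j (coord_op i f) S"
proof -
  have 1: "toggle j S \<inter> {..<i} = S \<inter> {..<i}" using assms by (auto simp: toggle_def)
  have 2: "(- 1 :: rat) ^ card (toggle i S \<inter> {..<j}) = - ((- 1) ^ card (S \<inter> {..<j}))"
  proof (cases "i \<in> S")
    case True
    then have "S \<inter> {..<j} = insert i (toggle i S \<inter> {..<j})" "i \<notin> toggle i S \<inter> {..<j}"
      using assms by (auto simp: toggle_def)
    then show ?thesis by simp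
  next
    case False
    then have "toggle i S \<inter> {..<j} = insert i (S \<inter> {..<j})" "i \<notin> S \<inter> {..<j}"
      using assms by (auto simp: toggle_def)
    then show ?thesis by simp
  qed
  show ?thesis
    using assms by (simp add: coord_op_def 1 2 mem_toggle toggle_commute[of j i])
qed

lemma coord_op_anticommute:
  "i \<noteq> j \<Longrightarrow> coord_op i (coord_op j f) S = - coord_op j (coord_op i f) S"
  using coord_op_anticommute_less[of i j f S] coord_op_anticommute_less[of j i f S]
  by (cases "i < j") auto

text \<open>The orbit map of the constant function 1 sends 1 to a non-zero function, which a linear
  map could not do if 1 were 0.\<close>

lemma clifford_one_neq_zero: "(1 :: 'v clifford) \<noteq> 0"
proof
  assume "(1 :: 'v clifford) = 0"
  define R where "R v f S = (\<Sum>i<n. coord i v * coord_op i f S)" for v f S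
  have "Q_bilinear R"
    by (simp add: Q_bilinear_def Q_linear_iff R_def fun_eq_iff scaleQ_fun_def coord_linear
        coord_op_def algebra_simps sum.distrib sum_distrib_left scaleQ_rat_def)
  moreover have "R v (R v f) = qform v v *\<^sub>Q f" for v f
  proof
    fix S
    define a where "a i j = coord i v * coord j v * coord_op i (coord_op j f) S" for i j
    have "R v (R v f) S = (\<Sum>i<n. \<Sum>j<n. a i j)"
      unfolding R_def a_def
      by (intro sum.cong refl) (simp add: coord_op_def sum_distrib_left algebra_simps)
    \<comment> \<open>Adding the double sum to its transpose cancels the off-diagonal terms by
      anticommutation and leaves twice the diagonal.\<close>
    moreover have "(\<Sum>i<n. \<Sum>j<n. a i j) + (\<Sum>i<n. \<Sum>j<n. a j i) = 2 * (\<Sum>i<n. a i i)"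
    proof -
      have "(\<Sum>i<n. \<Sum>j<n. a i j) + (\<Sum>i<n. \<Sum>j<n. a j i) =
          (\<Sum>i<n. \<Sum>j<n. if i = j then 2 * a i i else 0)"
        unfolding sum.distrib[symmetric]
      proof (intro sum.cong refl)
        fix i j
        show "a i j + a j i = (if i = j then 2 * a i i else 0)"
        proof (cases "i = j")
          case False
          from coord_op_anticommute[OF this] show ?thesis
            using False by (simp only: a_def) simp
        qed simp
      qed
      then show ?thesis by (simp add: sum_distrib_left)
    qed
    moreover have "(\<Sum>i<n. \<Sum>j<n. a j i) = (\<Sum>i<n. \<Sum>j<n. a i j)" by (rule sum.swap)
    ultimately have "R v (R v f) S = (\<Sum>i<n. a i i)" by simp
    also have "\<dots> = (qform v v *\<^sub>Q f) S"
      by (simp add: a_def coord_op_square qform_coord[of v] scaleQ_fun_def scaleQ_rat_def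
          sum_distrib_right mult.assoc)
    finally show "R v (R v f) S = (qform v v *\<^sub>Q f) S" .
  qed
  ultimately obtain \<rho> where \<rho>: "Q_linear \<rho>"
    "\<And>vs. \<rho> (clifford_word vs) = foldr R vs (\<lambda>_. 1)"
    using clifford_module_action[of R "\<lambda>_. 1"] by blast
  have "(\<lambda>_. 1) = \<rho> 1" using \<rho>(2)[of "[]"] by simp
  also have "\<dots> = 0" using \<open>1 = 0\<close> Q_linear_zero[OF \<rho>(1)] by simp
  finally show False by (simp add: fun_eq_iff)
qed

subsection \<open>Ordered products span\<close>

definition frame_word :: "nat list \<Rightarrow> 'v clifford" where
  "frame_word xs = clifford_word (map e xs)"

lemma frame_word_simps [simp]:
  "frame_word [] = 1"
  "frame_word (i # xs) = clifford_gen (e i) * frame_word xs"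
  "frame_word (xs @ ys) = frame_word xs * frame_word ys"
  by (simp_all add: frame_word_def clifford_word_append)

lemma clifford_gen_frame_anticommute:
  assumes "i < n" "j < n" "i \<noteq> j"
  shows "clifford_gen (e i) * clifford_gen (e j) = - (clifford_gen (e j) * clifford_gen (e i))"
  using clifford_gen_anticommute[of "e i" "e j"] orthogonal[OF assms]
  by (simp add: eq_neg_iff_add_eq_0)

text \<open>Each letter different from \<open>e i\<close> contributes a sign when \<open>e i\<close>
  passes it, and a letter equal to \<open>e i\<close> contributes none.\<close>

lemma frame_word_commute:
  assumes "i < n" "set xs \<subseteq> {..<n}"
  shows "clifford_gen (e i) * frame_word xs =
    ((- 1) ^ length (filter (\<lambda>j. j \<noteq> i) xs)) *\<^sub>Q (frame_word xs * clifford_gen (e i))"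
  using assms(2)
proof (induction xs)
  case Nil
  then show ?case by simp
next
  case (Cons j xs)
  have IH: "clifford_gen (e i) * frame_word xs =
    ((- 1) ^ length (filter (\<lambda>j. j \<noteq> i) xs)) *\<^sub>Q (frame_word xs * clifford_gen (e i))"
    using Cons by simp
  show ?case
  proof (cases "j = i")
    case True
    have "clifford_gen (e i) * (clifford_gen (e i) * frame_word xs) =
        (- 1) ^ length (filter (\<lambda>j. j \<noteq> i) xs) *\<^sub>Q
          (clifford_gen (e i) * (frame_word xs * clifford_gen (e i)))"
      by (subst IH) (simp only: scaleQ_mult_right)
    then show ?thesis using True by (simp add: mult.assoc)
  next
    case False
    then have "clifford_gen (e i) * (clifford_gen (e j) * frame_word xs) =
        - (clifford_gen (e j) * (clifford_gen (e i) * frame_word xs))"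
      using clifford_gen_frame_anticommute[of i j] Cons.prems assms(1)
      by (simp flip: mult.assoc)
    then show ?thesis using False by (simp add: IH scaleQ_mult_right mult.assoc)
  qed
qed

abbreviation ordered :: "nat set \<Rightarrow> nat list" where
  "ordered S \<equiv> filter (\<lambda>j. j \<in> S) [0..<n]"

text \<open>Past the letters below i, \<open>e i\<close> arrives at its place in the order. There it
  is either inserted or cancels against an \<open>e i\<close> already present. The scalar is a sign,
  times the norm in the case of cancellation.\<close>

lemma frame_word_toggle:
  assumes "i < n"
  shows "\<exists>r. clifford_gen (e i) * frame_word (ordered S) = r *\<^sub>Q frame_word (ordered (toggle i S))"
proof -
  define A where "A = filter (\<lambda>j. j \<in> S) [0..<i]"
  define B where "B = filter (\<lambda>j. j \<in> S) [Suc i..<n]"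
  have split: "[0..<n] = [0..<i] @ i # [Suc i..<n]"
    using assms upt_add_eq_append[of 0 i "n - i"] by (simp add: upt_conv_Cons)
  have ord: "ordered S = A @ (if i \<in> S then [i] else []) @ B"
    by (subst split) (simp add: A_def B_def)
  have "filter (\<lambda>j. j \<in> toggle i S) [0..<i] = A" "filter (\<lambda>j. j \<in> toggle i S) [Suc i..<n] = B"
    unfolding A_def B_def by (intro filter_cong refl; auto simp: toggle_def)+
  then have tog: "ordered (toggle i S) = A @ (if i \<in> S then [] else [i]) @ B"
    by (subst split) (simp add: mem_toggle)
  have "set A \<subseteq> {..<n}" using assms by (auto simp: A_def)
  from frame_word_commute[OF assms this] obtain s where
    s: "clifford_gen (e i) * frame_word A = s *\<^sub>Q (frame_word A * clifford_gen (e i))" by blast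
  show ?thesis
  proof (cases "i \<in> S")
    case True
    have "clifford_gen (e i) * frame_word (ordered S) =
        s *\<^sub>Q (frame_word A * (clifford_gen (e i) * clifford_gen (e i)) * frame_word B)"
      using True unfolding ord by (simp add: s scaleQ_mult_left flip: mult.assoc)
    also have "\<dots> = (s * qform (e i) (e i)) *\<^sub>Q frame_word (ordered (toggle i S))"
      using True unfolding tog
      by (simp add: clifford_gen_square scaleQ_mult_left scaleQ_mult_right)
    finally show ?thesis by blast
  next
    case False
    have "clifford_gen (e i) * frame_word (ordered S) = s *\<^sub>Q frame_word (ordered (toggle i S))"
      using False unfolding ord tog by (simp add: s scaleQ_mult_left flip: mult.assoc)
    then show ?thesis by blast
  qed
qed

text \<open>Each new letter toggles an index and so changes the parity of the set. Keeping track of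
  this parity lets the result restrict to the even part.\<close>

lemma clifford_word_in_span:
  "clifford_word vs \<in> rat_vector.span
     ((\<lambda>S. frame_word (ordered S)) ` {S. S \<subseteq> {..<n} \<and> even (card S) = even (length vs)})"
  (is "_ \<in> rat_vector.span (?f ` ?I vs)")
proof (induction vs)
  case Nil
  have "frame_word (ordered {}) = 1" by simp
  then show ?case by (intro rat_vector.span_base image_eqI[of _ _ "{}"]) auto
next
  case (Cons v vs)
  have gen: "clifford_gen (e i) * x \<in> rat_vector.span (?f ` ?I (v # vs))"
    if "i < n" "x \<in> rat_vector.span (?f ` ?I vs)" for i x
    using that(2)
  proof (induction rule: rat_vector.span_induct_alt)
    case base
    show ?case by (simp add: rat_vector.span_zero)
  next
    case (step c x y)
    then obtain S where S: "x = ?f S" "S \<subseteq> {..<n}" "even (card S) = even (length vs)" by auto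
    obtain r where r: "clifford_gen (e i) * ?f S = r *\<^sub>Q ?f (toggle i S)"
      using frame_word_toggle[OF \<open>i < n\<close>] by blast
    have "finite S" using S finite_subset by blast
    then have "even (card (toggle i S)) \<longleftrightarrow> \<not> even (card S)"
      by (auto simp: toggle_def card_Diff_singleton_if card_gt_0_iff Suc_le_eq)
    then have "toggle i S \<in> ?I (v # vs)" using S \<open>i < n\<close> by (auto simp: toggle_def)
    then have "?f (toggle i S) \<in> rat_vector.span (?f ` ?I (v # vs))"
      by (intro rat_vector.span_base imageI)
    then show ?case using step.IH r S(1)
      by (simp add: distrib_left scaleQ_mult_right rat_vector.span_add rat_vector.span_scale)
  qed
  have "clifford_gen v = (\<Sum>i<n. coord i v *\<^sub>Q clifford_gen (e i))"
    by (subst coord_expansion[of v])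
       (simp only: Q_linear_sum[OF Q_linear_clifford_gen] Q_linear_scaleQ[OF Q_linear_clifford_gen])
  then have "clifford_word (v # vs) =
      (\<Sum>i<n. coord i v *\<^sub>Q (clifford_gen (e i) * clifford_word vs))"
    by (simp add: sum_distrib_right scaleQ_mult_left)
  also have "\<dots> \<in> rat_vector.span (?f ` ?I (v # vs))"
    by (intro rat_vector.span_sum rat_vector.span_scale gen Cons.IH) simp
  finally show ?case .
qed

definition even_index :: "nat set set" where
  "even_index = {S. S \<subseteq> {..<n} \<and> even (card S)}"

definition even_basis :: "nat set \<Rightarrow> 'v even_clifford" where
  "even_basis S = even_word (map e (ordered S))"

lemma length_ordered: "S \<subseteq> {..<n} \<Longrightarrow> length (ordered S) = card S"
proof -
  assume S: "S \<subseteq> {..<n}"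
  have "set (ordered S) = S" using S by auto
  then show ?thesis using distinct_card[of "ordered S"] by simp
qed

lemma finite_even_index: "finite even_index"
  by (rule finite_subset[of _ "Pow {..<n}"]) (auto simp: even_index_def)

lemma Rep_even_basis: "S \<in> even_index \<Longrightarrow> Rep_even_clifford (even_basis S) = frame_word (ordered S)"
  by (simp add: even_index_def even_basis_def Rep_even_word length_ordered frame_word_def)

text \<open>The inclusion into the full Clifford algebra is linear and injective, so the spanning
  statement is transported back along it.\<close>

lemma span_even_basis: "rat_vector.span (even_basis ` even_index) = UNIV"
proof -
  interpret Rep: Vector_Spaces.linear scaleQ scaleQ "Rep_even_clifford :: 'v even_clifford \<Rightarrow> _"
    by (rule Q_linear_Rep_even)
  have "x \<in> rat_vector.span (even_basis ` even_index)" for x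
  proof -
    have "Rep_even_clifford x \<in> even_part" by (rule Rep_even_clifford)
    also have "even_part \<subseteq> rat_vector.span ((\<lambda>S. frame_word (ordered S)) ` even_index)"
      unfolding even_part_def
    proof (rule rat_vector.span_minimal)
      show "clifford_word ` {vs. even (length vs)} \<subseteq>
          rat_vector.span ((\<lambda>S. frame_word (ordered S)) ` even_index)"
      proof safe
        fix vs :: "'v list" assume "even (length vs)"
        then show "clifford_word vs \<in> rat_vector.span ((\<lambda>S. frame_word (ordered S)) ` even_index)"
          using clifford_word_in_span[of vs] by (simp add: even_index_def)
      qed
    qed simp
    also have "(\<lambda>S. frame_word (ordered S)) ` even_index = Rep_even_clifford ` even_basis ` even_index"
      unfolding image_image by (intro image_cong refl) (simp add: Rep_even_basis)
    finally have "Rep_even_clifford x \<in> Rep_even_clifford ` rat_vector.span (even_basis ` even_index)"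
      by (simp only: Rep.span_image)
    then show ?thesis by (auto simp: Rep_even_clifford_inject)
  qed
  then show ?thesis by blast
qed

lemma finite_dimensional_even: "finite_dimensional TYPE('v even_clifford)"
  unfolding finite_dimensional_def
  using span_even_basis finite_even_index by (intro exI[of _ "even_basis ` even_index"]) simp

subsection \<open>The trace form\<close>

definition tr :: "'v even_clifford \<Rightarrow> rat" where
  "tr x = lin_trace (\<lambda>y. x * y)"

lemma linear_tr: "Q_linear tr"
  by (simp add: Q_linear_iff tr_def distrib_right scaleQ_mult_left lin_trace_add lin_trace_scaleQ
      scaleQ_rat_def)

text \<open>This is the dimension of the even Clifford algebra, positive because that algebra is not
  zero.\<close>

lemma tr_one_neq_0: "tr 1 \<noteq> 0"
proof -
  have "(1 :: 'v even_clifford) \<noteq> 0"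
    using clifford_one_neq_zero
    by (simp add: Rep_even_clifford_inject[symmetric] one_even_clifford.rep_eq zero_even_clifford.rep_eq)
  from lin_trace_id_neq_0[OF finite_dimensional_even this] show ?thesis by (simp add: tr_def)
qed

text \<open>Conjugation by \<open>e i\<close> is an automorphism of the even Clifford algebra that sends such a word
  to its negative.\<close>

lemma tr_word_eq_0:
  assumes "even (length xs)" "set xs \<subseteq> {..<n}" "i < n" "odd (count_list xs i)"
  shows "tr (even_word (map e xs)) = 0"
proof -
  define x where "x = even_word (map e xs)"
  define s where "s y = vec_sandwich (e i) y (e i)" for y
  define q where "q = qform (e i) (e i)"
  have q: "q \<noteq> 0" using anisotropic[OF assms(3)] by (simp add: q_def)
  have lin_s: "Q_linear s" unfolding s_def by (rule Q_linear_vec_sandwich)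
  have lin_xs: "Q_linear (\<lambda>y. x * s y)"
    by (simp add: Q_linear_iff Q_linear_props[OF lin_s] distrib_left scaleQ_mult_right)
  have ss: "s (s y) = (q * q) *\<^sub>Q y" for y
  proof -
    have "Rep_even_clifford (s (s y)) = (clifford_gen (e i) * clifford_gen (e i)) *
        Rep_even_clifford y * (clifford_gen (e i) * clifford_gen (e i))"
      by (simp add: s_def vec_sandwich.rep_eq mult.assoc)
    then show ?thesis
      by (simp add: Rep_even_clifford_inject[symmetric] clifford_gen_square q_def
          scaleQ_even_clifford.rep_eq scaleQ_mult_left scaleQ_mult_right)
  qed
  have Rep_x: "Rep_even_clifford x = frame_word xs"
    using assms(1) by (simp add: x_def Rep_even_word frame_word_def)
  \<comment> \<open>The length of the word is even and i occurs an odd number of times, so the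
    number of other letters is odd: \<open>e i\<close> anticommutes with x.\<close>
  have "length (filter (\<lambda>j. j \<noteq> i) xs) + count_list xs i = length xs"
    by (induction xs) auto
  then have "odd (length (filter (\<lambda>j. j \<noteq> i) xs))"
    using assms(1,4) by (metis even_add)
  then have "clifford_gen (e i) * frame_word xs = - (frame_word xs * clifford_gen (e i))"
    using frame_word_commute[OF assms(3,2)] by simp
  then have "Rep_even_clifford (s (x * y)) = Rep_even_clifford (- (x * s y))" for y
    by (simp add: s_def vec_sandwich.rep_eq times_even_clifford.rep_eq uminus_even_clifford.rep_eq
        Rep_x flip: mult.assoc)
  then have sx: "s (x * y) = - (x * s y)" for y by (simp add: Rep_even_clifford_inject)
  have "(q * q) *\<^sub>Q (x * y) = - s (x * s y)" for y
    using sx[of "s y"] by (simp add: ss scaleQ_mult_right)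
  \<comment> \<open>Left multiplication by x equals -1/q^2 times itself composed with s on both
    sides. Cyclicity of the trace brings the two copies of s together, where they give q^2, and
    leaves tr x = - tr x.\<close>
  then have "x * y = (- inverse (q * q)) *\<^sub>Q s (x * s y)" for y
    using q by (metis (no_types, lifting) mult_eq_0_iff rat_vector.scale_left_imp_eq
        rat_vector.scale_minus_left rat_vector.scale_scale right_inverse scaleQ_one
        rat_vector.scale_minus_right)
  then have "(\<lambda>y. x * y) = (\<lambda>y. (- inverse (q * q)) *\<^sub>Q s (x * s y))" by (rule ext)
  then have "tr x = lin_trace (\<lambda>y. (- inverse (q * q)) *\<^sub>Q s (x * s y))"
    unfolding tr_def by (rule arg_cong)
  also have "\<dots> = - inverse (q * q) * lin_trace (\<lambda>y. s (x * s y))" by (rule lin_trace_scaleQ)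
  also have "lin_trace (\<lambda>y. s (x * s y)) = lin_trace (\<lambda>y. x * s (s y))"
    by (rule lin_trace_commute[OF finite_dimensional_even finite_dimensional_even lin_s lin_xs])
  also have "\<dots> = q * q * tr x" by (simp add: ss scaleQ_mult_right lin_trace_scaleQ tr_def)
  finally show ?thesis using q by (simp add: x_def field_simps)
qed

text \<open>The scalar is dictated by the telescoping product: a reversed ordered product times the
  ordered product is the product of the norms, of which the trace is then taken.\<close>

definition dual_basis :: "nat set \<Rightarrow> 'v even_clifford" where
  "dual_basis S = inverse (prod_list (map (\<lambda>i. qform (e i) (e i)) (ordered S)) * tr 1) *\<^sub>Q
     even_word (map e (rev (ordered S)))"

lemma tr_dual_basis:
  assumes "S \<in> even_index" "T \<in> even_index"
  shows "tr (dual_basis S * even_basis T) = (if S = T then 1 else 0)"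
proof -
  define p where "p = prod_list (map (\<lambda>i. qform (e i) (e i)) (ordered S))"
  have p: "p \<noteq> 0" using anisotropic by (auto simp: p_def prod_list_zero_iff)
  have even: "even (length (ordered S))" "even (length (ordered T))"
    using assms by (simp_all only: even_index_def mem_Collect_eq length_ordered)
  have mult: "dual_basis S * even_basis T = inverse (p * tr 1) *\<^sub>Q even_word (map e (rev (ordered S) @ ordered T))"
    using even by (simp add: dual_basis_def even_basis_def p_def scaleQ_mult_left even_word_append)
  show ?thesis
  proof (cases "S = T")
    case True
    have "clifford_word (map e (rev (ordered S) @ ordered S)) = p *\<^sub>Q 1"
      using clifford_word_rev_mult[of "map e (ordered S)"]
      by (simp add: clifford_word_append p_def rev_map comp_def)
    then have "even_word (map e (rev (ordered S) @ ordered S)) = p *\<^sub>Q 1"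
      using even by (simp add: Rep_even_clifford_inject[symmetric] Rep_even_word
          scaleQ_even_clifford.rep_eq one_even_clifford.rep_eq)
    then show ?thesis
      using True p tr_one_neq_0 unfolding mult
      by (simp add: Q_linear_scaleQ[OF linear_tr] scaleQ_rat_def field_simps)
  next
    case False
    \<comment> \<open>An index in exactly one of S and T occurs exactly once in the concatenated
      word, so the trace of that word vanishes.\<close>
    then obtain i where i: "i \<in> S \<longleftrightarrow> i \<notin> T" by blast
    then have "i < n" using assms by (auto simp: even_index_def)
    have "count_list (ordered U) i = (if i \<in> U then 1 else 0)" for U
      using \<open>i < n\<close> by (simp add: count_list_distinct)
    then have "odd (count_list (rev (ordered S) @ ordered T) i)" using i by auto
    moreover have "even (length (rev (ordered S) @ ordered T))" using even by simp
    ultimately have "tr (even_word (map e (rev (ordered S) @ ordered T))) = 0"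
      using \<open>i < n\<close> by (intro tr_word_eq_0[of _ i]) auto
    then show ?thesis
      using False unfolding mult by (simp add: Q_linear_scaleQ[OF linear_tr] scaleQ_rat_def)
  qed
qed

lemma Q_linear_tr_mult: "Q_linear (\<lambda>x. tr (y * x))"
  by (simp add: Q_linear_iff Q_linear_props[OF linear_tr] distrib_left scaleQ_mult_right)

text \<open>Both sides are linear and agree on a spanning set by biorthogonality, so coordinates are
  read off through traces.\<close>

lemma even_basis_expansion: "x = (\<Sum>S\<in>even_index. tr (dual_basis S * x) *\<^sub>Q even_basis S)"
proof (rule Q_linear_eq_on_span[of "\<lambda>x. x" _ "even_basis ` even_index"])
  show "Q_linear (\<lambda>x. \<Sum>S\<in>even_index. tr (dual_basis S * x) *\<^sub>Q even_basis S)"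
    by (simp add: Q_linear_iff Q_linear_props[OF linear_tr] distrib_left scaleQ_mult_right
        scaleQ_add_left sum.distrib rat_vector.scale_sum_right scaleQ_rat_def)
  fix x assume "x \<in> even_basis ` even_index"
  then obtain T where T: "T \<in> even_index" "x = even_basis T" by auto
  have "(\<Sum>S\<in>even_index. tr (dual_basis S * x) *\<^sub>Q even_basis S) =
      (\<Sum>S\<in>even_index. if S = T then even_basis S else 0)"
    using T by (intro sum.cong) (auto simp: tr_dual_basis)
  then show "x = (\<Sum>S\<in>even_index. tr (dual_basis S * x) *\<^sub>Q even_basis S)"
    using T finite_even_index by simp
qed (simp_all add: Q_linear_iff span_even_basis)

lemma trace_form_nondegenerate:
  assumes "\<And>y. tr (y * x) = 0"
  shows "x = 0"
  using even_basis_expansion[of x] assms by simp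

lemma trace_form_surjective:
  assumes "Q_linear \<phi>"
  shows "\<exists>y. \<forall>x. tr (y * x) = \<phi> x"
proof (intro exI allI)
  fix x
  \<comment> \<open>The witness is the combination of the dual basis whose coefficients are the
    values of \<phi> on \<open>even_basis\<close>.\<close>
  have "tr ((\<Sum>S\<in>even_index. \<phi> (even_basis S) *\<^sub>Q dual_basis S) * x) =
      (\<Sum>S\<in>even_index. \<phi> (even_basis S) * tr (dual_basis S * x))"
    by (simp add: sum_distrib_right Q_linear_sum[OF linear_tr] scaleQ_mult_left
        Q_linear_scaleQ[OF linear_tr] scaleQ_rat_def)
  also have "\<dots> = \<phi> (\<Sum>S\<in>even_index. tr (dual_basis S * x) *\<^sub>Q even_basis S)"
    by (simp add: Q_linear_sum[OF assms] Q_linear_scaleQ[OF assms] scaleQ_rat_def mult.commute)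
  finally show "tr ((\<Sum>S\<in>even_index. \<phi> (even_basis S) *\<^sub>Q dual_basis S) * x) = \<phi> x"
    by (simp only: even_basis_expansion[symmetric])
qed

lemma tr_commute: "tr (x * y) = tr (y * x)"
  unfolding tr_def mult.assoc
  by (rule lin_trace_commute[OF finite_dimensional_even finite_dimensional_even])
     (simp_all add: Q_linear_iff distrib_left scaleQ_mult_right)

end

section \<open>Existence of an orthogonal frame\<close>

definition nondegenerate :: "'v::quadratic_space itself \<Rightarrow> bool" where
  "nondegenerate _ \<longleftrightarrow> (\<forall>v :: 'v. (\<forall>w. qform v w = 0) \<longrightarrow> v = 0)"

lemma orthogonal_independent:
  fixes E :: "'v::quadratic_space set"
  assumes "\<And>x y. x \<in> E \<Longrightarrow> y \<in> E \<Longrightarrow> x \<noteq> y \<Longrightarrow> qform x y = 0" "\<And>x. x \<in> E \<Longrightarrow> qform x x \<noteq> 0"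
  shows "rat_vector.independent E"
  unfolding rat_vector.independent_explicit_finite_subsets
proof (intro allI impI ballI)
  fix S u v assume S: "S \<subseteq> E" "finite S" "(\<Sum>v\<in>S. u v *\<^sub>Q v) = 0" "v \<in> S"
  have "0 = qform v (\<Sum>w\<in>S. u w *\<^sub>Q w)" using S(3) by (simp add: Q_linear_zero[OF Q_linear_qform(1)])
  also have "\<dots> = (\<Sum>w\<in>S. if w = v then u v * qform v v else 0)"
    unfolding Q_linear_sum[OF Q_linear_qform(1)]
    using S assms(1) by (intro sum.cong) (auto simp: qform_scaleQ_right)
  finally show "u v = 0" using S assms(2)[of v] by auto
qed

text \<open>An orthogonal set E of anisotropic vectors is independent, so one of maximal size
  exists. On its complement W every norm vanishes, since otherwise E could be enlarged. Hence W lies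
  in the radical and is zero, and every vector equals its projection to the span of E.\<close>

lemma ex_orthogonal_frame:
  assumes fin: "finite_dimensional TYPE('v::quadratic_space)" and nondeg: "nondegenerate TYPE('v)"
  shows "\<exists>(e :: nat \<Rightarrow> 'v) n. orthogonal_frame e n"
proof -
  obtain B :: "'v set" where B: "finite B" "rat_vector.span B = UNIV"
    using fin by (auto simp: finite_dimensional_def)
  define ok :: "'v set \<Rightarrow> bool" where
    "ok E \<longleftrightarrow> (\<forall>x\<in>E. \<forall>y\<in>E. x \<noteq> y \<longrightarrow> qform x y = 0) \<and> (\<forall>x\<in>E. qform x x \<noteq> 0)" for E
  have bound: "finite E \<and> card E \<le> card B" if "ok E" for E
    using rat_vector.independent_span_bound[OF B(1), of E] B(2) that orthogonal_independent[of E]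
    by (auto simp: ok_def)
  have "ok {}" by (simp add: ok_def)
  then obtain E where E: "ok E" "\<And>F. ok F \<Longrightarrow> card F \<le> card E"
    using ex_has_greatest_nat[of ok "{}" card "Suc (card B)"] bound by (auto simp: less_Suc_eq_le)
  have finE: "finite E" using bound E by blast
  define W where "W = {v. \<forall>x\<in>E. qform x v = 0}"
  have W0: "qform v v = 0" if "v \<in> W" for v
  proof (rule ccontr)
    assume nz: "qform v v \<noteq> 0"
    then have "ok (insert v E)" using E(1) that by (auto simp: ok_def W_def qform_sym)
    moreover have "v \<notin> E" using nz that by (auto simp: W_def)
    ultimately show False using E(2)[of "insert v E"] finE by simp
  qed
  \<comment> \<open>Polarization turns the vanishing of all norms on W into the vanishing of the
    bilinear form.\<close>
  have WW: "qform v w = 0" if "v \<in> W" "w \<in> W" for v w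
  proof -
    have "v + w \<in> W" using that by (simp add: W_def qform_add_right)
    from W0[OF this] show ?thesis
      using W0[OF that(1)] W0[OF that(2)] by (simp add: qform_add_left qform_add_right qform_sym[of w v])
  qed
  define proj where "proj v = (\<Sum>x\<in>E. (qform x v / qform x x) *\<^sub>Q x)" for v
  have projW: "v - proj v \<in> W" for v
  proof -
    have "qform y (proj v) = qform y v" if "y \<in> E" for y
    proof -
      have "qform y (proj v) = (\<Sum>x\<in>E. if x = y then qform y v else 0)"
        unfolding proj_def Q_linear_sum[OF Q_linear_qform(1)]
        using E(1) that by (intro sum.cong refl) (auto simp: ok_def qform_scaleQ_right)
      then show ?thesis using finE that by simp
    qed
    then show ?thesis by (simp add: W_def Q_linear_diff[OF Q_linear_qform(1)])
  qed
  have W_zero: "v = 0" if "v \<in> W" for v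
  proof -
    have "qform v w = 0" for w
    proof -
      have "qform v (proj w) = 0"
        unfolding proj_def Q_linear_sum[OF Q_linear_qform(1)]
        using that by (intro sum.neutral) (auto simp: W_def qform_scaleQ_right qform_sym[of v])
      then show ?thesis
        using WW[OF that projW[of w]] by (simp add: Q_linear_diff[OF Q_linear_qform(1)])
    qed
    then show ?thesis using nondeg by (simp add: nondegenerate_def)
  qed
  have "v \<in> rat_vector.span E" for v
  proof -
    have "v = proj v" using W_zero[OF projW[of v]] by simp
    moreover have "proj v \<in> rat_vector.span E"
      unfolding proj_def by (intro rat_vector.span_sum rat_vector.span_scale rat_vector.span_base)
    ultimately show ?thesis by simp
  qed
  then have span: "rat_vector.span E = UNIV" by blast
  obtain e where e: "bij_betw e {..<card E} E"
    using ex_bij_betw_nat_finite[OF finE] by (auto simp: atLeast0LessThan)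
  have "orthogonal_frame e (card E)"
  proof
    fix i j assume "i < card E" "j < card E" "i \<noteq> j"
    then show "qform (e i) (e j) = 0"
      using E(1) e unfolding ok_def bij_betw_def inj_on_def by (metis imageI lessThan_iff)
  next
    fix i assume "i < card E"
    then show "qform (e i) (e i) \<noteq> 0" using E(1) e by (auto simp: ok_def bij_betw_def)
  next
    show "rat_vector.span (e ` {..<card E}) = UNIV" using e span by (simp add: bij_betw_def)
  qed
  then show ?thesis by blast
qed

section \<open>The Kuga--Satake correspondence\<close>

lemma tensor_linear_eqI:
  assumes "Q_linear f" "Q_linear g" "\<And>a b. f (pure_tensor a b) = g (pure_tensor a b)"
  shows "f t = g t"
  by (induction t rule: tensor_induct)
     (simp_all add: assms(3) Q_linear_add[OF assms(1)] Q_linear_add[OF assms(2)])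

lemma tensor_map_comp:
  assumes "Q_linear f" "Q_linear g" "Q_linear f'" "Q_linear g'"
  shows "tensor_map f g (tensor_map f' g' t) = tensor_map (\<lambda>x. f (f' x)) (\<lambda>y. g (g' y)) t"
  by (rule tensor_linear_eqI)
     (simp_all add: assms Q_linear_comp Q_linear_tensor_map tensor_map_pure)

lemma tensor_map_id: "tensor_map (\<lambda>x. x) (\<lambda>y. y) t = t"
  by (rule tensor_linear_eqI) (simp_all add: Q_linear_tensor_map tensor_map_pure Q_linear_iff[of "\<lambda>x. x"])

lemma inj_tensor_map:
  assumes "Q_linear f" "Q_linear g" "bij f" "bij g"
  shows "inj (tensor_map f g)"
proof (rule inj_on_inverseI)
  fix t
  show "tensor_map (inv_into UNIV f) (inv_into UNIV g) (tensor_map f g t) = t"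
    using assms by (simp add: tensor_map_comp Q_linear_inv bij_is_inj tensor_map_id)
qed

lemma linear_pure_tensor: "Q_linear (pure_tensor a)" "Q_linear (\<lambda>a. pure_tensor a b)"
  by (simp_all add: Q_linear_iff pure_tensor_add_left pure_tensor_add_right
      pure_tensor_scaleQ_left pure_tensor_scaleQ_right)

locale kuga_satake_space = orthogonal_frame e n
  for e :: "nat \<Rightarrow> 'v::quadratic_space" and n +
  fixes v0 f1 f2 :: 'v
  assumes auxiliary: "KS_auxiliary v0 f1 f2"
begin

abbreviation Q where "Q \<equiv> KS_form f1 f2"
abbreviation D where "D \<equiv> KS_form_dual f1 f2"

lemma Q_eq_tr: "Q x w = tr (vec_mult f1 f2 * even_rev x * w)"
  by (simp add: KS_form_def tr_def)

lemma Q_bilinear: "Q_bilinear Q"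
  by (simp add: Q_bilinear_def Q_linear_iff Q_eq_tr Q_linear_props[OF Q_linear_even_rev]
      Q_linear_props[OF linear_tr] distrib_left distrib_right scaleQ_mult_left scaleQ_mult_right)

lemma Q_linear1: "Q_linear (Q x)" and Q_linear2: "Q_linear (\<lambda>x. Q x w)"
  using Q_bilinear by (auto simp: Q_bilinear_def)

text \<open>Up to the non-zero scalar q(f1) q(f2) the inverse is f2 f1. Thus Q is the trace form
  twisted by a unit and by reversal, and both properties of the trace form pass to Q.\<close>

lemma f1f2_invertible: "\<exists>u. u * vec_mult f1 f2 = 1 \<and> vec_mult f1 f2 * u = 1"
proof -
  define r where "r = qform f1 f1 * qform f2 f2"
  have r: "r \<noteq> 0" using auxiliary by (auto simp: KS_auxiliary_def r_def)
  have "clifford_gen f1 * clifford_gen f2 * (clifford_gen f2 * clifford_gen f1) = r *\<^sub>Q 1"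
    "clifford_gen f2 * clifford_gen f1 * (clifford_gen f1 * clifford_gen f2) = r *\<^sub>Q 1"
    using clifford_word_rev_mult[of "[f2, f1]"] clifford_word_rev_mult[of "[f1, f2]"]
    by (simp_all add: r_def mult.assoc mult.commute)
  then have "vec_mult f1 f2 * vec_mult f2 f1 = r *\<^sub>Q 1" "vec_mult f2 f1 * vec_mult f1 f2 = r *\<^sub>Q 1"
    by (simp_all add: Rep_even_clifford_inject[symmetric] vec_mult.rep_eq one_even_clifford.rep_eq
        times_even_clifford.rep_eq scaleQ_even_clifford.rep_eq)
  then show ?thesis using r
    by (intro exI[of _ "inverse r *\<^sub>Q vec_mult f2 f1"]) (simp add: scaleQ_mult_left scaleQ_mult_right)
qed

lemma Q_nondegenerate:
  assumes "\<And>w. Q x w = 0"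
  shows "x = 0"
proof -
  have "vec_mult f1 f2 * even_rev x = 0"
    using assms by (intro trace_form_nondegenerate) (simp add: tr_commute[of _ "vec_mult f1 f2 * _"] Q_eq_tr)
  moreover obtain u where "u * vec_mult f1 f2 = 1" using f1f2_invertible by blast
  ultimately have "even_rev x = 0" by (metis mult.assoc mult_1 mult_zero_right)
  then show ?thesis using even_rev_even_rev[of x] Q_linear_zero[OF Q_linear_even_rev] by metis
qed

lemma Q_surjective:
  assumes "Q_linear \<phi>"
  shows "\<exists>x. Q x = \<phi>"
proof -
  obtain y where y: "\<And>w. tr (y * w) = \<phi> w" using trace_form_surjective[OF assms] by blast
  obtain u where u: "vec_mult f1 f2 * u = 1" using f1f2_invertible by blast
  have "Q (even_rev (u * y)) = \<phi>"
    by (rule ext) (simp add: Q_eq_tr even_rev_even_rev y u flip: mult.assoc)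
  then show ?thesis by blast
qed

lemma Rep_D: "Rep_rat_dual (D x) = Q x"
  unfolding KS_form_dual_def by (rule Abs_rat_dual_inverse) (simp add: Q_linear1)

lemma linear_D: "Q_linear D"
  unfolding Q_linear_iff Rep_rat_dual_inject[symmetric]
  by (simp add: Rep_D plus_rat_dual.rep_eq scaleQ_rat_dual.rep_eq fun_eq_iff Q_linear_props[OF Q_linear2])

lemma bij_D: "bij D"
proof (rule bijI)
  show "inj D"
  proof (rule injI)
    fix x y assume "D x = D y"
    then have "D (x - y) = 0" by (simp add: Q_linear_diff[OF linear_D])
    then have "Q (x - y) = (\<lambda>_. 0)" by (metis Rep_D zero_rat_dual.rep_eq)
    then have "x - y = 0" by (intro Q_nondegenerate) simp
    then show "x = y" by simp
  qed
  show "surj D"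
    unfolding surj_def
  proof
    fix h :: "'v even_clifford rat_dual"
    have "Q_linear (Rep_rat_dual h)" using Rep_rat_dual[of h] by simp
    then obtain x where "Q x = Rep_rat_dual h" using Q_surjective by blast
    then show "\<exists>x. h = D x" by (metis Rep_D Rep_rat_dual_inject)
  qed
qed

text \<open>The first argument of Q that represents the coordinate functional belonging to
  S.\<close>

definition Q_dual_basis :: "nat set \<Rightarrow> 'v even_clifford" where
  "Q_dual_basis S = (SOME x. Q x = (\<lambda>w. tr (dual_basis S * w)))"

lemma Q_dual_basis: "Q (Q_dual_basis S) w = tr (dual_basis S * w)"
  using someI_ex[OF Q_surjective[OF Q_linear_tr_mult[of "dual_basis S"]]]
  by (simp add: Q_dual_basis_def)

lemma Q_expansion_right: "(\<Sum>S\<in>even_index. Q (Q_dual_basis S) w *\<^sub>Q even_basis S) = w"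
  unfolding Q_dual_basis by (rule even_basis_expansion[symmetric])

text \<open>By non-degeneracy it is enough to pair with an arbitrary w; moving the coefficients into
  the second argument produces the expansion of w.\<close>

lemma Q_expansion_left: "(\<Sum>S\<in>even_index. Q x (even_basis S) *\<^sub>Q Q_dual_basis S) = x"
proof -
  have "Q ((\<Sum>S\<in>even_index. Q x (even_basis S) *\<^sub>Q Q_dual_basis S) - x) w = 0" for w
  proof -
    have "Q (\<Sum>S\<in>even_index. Q x (even_basis S) *\<^sub>Q Q_dual_basis S) w =
        Q x (\<Sum>S\<in>even_index. Q (Q_dual_basis S) w *\<^sub>Q even_basis S)"
      by (simp add: Q_linear_sum[OF Q_linear2] Q_linear_scaleQ[OF Q_linear2]
          Q_linear_sum[OF Q_linear1] Q_linear_scaleQ[OF Q_linear1] scaleQ_rat_def mult.commute)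
    then show ?thesis by (simp add: Q_linear_diff[OF Q_linear2] Q_expansion_right)
  qed
  from Q_nondegenerate[OF this] show ?thesis by simp
qed

lemma Q_bilinear_to_end: "Q_bilinear (\<lambda>x y. Q x w *\<^sub>Q (y :: 'v even_clifford))"
  by (simp add: Q_bilinear_def Q_linear_iff Q_linear_props[OF Q_linear2] scaleQ_add_left
      scaleQ_add_right scaleQ_rat_def mult.commute)

lemma linear_tensor_to_end: "Q_linear (\<lambda>t. tensor_to_end f1 f2 t w)"
  unfolding tensor_to_end_def by (rule Q_linear_tensor_lift[OF Q_bilinear_to_end])

lemma tensor_to_end_pure: "tensor_to_end f1 f2 (pure_tensor x y) w = Q x w *\<^sub>Q y"
  unfolding tensor_to_end_def by (rule tensor_lift_pure[OF Q_bilinear_to_end])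

text \<open>The inverse of the passage from tensors to endomorphisms: E comes from the sum of
  \<open>Q_dual_basis S\<close> tensor E(\<open>even_basis S\<close>). The formula yields
  injectivity here and the witness for surjectivity below.\<close>

lemma tensor_recover:
  "(\<Sum>S\<in>even_index. pure_tensor (Q_dual_basis S) (tensor_to_end f1 f2 t (even_basis S))) = t"
proof (rule tensor_linear_eqI[where g = "\<lambda>t. t"])
  show "Q_linear (\<lambda>t. \<Sum>S\<in>even_index.
      pure_tensor (Q_dual_basis S) (tensor_to_end f1 f2 t (even_basis S)))"
    by (simp add: Q_linear_iff Q_linear_props[OF linear_tensor_to_end] pure_tensor_add_right
        pure_tensor_scaleQ_right sum.distrib rat_vector.scale_sum_right)
  fix a b
  have "(\<Sum>S\<in>even_index.
      pure_tensor (Q_dual_basis S) (tensor_to_end f1 f2 (pure_tensor a b) (even_basis S))) =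
      pure_tensor (\<Sum>S\<in>even_index. Q a (even_basis S) *\<^sub>Q Q_dual_basis S) b"
    by (simp add: Q_linear_sum[OF linear_pure_tensor(2)] tensor_to_end_pure
        pure_tensor_scaleQ_left pure_tensor_scaleQ_right)
  then show "(\<Sum>S\<in>even_index.
      pure_tensor (Q_dual_basis S) (tensor_to_end f1 f2 (pure_tensor a b) (even_basis S))) =
      pure_tensor a b"
    by (simp add: Q_expansion_left)
qed (simp add: Q_linear_iff)

lemma tensor_to_end_inject: "tensor_to_end f1 f2 s = tensor_to_end f1 f2 t \<Longrightarrow> s = t"
  using tensor_recover[of s] tensor_recover[of t] by metis

lemma tensor_to_end_surjective:
  assumes "Q_linear E"
  shows "\<exists>t. tensor_to_end f1 f2 t = E"
proof (intro exI ext)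
  fix w
  have "tensor_to_end f1 f2 (\<Sum>S\<in>even_index. pure_tensor (Q_dual_basis S) (E (even_basis S))) w =
      E (\<Sum>S\<in>even_index. Q (Q_dual_basis S) w *\<^sub>Q even_basis S)"
    by (simp add: Q_linear_sum[OF linear_tensor_to_end] tensor_to_end_pure
        Q_linear_sum[OF assms] Q_linear_scaleQ[OF assms])
  then show "tensor_to_end f1 f2
      (\<Sum>S\<in>even_index. pure_tensor (Q_dual_basis S) (E (even_basis S))) w = E w"
    by (simp only: Q_expansion_right)
qed

lemma kuga_satake_eq:
  assumes "tensor_to_end f1 f2 t = (\<lambda>w. vec_sandwich v w v0)"
  shows "kuga_satake v0 f1 f2 v = tensor_map D D t"
proof -
  have "(THE t. tensor_to_end f1 f2 t = (\<lambda>w. vec_sandwich v w v0)) = t"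
    using assms by (intro the_equality tensor_to_end_inject) simp_all
  then show ?thesis by (simp add: kuga_satake_def)
qed

lemma kuga_satake_ex:
  "\<exists>t. tensor_to_end f1 f2 t = (\<lambda>w. vec_sandwich v w v0)"
  by (rule tensor_to_end_surjective[OF Q_linear_vec_sandwich])

text \<open>Anticommutators with all w recover the form, which determines the vector through its
  frame coordinates; this uses 1 \<noteq> 0.\<close>

lemma inj_clifford_gen: "inj (clifford_gen :: 'v \<Rightarrow> _)"
proof (rule injI)
  fix x y :: 'v
  assume "clifford_gen x = clifford_gen y"
  then have "clifford_gen (x - y) = 0" by (simp add: Q_linear_diff[OF Q_linear_clifford_gen])
  then have "(2 * qform (x - y) w) *\<^sub>Q (1 :: 'v clifford) = 0" for w
    using clifford_gen_anticommute[of "x - y" w] by simp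
  then have "qform (x - y) w = 0" for w using clifford_one_neq_zero by simp
  then show "x = y" using coord_expansion[of "x - y"] by (simp add: coord_def)
qed

text \<open>Evaluating the endomorphism at 1 gives v v0, and one more factor v0 on the right leaves
  q(v0) v with q(v0) \<noteq> 0.\<close>

lemma inj_kuga_satake: "inj (kuga_satake v0 f1 f2)"
proof (rule injI)
  fix v w
  assume eq: "kuga_satake v0 f1 f2 v = kuga_satake v0 f1 f2 w"
  obtain s t where s: "tensor_to_end f1 f2 s = (\<lambda>x. vec_sandwich v x v0)"
    and t: "tensor_to_end f1 f2 t = (\<lambda>x. vec_sandwich w x v0)"
    using kuga_satake_ex by meson
  have "s = t"
    using eq inj_tensor_map[OF linear_D linear_D bij_D bij_D]
    by (simp add: kuga_satake_eq[OF s] kuga_satake_eq[OF t] inj_eq)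
  then have "vec_sandwich v 1 v0 = vec_sandwich w 1 v0" using s t by metis
  then have "clifford_gen v * clifford_gen v0 = clifford_gen w * clifford_gen v0"
    by (simp add: Rep_even_clifford_inject[symmetric] vec_sandwich.rep_eq one_even_clifford.rep_eq)
  then have "clifford_gen v * (clifford_gen v0 * clifford_gen v0) =
      clifford_gen w * (clifford_gen v0 * clifford_gen v0)"
    by (simp flip: mult.assoc)
  then have "qform v0 v0 *\<^sub>Q clifford_gen v = qform v0 v0 *\<^sub>Q clifford_gen w"
    by (simp add: clifford_gen_square scaleQ_mult_right)
  then show "v = w" using auxiliary inj_clifford_gen by (simp add: KS_auxiliary_def inj_eq)
qed

end

section \<open>Transport of the correspondence along a similarity\<close>

lemma (in quadratic_similarity) lin_trace_\<Phi>:
  assumes "finite_dimensional TYPE('v even_clifford)" "finite_dimensional TYPE('w even_clifford)"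
  shows "lin_trace (\<lambda>y. \<Phi> x * y) = lin_trace (\<lambda>y. x * y)"
proof -
  have inv: "\<Phi> (inv_into UNIV \<Phi> y) = y" "inv_into UNIV \<Phi> (\<Phi> z) = z" for y z
    using bij_\<Phi> by (simp_all add: bij_is_surj surj_f_inv_f bij_is_inj)
  have lin: "Q_linear (\<lambda>y. x * inv_into UNIV \<Phi> y)"
    using Q_linear_inv[OF linear_\<Phi> bij_\<Phi>] by (simp add: Q_linear_iff distrib_left scaleQ_mult_right)
  \<comment> \<open>Left multiplication by \<Phi>(x) is left multiplication by x conjugated with
    \<Phi>.\<close>
  have "lin_trace (\<lambda>y. \<Phi> x * y) = lin_trace (\<lambda>y. \<Phi> (x * inv_into UNIV \<Phi> y))"
    by (simp add: \<Phi>_mult inv)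
  also have "\<dots> = lin_trace (\<lambda>y. x * inv_into UNIV \<Phi> (\<Phi> y))"
    by (rule lin_trace_commute[OF assms(2,1) linear_\<Phi> lin])
  finally show ?thesis by (simp add: inv)
qed

text \<open>The factor on \<open>\<psi> f1\<close> makes the product of the new f1 and f2 equal to
  \<open>\<Phi> (vec_mult f1 f2)\<close>, so that both trace forms agree along
  \<open>\<Phi>\<close>. The factor on \<open>\<psi> v0\<close> is the scalar left over at the end
  of the computation of the diagram.\<close>

locale kuga_satake_similarity =
  quadratic_similarity \<psi> \<mu> +
  V: kuga_satake_space e n v0 f1 f2 +
  W: kuga_satake_space e' n' "inverse (\<mu> * N\<^sup>2) *\<^sub>Q \<psi> v0" "inverse \<mu> *\<^sub>Q \<psi> f1" "\<psi> f2"
  for \<psi> :: "'v::quadratic_space \<Rightarrow> 'w::quadratic_space" and \<mu> and e :: "nat \<Rightarrow> 'v"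
    and n and v0 f1 f2 :: 'v and e' :: "nat \<Rightarrow> 'w" and n' and N :: rat +
  assumes N: "N \<noteq> 0"
begin

text \<open>The map on first homology of the isogeny to be constructed; N will clear the
  denominators of \<open>\<Phi>\<close> on the lattice.\<close>

definition G where "G x = N *\<^sub>Q \<Phi> x"

lemma linear_G: "Q_linear G"
  by (simp add: Q_linear_iff G_def Q_linear_props[OF linear_\<Phi>] scaleQ_add_right mult.commute)

lemma bij_G: "bij G"
proof (rule bijI)
  show "inj G" using N bij_\<Phi> by (auto simp: G_def inj_def bij_def)
  show "surj G"
    unfolding surj_def
  proof
    fix y
    obtain x where "\<Phi> x = inverse N *\<^sub>Q y" using bij_\<Phi> by (metis bij_pointE)
    then show "\<exists>x. y = G x" using N by (intro exI[of _ x]) (simp add: G_def)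
  qed
qed

lemma W_Q_G: "W.Q (G x) (G y) = N\<^sup>2 * V.Q x y"
proof -
  have "vec_mult (inverse \<mu> *\<^sub>Q \<psi> f1) (\<psi> f2) = \<Phi> (vec_mult f1 f2)"
    using Q_bilinear_vec_mult[where 'a = 'w] by (simp add: \<Phi>_vec_mult Q_bilinear_def Q_linear_iff)
  then have "W.Q (\<Phi> x) (\<Phi> y) = V.Q x y"
    using lin_trace_\<Phi>[OF V.finite_dimensional_even W.finite_dimensional_even]
    by (simp add: KS_form_def \<Phi>_even_rev[symmetric] \<Phi>_mult[symmetric])
  then show ?thesis
    by (simp add: G_def Q_linear_scaleQ[OF W.Q_linear1] Q_linear_scaleQ[OF W.Q_linear2]
        scaleQ_rat_def power2_eq_square)
qed

lemma kuga_satake_commutes: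
  assumes push: "Q_linear push" "\<And>h y. Rep_rat_dual (push h) (G y) = Rep_rat_dual h y"
  shows "tensor_map push push (kuga_satake v0 f1 f2 v) =
    kuga_satake (inverse (\<mu> * N\<^sup>2) *\<^sub>Q \<psi> v0) (inverse \<mu> *\<^sub>Q \<psi> f1) (\<psi> f2) (\<psi> v)"
proof -
  obtain t where t: "tensor_to_end f1 f2 t = (\<lambda>w. vec_sandwich v w v0)"
    using V.kuga_satake_ex by blast
  \<comment> \<open>Evaluated at G z, the pushed functional is Q(x, z), which is N^-2 times the
    target form at (G x, G z).\<close>
  have push_D: "push (V.D x) = inverse (N\<^sup>2) *\<^sub>Q W.D (G x)" for x
  proof -
    have "Rep_rat_dual (push (V.D x)) y = Rep_rat_dual (inverse (N\<^sup>2) *\<^sub>Q W.D (G x)) y" for y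
    proof -
      obtain z where "y = G z" using bij_G by (metis bij_pointE)
      then show ?thesis
        using N by (simp add: push(2) V.Rep_D W.Rep_D scaleQ_rat_dual.rep_eq W_Q_G scaleQ_rat_def)
    qed
    then show ?thesis by (simp add: Rep_rat_dual_inject[symmetric] fun_eq_iff)
  qed
  \<comment> \<open>Each of the two tensor factors contributes N^-2; this is the tensor that the
    target correspondence has to produce.\<close>
  define t' where "t' = inverse (N ^ 4) *\<^sub>Q tensor_map G G t"
  have "tensor_map push push (tensor_map V.D V.D t) =
      inverse (N ^ 4) *\<^sub>Q tensor_map W.D W.D (tensor_map G G t)"
  proof (rule tensor_linear_eqI[of "\<lambda>t. tensor_map push push (tensor_map V.D V.D t)"])
    show "Q_linear (\<lambda>t. tensor_map push push (tensor_map V.D V.D t))"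
      by (rule Q_linear_comp[OF Q_linear_tensor_map[OF push(1) push(1)]
            Q_linear_tensor_map[OF V.linear_D V.linear_D]])
    have "Q_linear (\<lambda>t. tensor_map W.D W.D (tensor_map G G t))"
      by (rule Q_linear_comp[OF Q_linear_tensor_map[OF W.linear_D W.linear_D]
            Q_linear_tensor_map[OF linear_G linear_G]])
    then show "Q_linear (\<lambda>t. inverse (N ^ 4) *\<^sub>Q tensor_map W.D W.D (tensor_map G G t))"
      by (simp add: Q_linear_iff scaleQ_add_right mult.commute)
    have "inverse (N\<^sup>2) * inverse (N\<^sup>2) = inverse (N ^ 4)"
      by (simp flip: inverse_mult_distrib power_add)
    then show "tensor_map push push (tensor_map V.D V.D (pure_tensor a b)) =
        inverse (N ^ 4) *\<^sub>Q tensor_map W.D W.D (tensor_map G G (pure_tensor a b))" for a b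
      by (simp add: push(1) V.linear_D W.linear_D linear_G tensor_map_pure push_D
          pure_tensor_scaleQ_left pure_tensor_scaleQ_right)
  qed
  then have eq: "tensor_map push push (kuga_satake v0 f1 f2 v) = tensor_map W.D W.D t'"
    by (simp add: V.kuga_satake_eq[OF t] t'_def Q_linear_scaleQ[OF Q_linear_tensor_map[OF W.linear_D W.linear_D]])
  have "tensor_to_end (inverse \<mu> *\<^sub>Q \<psi> f1) (\<psi> f2) t' =
      (\<lambda>w. vec_sandwich (\<psi> v) w (inverse (\<mu> * N\<^sup>2) *\<^sub>Q \<psi> v0))"
  proof
    fix w'
    obtain w where w: "w' = G w" using bij_G by (metis bij_pointE)
    \<comment> \<open>On a pure tensor the left side is the target form at (G a, G w) times G b,
      whence the factor N^2.\<close>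
    have "tensor_to_end (inverse \<mu> *\<^sub>Q \<psi> f1) (\<psi> f2) (tensor_map G G t) (G w) =
        N\<^sup>2 *\<^sub>Q G (tensor_to_end f1 f2 t w)"
      by (rule tensor_linear_eqI[of "\<lambda>t. tensor_to_end (inverse \<mu> *\<^sub>Q \<psi> f1) (\<psi> f2) (tensor_map G G t) (G w)"])
         (simp_all add: Q_linear_iff Q_linear_props[OF Q_linear_tensor_map[OF linear_G linear_G]]
           Q_linear_props[OF W.linear_tensor_to_end] Q_linear_props[OF V.linear_tensor_to_end]
           Q_linear_props[OF linear_G] tensor_map_pure[OF linear_G linear_G]
           W.tensor_to_end_pure V.tensor_to_end_pure W_Q_G scaleQ_add_right mult.commute)
    also have "G (tensor_to_end f1 f2 t w) = inverse \<mu> *\<^sub>Q vec_sandwich (\<psi> v) (G w) (\<psi> v0)"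
      by (simp add: t G_def \<Phi>_vec_sandwich Q_linear_scaleQ[OF Q_linear_vec_sandwich] mult.commute)
    finally have "tensor_to_end (inverse \<mu> *\<^sub>Q \<psi> f1) (\<psi> f2) t' w' =
        (inverse (N ^ 4) * (N\<^sup>2 * inverse \<mu>)) *\<^sub>Q vec_sandwich (\<psi> v) w' (\<psi> v0)"
      by (simp add: w t'_def Q_linear_scaleQ[OF W.linear_tensor_to_end])
    \<comment> \<open>This equation determines the scaling of the auxiliary vector
      \<open>\<psi> v0\<close>.\<close>
    also have "inverse (N ^ 4) * (N\<^sup>2 * inverse \<mu>) = inverse (\<mu> * N\<^sup>2)"
      using N by (simp add: field_simps power2_eq_square eval_nat_numeral)
    finally show "tensor_to_end (inverse \<mu> *\<^sub>Q \<psi> f1) (\<psi> f2) t' w' =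
        vec_sandwich (\<psi> v) w' (inverse (\<mu> * N\<^sup>2) *\<^sub>Q \<psi> v0)"
      by (simp only: Q_linear_scaleQ[OF Q_linear_vec_sandwich_right])
  qed
  from W.kuga_satake_eq[OF this] eq show ?thesis by simp
qed

end

section \<open>Extension of scalars\<close>

global_interpretation ext:
  vector_space "ext_scale :: 'k::{rat_algebra,field} \<Rightarrow> ('a::rat_vector, 'k) tensor \<Rightarrow> _"
  by (rule vector_space_ext_scale)

text \<open>A functional with value 1 at v, extended to real scalars, takes the value 1 on
  \<open>pure_tensor v 1\<close>.\<close>

lemma pure_tensor_one_eq_0: "pure_tensor v (1 :: real) = 0 \<Longrightarrow> v = 0"
proof (rule ccontr)
  assume 0: "pure_tensor v (1 :: real) = 0" and "v \<noteq> 0"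
  then obtain \<phi> :: "'a \<Rightarrow> rat" where \<phi>: "Q_linear \<phi>" "\<phi> v = 1" using ex_Q_functional by blast
  have "Q_bilinear (\<lambda>a (r :: real). \<phi> a *\<^sub>Q r)"
    by (simp add: Q_bilinear_def Q_linear_iff Q_linear_props[OF \<phi>(1)] scaleQ_add_left
        scaleQ_add_right scaleQ_rat_def mult.commute)
  from Q_linear_zero[OF Q_linear_tensor_lift[OF this]] tensor_lift_pure[OF this, of v 1] 0 \<phi>(2)
  show False by simp
qed

lemma pure_tensor_one_inject: "pure_tensor v (1 :: real) = pure_tensor w 1 \<longleftrightarrow> v = w"
  using pure_tensor_one_eq_0[of "v - w"] Q_linear_diff[of "\<lambda>v. pure_tensor v (1 :: real)" v w]
  by (auto simp: Q_linear_iff pure_tensor_add_left pure_tensor_scaleQ_left)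

text \<open>Both \<open>ext_bilin\<close> and \<open>ext_form\<close> are nested lifts, and a lift
  is meaningful only for a bilinear map. Here bilinearity of the inner lift is established once for
  both.\<close>

lemma tensor_double_lift:
  fixes T :: "'a::rat_vector \<Rightarrow> 'k::rat_vector \<Rightarrow> 'b::rat_vector \<Rightarrow> 'l::rat_vector \<Rightarrow> 'c::rat_vector"
  assumes T: "\<And>a r. Q_bilinear (T a r)" "\<And>b s. Q_bilinear (\<lambda>a r. T a r b s)"
  shows "Q_bilinear (\<lambda>x y. tensor_lift (\<lambda>a r. tensor_lift (T a r) y) x)" (is ?bilin)
    and "tensor_lift (\<lambda>a r. tensor_lift (T a r) (pure_tensor b s)) (pure_tensor a' r') = T a' r' b s"
proof -
  have inner: "Q_bilinear (\<lambda>a r. tensor_lift (T a r) y)" for y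
  proof -
    have T_lin: "T (a + a') r b s = T a r b s + T a' r b s" "T a (r + r') b s = T a r b s + T a r' b s"
      "T (c *\<^sub>Q a) r b s = c *\<^sub>Q T a r b s" "T a (c *\<^sub>Q r) b s = c *\<^sub>Q T a r b s" for a a' r r' b s c
      using T(2) by (auto simp: Q_bilinear_def Q_linear_iff)
    have add1: "tensor_lift (T (a + a') r) y = tensor_lift (T a r) y + tensor_lift (T a' r) y" for a a' r
    proof (induction y rule: tensor_induct)
      case (pure b s)
      show ?case unfolding tensor_lift_pure[OF T(1)] by (rule T_lin)
    next
      case (add s t)
      then show ?case
        by (simp only: Q_linear_add[OF Q_linear_tensor_lift[OF T(1)]] add_ac)
    qed
    have add2: "tensor_lift (T a (r + r')) y = tensor_lift (T a r) y + tensor_lift (T a r') y" for a r r'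
    proof (induction y rule: tensor_induct)
      case (pure b s)
      show ?case unfolding tensor_lift_pure[OF T(1)] by (rule T_lin)
    next
      case (add s t)
      then show ?case
        by (simp only: Q_linear_add[OF Q_linear_tensor_lift[OF T(1)]] add_ac)
    qed
    have scale1: "tensor_lift (T (c *\<^sub>Q a) r) y = c *\<^sub>Q tensor_lift (T a r) y" for c a r
    proof (induction y rule: tensor_induct)
      case (pure b s)
      show ?case unfolding tensor_lift_pure[OF T(1)] by (rule T_lin)
    next
      case (add s t)
      then show ?case
        by (simp only: Q_linear_add[OF Q_linear_tensor_lift[OF T(1)]] scaleQ_add_right)
    qed
    have scale2: "tensor_lift (T a (c *\<^sub>Q r)) y = c *\<^sub>Q tensor_lift (T a r) y" for c a r
    proof (induction y rule: tensor_induct)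
      case (pure b s)
      show ?case unfolding tensor_lift_pure[OF T(1)] by (rule T_lin)
    next
      case (add s t)
      then show ?case
        by (simp only: Q_linear_add[OF Q_linear_tensor_lift[OF T(1)]] scaleQ_add_right)
    qed
    show ?thesis using add1 add2 scale1 scale2 by (simp add: Q_bilinear_def Q_linear_iff)
  qed
  note lin = Q_linear_tensor_lift[OF inner] and pure = tensor_lift_pure[OF inner]
  show "tensor_lift (\<lambda>a r. tensor_lift (T a r) (pure_tensor b s)) (pure_tensor a' r') = T a' r' b s"
    unfolding pure by (rule tensor_lift_pure[OF T(1)])
  have "Q_linear (\<lambda>y. tensor_lift (\<lambda>a r. tensor_lift (T a r) y) x)" for x
    unfolding Q_linear_iff
  proof (intro conjI allI)
    fix y y' and c :: rat
    show "tensor_lift (\<lambda>a r. tensor_lift (T a r) (y + y')) x =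
        tensor_lift (\<lambda>a r. tensor_lift (T a r) y) x + tensor_lift (\<lambda>a r. tensor_lift (T a r) y') x"
    proof (induction x rule: tensor_induct)
      case (pure a r)
      show ?case
        unfolding tensor_lift_pure[OF inner] by (rule Q_linear_add[OF Q_linear_tensor_lift[OF T(1)]])
    next
      case (add s t)
      show ?case
        unfolding Q_linear_add[OF Q_linear_tensor_lift[OF inner]] add.IH by (simp only: add_ac)
    qed
    show "tensor_lift (\<lambda>a r. tensor_lift (T a r) (c *\<^sub>Q y)) x =
        c *\<^sub>Q tensor_lift (\<lambda>a r. tensor_lift (T a r) y) x"
    proof (induction x rule: tensor_induct)
      case (pure a r)
      show ?case
        unfolding tensor_lift_pure[OF inner] by (rule Q_linear_scaleQ[OF Q_linear_tensor_lift[OF T(1)]])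
    next
      case (add s t)
      show ?case
        unfolding Q_linear_add[OF Q_linear_tensor_lift[OF inner]] add.IH scaleQ_add_right ..
    qed
  qed
  then show ?bilin using lin unfolding Q_bilinear_def by blast
qed

lemma ext_bilin:
  fixes B :: "'a::rat_vector \<Rightarrow> 'b::rat_vector \<Rightarrow> 'c::rat_vector"
  assumes "Q_bilinear B"
  shows Q_bilinear_ext_bilin: "Q_bilinear (ext_bilin B :: ('a, 'k::{rat_algebra,field}) tensor \<Rightarrow> _)"
    and ext_bilin_pure: "ext_bilin B (pure_tensor a (r :: 'k)) (pure_tensor b s) =
      pure_tensor (B a b) (r * s)"
proof -
  have "Q_bilinear (\<lambda>b (s :: 'k). pure_tensor (B a b) (r * s))" for a r
    using assms by (simp add: Q_bilinear_def Q_linear_iff pure_tensor_add_left pure_tensor_add_right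
        pure_tensor_scaleQ_left pure_tensor_scaleQ_right distrib_left scaleQ_mult_right)
  moreover have "Q_bilinear (\<lambda>a (r :: 'k). pure_tensor (B a b) (r * s))" for b s
    using assms by (simp add: Q_bilinear_def Q_linear_iff pure_tensor_add_left pure_tensor_add_right
        pure_tensor_scaleQ_left pure_tensor_scaleQ_right distrib_right scaleQ_mult_left)
  ultimately show "Q_bilinear (ext_bilin B :: ('a, 'k) tensor \<Rightarrow> _)"
    and "ext_bilin B (pure_tensor a (r :: 'k)) (pure_tensor b s) = pure_tensor (B a b) (r * s)"
    unfolding ext_bilin_def[abs_def] by (rule tensor_double_lift)+
qed

lemma ext_form:
  fixes B :: "'a::rat_vector \<Rightarrow> 'b::rat_vector \<Rightarrow> rat"
  assumes "Q_bilinear B"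
  shows Q_bilinear_ext_form: "Q_bilinear (ext_form B :: ('a, 'k::{rat_algebra,field}) tensor \<Rightarrow> _)"
    and ext_form_pure: "ext_form B (pure_tensor a (r :: 'k)) (pure_tensor b s) = B a b *\<^sub>Q (r * s)"
proof -
  have "Q_bilinear (\<lambda>b (s :: 'k). B a b *\<^sub>Q (r * s))" for a r
    using assms by (simp add: Q_bilinear_def Q_linear_iff scaleQ_add_left scaleQ_add_right
        scaleQ_rat_def distrib_left scaleQ_mult_right mult.commute)
  moreover have "Q_bilinear (\<lambda>a (r :: 'k). B a b *\<^sub>Q (r * s))" for b s
    using assms by (simp add: Q_bilinear_def Q_linear_iff scaleQ_add_left scaleQ_add_right
        scaleQ_rat_def distrib_right scaleQ_mult_left mult.commute[of _ "B _ _"])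
  ultimately show "Q_bilinear (ext_form B :: ('a, 'k) tensor \<Rightarrow> _)"
    and "ext_form B (pure_tensor a (r :: 'k)) (pure_tensor b s) = B a b *\<^sub>Q (r * s)"
    unfolding ext_form_def[abs_def] by (rule tensor_double_lift)+
qed

lemma Q_bilinear_mult: "Q_bilinear ((*) :: 'a::rat_algebra \<Rightarrow> 'a \<Rightarrow> 'a)"
  by (simp add: Q_bilinear_def Q_linear_iff distrib_left distrib_right scaleQ_mult_left
      scaleQ_mult_right)

lemma Q_bilinear_props:
  assumes "Q_bilinear B"
  shows "B (x + x') y = B x y + B x' y" "B x (y + y') = B x y + B x y'"
    "B (c *\<^sub>Q x) y = c *\<^sub>Q B x y" "B x (c *\<^sub>Q y) = c *\<^sub>Q B x y"
    "B (x - x') y = B x y - B x' y" "B x (y - y') = B x y - B x y'" "B 0 y = 0"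
proof -
  have lin: "Q_linear (B x)" "Q_linear (\<lambda>x. B x y)" for x y
    using assms by (simp_all add: Q_bilinear_def)
  show "B (x + x') y = B x y + B x' y" "B x (y + y') = B x y + B x y'"
    "B (c *\<^sub>Q x) y = c *\<^sub>Q B x y" "B x (c *\<^sub>Q y) = c *\<^sub>Q B x y"
    "B (x - x') y = B x y - B x' y" "B x (y - y') = B x y - B x y'" "B 0 y = 0"
    by (simp_all add: Q_linear_props[OF lin(1)] Q_linear_props[OF lin(2)])
qed

lemma tensor_bilinear_eqI:
  assumes "Q_bilinear B" "Q_bilinear B'"
    and "\<And>a r b s. B (pure_tensor a r) (pure_tensor b s) = B' (pure_tensor a r) (pure_tensor b s)"
  shows "B x y = B' x y"
proof (rule tensor_linear_eqI[of "\<lambda>x. B x y"])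
  show "Q_linear (\<lambda>x. B x y)" "Q_linear (\<lambda>x. B' x y)" using assms by (auto simp: Q_bilinear_def)
  show "B (pure_tensor a r) y = B' (pure_tensor a r) y" for a r
    by (rule tensor_linear_eqI) (use assms in \<open>auto simp: Q_bilinear_def\<close>)
qed

lemma ext_scale_add: "ext_scale (c :: 'k::{rat_algebra,field}) (x + y) = ext_scale c x + ext_scale c y"
  by (rule ext.scale_right_distrib)

lemma ext_form_scale:
  fixes c :: "'k::{rat_algebra,field}"
  assumes B: "Q_bilinear B"
  shows ext_form_scale_left: "ext_form B (ext_scale c x) y = c * ext_form B x y"
    and ext_form_scale_right: "ext_form B x (ext_scale c y) = c * ext_form B x y"
  by (rule tensor_bilinear_eqI[of "\<lambda>x y. ext_form B (ext_scale c x) y"],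
      use Q_bilinear_ext_form[OF B, where 'k = 'k] in \<open>simp_all add: Q_bilinear_def Q_linear_iff
        ext_scale_add Q_linear_scaleQ[OF Q_linear_ext_scale] distrib_left scaleQ_mult_right
        ext_scale_pure ext_form_pure[OF B] mult.assoc\<close>)
     (rule tensor_bilinear_eqI[of "\<lambda>x y. ext_form B x (ext_scale c y)"],
      use Q_bilinear_ext_form[OF B, where 'k = 'k] in \<open>simp_all add: Q_bilinear_def Q_linear_iff
        ext_scale_add Q_linear_scaleQ[OF Q_linear_ext_scale] distrib_left scaleQ_mult_right
        ext_scale_pure ext_form_pure[OF B] mult.left_commute\<close>)

lemma ext_bilin_scale:
  fixes c :: "'k::{rat_algebra,field}"
  assumes B: "Q_bilinear B"
  shows ext_bilin_scale_left: "ext_bilin B (ext_scale c x) y = ext_scale c (ext_bilin B x y)"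
    and ext_bilin_scale_right: "ext_bilin B x (ext_scale c y) = ext_scale c (ext_bilin B x y)"
  by (rule tensor_bilinear_eqI[of "\<lambda>x y. ext_bilin B (ext_scale c x) y"],
      use Q_bilinear_ext_bilin[OF B, where 'k = 'k] in \<open>simp_all add: Q_bilinear_def Q_linear_iff
        ext_scale_add Q_linear_scaleQ[OF Q_linear_ext_scale]
        ext_scale_pure ext_bilin_pure[OF B] mult.assoc\<close>)
     (rule tensor_bilinear_eqI[of "\<lambda>x y. ext_bilin B x (ext_scale c y)"],
      use Q_bilinear_ext_bilin[OF B, where 'k = 'k] in \<open>simp_all add: Q_bilinear_def Q_linear_iff
        ext_scale_add Q_linear_scaleQ[OF Q_linear_ext_scale]
        ext_scale_pure ext_bilin_pure[OF B] mult.left_commute\<close>)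

definition ext_map :: "('a::rat_vector \<Rightarrow> 'b::rat_vector) \<Rightarrow> ('a, 'k::rat_algebra) tensor \<Rightarrow> ('b, 'k) tensor" where
  "ext_map f = tensor_map f id"

lemma Q_linear_id: "Q_linear id" by (simp add: Q_linear_iff)

lemma ext_map:
  fixes f :: "'a::rat_vector \<Rightarrow> 'b::rat_vector"
  assumes "Q_linear f"
  shows Q_linear_ext_map: "Q_linear (ext_map f :: ('a, 'k::rat_algebra) tensor \<Rightarrow> _)"
    and ext_map_pure: "ext_map f (pure_tensor a (r :: 'k)) = pure_tensor (f a) r"
  unfolding ext_map_def
  using Q_linear_tensor_map[OF assms Q_linear_id] tensor_map_pure[OF assms Q_linear_id, of a r]
  by simp_all

lemma ext_map_scale:
  assumes "Q_linear f"
  shows "ext_map f (ext_scale (c :: 'k::{rat_algebra,field}) x) = ext_scale c (ext_map f x)"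
  by (rule tensor_linear_eqI[of "\<lambda>x. ext_map f (ext_scale c x)"])
     (simp_all only: Q_linear_comp Q_linear_ext_map[OF assms] Q_linear_ext_scale ext_map_pure[OF assms] ext_scale_pure)

lemma ext_map_bilin:
  assumes B: "Q_bilinear B" "Q_bilinear B'" and lin: "Q_linear f" "Q_linear g" "Q_linear h"
    and nat: "\<And>a b. h (B a b) = B' (f a) (g b)"
  shows "ext_map h (ext_bilin B x y) =
    ext_bilin B' (ext_map f x) (ext_map g y :: ('d::rat_vector, 'k::{rat_algebra,field}) tensor)"
  by (rule tensor_bilinear_eqI[of "\<lambda>x y. ext_map h (ext_bilin B x y)"],
      use Q_bilinear_ext_bilin[OF B(1), where 'k = 'k] Q_bilinear_ext_bilin[OF B(2), where 'k = 'k]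
        Q_linear_ext_map[OF lin(1), where 'k = 'k] Q_linear_ext_map[OF lin(2), where 'k = 'k]
        Q_linear_ext_map[OF lin(3), where 'k = 'k]
      in \<open>simp_all add: Q_bilinear_def Q_linear_iff\<close>)
     (simp add: ext_bilin_pure[OF B(1)] ext_bilin_pure[OF B(2)] ext_map_pure lin nat)

lemma ext_form_map:
  assumes B: "Q_bilinear B" "Q_bilinear B'" and lin: "Q_linear f" "Q_linear g"
    and nat: "\<And>a b. B' (f a) (g b) = \<mu> * B a b"
  shows "ext_form B' (ext_map f x) (ext_map g y) =
    \<mu> *\<^sub>Q (ext_form B x y :: 'k::{rat_algebra,field})"
  by (rule tensor_bilinear_eqI[of "\<lambda>x y. ext_form B' (ext_map f x) (ext_map g y)"],
      use Q_bilinear_ext_form[OF B(1), where 'k = 'k] Q_bilinear_ext_form[OF B(2), where 'k = 'k]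
        Q_linear_ext_map[OF lin(1), where 'k = 'k] Q_linear_ext_map[OF lin(2), where 'k = 'k]
      in \<open>simp_all add: Q_bilinear_def Q_linear_iff scaleQ_add_right mult.commute\<close>)
     (simp add: ext_form_pure[OF B(1)] ext_form_pure[OF B(2)] ext_map_pure lin nat mult.commute)

subsection \<open>Real and imaginary parts\<close>

lemma of_rat_complex: "of_rat r = complex_of_real (of_rat r)"
  by (cases r) (simp add: of_rat_rat)

lemma Q_linear_real_complex:
  "Q_linear complex_of_real" "Q_linear Re" "Q_linear Im" "Q_linear cnj"
  by (simp_all add: Q_linear_iff scaleQ_real_def scaleQ_complex_def of_rat_complex)

definition ext_Re :: "'a::rat_vector complex_ext \<Rightarrow> 'a real_ext" where "ext_Re = tensor_map id Re"
definition ext_Im :: "'a::rat_vector complex_ext \<Rightarrow> 'a real_ext" where "ext_Im = tensor_map id Im"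

lemma ext_real_complex_linear:
  "Q_linear real_to_complex" "Q_linear ext_Re" "Q_linear ext_Im" "Q_linear ext_cnj"
  unfolding real_to_complex_def ext_Re_def ext_Im_def ext_cnj_def
  by (intro Q_linear_tensor_map Q_linear_id Q_linear_real_complex)+

lemma ext_real_complex_pure:
  "real_to_complex (pure_tensor a r) = pure_tensor a (complex_of_real r)"
  "ext_Re (pure_tensor a z) = pure_tensor a (Re z)"
  "ext_Im (pure_tensor a z) = pure_tensor a (Im z)"
  "ext_cnj (pure_tensor a z) = pure_tensor a (cnj z)"
  unfolding real_to_complex_def ext_Re_def ext_Im_def ext_cnj_def
  by (simp_all add: tensor_map_pure Q_linear_id Q_linear_real_complex)

lemmas real_to_complex_add = Q_linear_add[OF ext_real_complex_linear(1)]

lemma real_to_complex_scale: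
  "real_to_complex (ext_scale c x) = ext_scale (complex_of_real c) (real_to_complex x)"
  by (induction x rule: tensor_induct)
     (simp_all add: ext_scale_pure ext_scale_add ext_real_complex_pure real_to_complex_add)

lemma ext_Re_scale: "ext_Re (ext_scale c (real_to_complex x)) = ext_scale (Re c) x"
  by (induction x rule: tensor_induct)
     (simp_all add: ext_scale_pure ext_scale_add ext_real_complex_pure real_to_complex_add
       Q_linear_add[OF ext_real_complex_linear(2)])

lemma ext_Im_scale: "ext_Im (ext_scale c (real_to_complex x)) = ext_scale (Im c) x"
  by (induction x rule: tensor_induct)
     (simp_all add: ext_scale_pure ext_scale_add ext_real_complex_pure real_to_complex_add
       Q_linear_add[OF ext_real_complex_linear(3)])

lemma ext_cnj_scale: "ext_cnj (ext_scale c x) = ext_scale (cnj c) (ext_cnj x)"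
  by (induction x rule: tensor_induct)
     (simp_all add: ext_scale_pure ext_scale_add ext_real_complex_pure
       Q_linear_add[OF ext_real_complex_linear(4)])

lemma ext_cnj_real: "ext_cnj (real_to_complex x) = real_to_complex x"
  by (induction x rule: tensor_induct)
     (simp_all add: ext_real_complex_pure real_to_complex_add
       Q_linear_add[OF ext_real_complex_linear(4)])

lemma complex_ext_decompose:
  "z = real_to_complex (ext_Re z) + ext_scale \<i> (real_to_complex (ext_Im z))"
proof (induction z rule: tensor_induct)
  case (pure a c)
  have "pure_tensor a c = pure_tensor a (complex_of_real (Re c)) + pure_tensor a (\<i> * complex_of_real (Im c))"
    by (simp flip: pure_tensor_add_right complex_eq)
  then show ?case unfolding ext_real_complex_pure ext_scale_pure .
next
  case (add s t)
  have "s + t = (real_to_complex (ext_Re s) + ext_scale \<i> (real_to_complex (ext_Im s))) +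
      (real_to_complex (ext_Re t) + ext_scale \<i> (real_to_complex (ext_Im t)))"
    using add by simp
  also have "\<dots> = real_to_complex (ext_Re (s + t)) + ext_scale \<i> (real_to_complex (ext_Im (s + t)))"
    by (simp add: Q_linear_add[OF ext_real_complex_linear(2)] Q_linear_add[OF ext_real_complex_linear(3)]
        real_to_complex_add ext_scale_add algebra_simps)
  finally show ?case .
qed

lemma ext_map_real_to_complex:
  assumes "Q_linear f"
  shows "ext_map f (real_to_complex x) = real_to_complex (ext_map f x)"
  by (induction x rule: tensor_induct)
     (simp_all add: ext_real_complex_pure real_to_complex_add ext_map_pure[OF assms]
       Q_linear_add[OF Q_linear_ext_map[OF assms]])

lemma ext_form_real_to_complex:
  assumes B: "Q_bilinear B"
  shows "ext_form B (real_to_complex x) (real_to_complex y) = complex_of_real (ext_form B x y)"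
proof (rule tensor_bilinear_eqI[of "\<lambda>x y. ext_form B (real_to_complex x) (real_to_complex y)"])
  show "Q_bilinear (\<lambda>x y. ext_form B (real_to_complex x) (real_to_complex y))"
    using Q_bilinear_ext_form[OF B, where 'k = complex]
    by (simp add: Q_bilinear_def Q_linear_iff real_to_complex_add
        Q_linear_scaleQ[OF ext_real_complex_linear(1)])
  show "Q_bilinear (\<lambda>x y. complex_of_real (ext_form B x y))"
    using Q_bilinear_ext_form[OF B, where 'k = real] Q_linear_real_complex(1)
    by (simp add: Q_bilinear_def Q_linear_iff)
qed (simp add: ext_real_complex_pure ext_form_pure[OF B] scaleQ_real_def scaleQ_complex_def of_rat_complex)

section \<open>Hodge structures of K3 type\<close>

lemma Q_bilinear_qform: "Q_bilinear qform"
  by (simp add: Q_bilinear_def Q_linear_qform)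

lemmas ext_qform_props = Q_bilinear_props[OF Q_bilinear_ext_form[OF Q_bilinear_qform]]
  and ext_qform_scale = ext_form_scale[OF Q_bilinear_qform]
  and ext_vec_mult_props = Q_bilinear_props[OF Q_bilinear_ext_bilin[OF Q_bilinear_vec_mult]]

lemma ext_qform_sym: "ext_form qform x y = (ext_form qform y x :: 'k::{rat_algebra,field})"
  by (rule tensor_bilinear_eqI[of "ext_form qform" "\<lambda>x y. ext_form qform y x"])
     (use Q_bilinear_ext_form[OF Q_bilinear_qform, where 'k = 'k] in
       \<open>auto simp: Q_bilinear_def ext_form_pure[OF Q_bilinear_qform] qform_sym mult.commute\<close>)

lemma ext_vec_mult_anticommute:
  "ext_bilin vec_mult x y + ext_bilin vec_mult y x =
     ext_scale (2 * ext_form qform x y) (pure_tensor 1 (1 :: real))"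
proof (rule tensor_bilinear_eqI[of "\<lambda>x y. ext_bilin vec_mult x y + ext_bilin vec_mult y x"])
  show "Q_bilinear (\<lambda>x y. ext_bilin vec_mult x y + ext_bilin vec_mult y (x :: 'a real_ext))"
    by (simp add: Q_bilinear_def Q_linear_iff ext_vec_mult_props scaleQ_add_right)
  have scale: "ext_scale (r *\<^sub>Q c) z = r *\<^sub>Q ext_scale c z" for r and c :: real and z :: "'a even_clifford real_ext"
    by (induction z rule: tensor_induct)
       (simp_all add: ext_scale_pure scaleQ_mult_left pure_tensor_scaleQ_right ext_scale_add scaleQ_add_right)
  show "Q_bilinear (\<lambda>x y :: 'a real_ext.
      ext_scale (2 * ext_form qform x y) (pure_tensor 1 (1 :: real)) :: 'a even_clifford real_ext)"
    by (simp add: Q_bilinear_def Q_linear_iff ext_qform_props distrib_left ext.scale_left_distrib scaleQ_mult_right scale)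
  fix a b :: 'a and r s :: real
  have "pure_tensor (vec_mult a b) (r * s) + pure_tensor (vec_mult b a) (s * r) =
      pure_tensor ((2 * qform a b) *\<^sub>Q 1) (r * s)"
    by (simp add: mult.commute[of s] flip: pure_tensor_add_left vec_mult_anticommute)
  also have "\<dots> = ext_scale (2 * (qform a b *\<^sub>Q (r * s))) (pure_tensor 1 1)"
    by (simp add: ext_scale_pure pure_tensor_scaleQ_left scaleQ_real_def of_rat_mult mult.assoc
        flip: pure_tensor_scaleQ_right)
  finally show "ext_bilin vec_mult (pure_tensor a r) (pure_tensor b s) +
      ext_bilin vec_mult (pure_tensor b s) (pure_tensor a r) =
      ext_scale (2 * ext_form qform (pure_tensor a r) (pure_tensor b s)) (pure_tensor 1 1)"
    by (simp only: ext_bilin_pure[OF Q_bilinear_vec_mult] ext_form_pure[OF Q_bilinear_qform])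
qed

lemma ext_cnj_rectangular:
  "ext_cnj (real_to_complex a + ext_scale \<i> (real_to_complex b)) =
     real_to_complex a - ext_scale \<i> (real_to_complex b)"
  by (simp add: Q_linear_add[OF ext_real_complex_linear(4)] ext_cnj_scale ext_cnj_real)

lemma ext_scale_rectangular:
  "ext_scale c (real_to_complex a + ext_scale \<i> (real_to_complex b)) =
     real_to_complex (ext_scale (Re c) a - ext_scale (Im c) b) +
     ext_scale \<i> (real_to_complex (ext_scale (Im c) a + ext_scale (Re c) b))"
proof -
  have "ext_scale c (real_to_complex a + ext_scale \<i> (real_to_complex b)) =
      ext_scale (of_real (Re c) + \<i> * of_real (Im c)) (real_to_complex a) +
      ext_scale (\<i> * of_real (Re c) - of_real (Im c)) (real_to_complex b)"
  proof -
    have "c = of_real (Re c) + \<i> * of_real (Im c)" "c * \<i> = \<i> * of_real (Re c) - of_real (Im c)"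
      by (simp_all add: complex_eq_iff)
    then show ?thesis by (simp only: ext_scale_add ext.scale_scale)
  qed
  then show ?thesis
    by (simp add: Q_linear_diff[OF ext_real_complex_linear(1)] real_to_complex_add
        real_to_complex_scale ext_scale_add ext.scale_left_distrib ext.scale_left_diff_distrib)
qed

lemma rectangular_inject:
  fixes a b :: "'a::rat_vector real_ext"
  shows "real_to_complex a + ext_scale \<i> (real_to_complex b) =
     real_to_complex a' + ext_scale \<i> (real_to_complex b') \<longleftrightarrow> a = a' \<and> b = b'"
proof -
  have 1: "ext_Re (real_to_complex x + ext_scale \<i> (real_to_complex y)) = x" for x y :: "'a real_ext"
    using ext_Re_scale[of 1 x] by (simp add: Q_linear_add[OF ext_real_complex_linear(2)] ext_Re_scale)
  have 2: "ext_Im (real_to_complex x + ext_scale \<i> (real_to_complex y)) = y" for x y :: "'a real_ext"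
    using ext_Im_scale[of 1 x] by (simp add: Q_linear_add[OF ext_real_complex_linear(3)] ext_Im_scale)
  show ?thesis using 1 2 by metis
qed

section \<open>Frames of the negative plane\<close>

locale K3_type =
  fixes H :: "int \<Rightarrow> int \<Rightarrow> 'v::quadratic_space complex_ext set"
  assumes polarized: "polarized_K3_type H"
begin

lemma finite_dimensional: "finite_dimensional TYPE('v)"
  using polarized by (simp add: polarized_K3_type_def hodge_structure_def finite_dimensional_def)

text \<open>A vector in the radical of q stays in the radical after extension to the reals. The
  signature provides an orthogonal real basis with non-zero norms, and pairing with its members
  kills all coordinates.\<close>

lemma nondegenerate: "nondegenerate TYPE('v)"
  unfolding nondegenerate_def
proof (intro allI impI)
  fix v :: 'v assume v: "\<forall>w. qform v w = 0"
  define x where "x = pure_tensor v (1 :: real)"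
  have x0: "ext_form qform x y = 0" for y
    by (induction y rule: tensor_induct)
       (simp_all add: x_def ext_form_pure[OF Q_bilinear_qform] v ext_qform_props)
  obtain P N :: "'v real_ext set" where PN: "finite P" "finite N" "ext.span (P \<union> N) = UNIV"
    "\<forall>x \<in> P \<union> N. \<forall>y \<in> P \<union> N. x \<noteq> y \<longrightarrow> ext_form qform x y = 0"
    "\<forall>x \<in> P. ext_form qform x x > 0" "\<forall>x \<in> N. ext_form qform x x < 0"
    using polarized unfolding polarized_K3_type_def has_signature_def by blast
  have "x \<in> ext.span (P \<union> N)" using PN(3) by simp
  then obtain u where u: "x = (\<Sum>p\<in>P \<union> N. ext_scale (u p) p)"
    using ext.span_finite[of "P \<union> N"] PN(1,2) by auto
  have "u p = 0" if p: "p \<in> P \<union> N" for p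
  proof -
    have lin: "Q_linear (\<lambda>x. ext_form qform x p)"
      using Q_bilinear_ext_form[OF Q_bilinear_qform] by (auto simp: Q_bilinear_def)
    have "0 = (\<Sum>s\<in>P \<union> N. u s * ext_form qform s p)"
      using x0[of p] unfolding u by (simp add: Q_linear_sum[OF lin] ext_qform_scale)
    also have "\<dots> = (\<Sum>s\<in>P \<union> N. if s = p then u p * ext_form qform p p else 0)"
      using PN(4) p by (intro sum.cong) auto
    also have "\<dots> = u p * ext_form qform p p" using p PN(1,2) by simp
    finally show ?thesis using PN(5,6) p by force
  qed
  then have "x = 0" unfolding u by simp
  then show "v = 0" using pure_tensor_one_eq_0 unfolding x_def by blast
qed

lemma subspace_20: "ext.subspace (H 2 0)"
  using polarized by (simp add: polarized_K3_type_def hodge_structure_def)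

lemma line_20: "\<exists>\<sigma>. \<sigma> \<noteq> 0 \<and> \<sigma> \<in> H 2 0"
  and line_20_eq: "\<sigma> \<in> H 2 0 \<Longrightarrow> \<sigma> \<noteq> 0 \<Longrightarrow> s \<in> H 2 0 \<Longrightarrow> \<exists>c. s = ext_scale c \<sigma>"
proof -
  have dim: "ext.dim (H 2 0) = 1" using polarized by (simp add: polarized_K3_type_def)
  obtain B where B: "B \<subseteq> H 2 0" "ext.independent B" "H 2 0 \<subseteq> ext.span B" "card B = 1"
    using ext.basis_exists[of "H 2 0"] dim by metis
  then obtain \<tau> where \<tau>: "B = {\<tau>}" by (auto simp: card_1_singleton_iff)
  then have "\<tau> \<noteq> 0" using B(2) ext.dependent_zero by blast
  then show "\<exists>\<sigma>. \<sigma> \<noteq> 0 \<and> \<sigma> \<in> H 2 0" using B \<tau> by blast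
  assume "\<sigma> \<in> H 2 0" "\<sigma> \<noteq> 0" "s \<in> H 2 0"
  then obtain c d where c: "\<sigma> = ext_scale c \<tau>" and d: "s = ext_scale d \<tau>"
    using B(3) \<tau> by (force simp: ext.span_singleton)
  have "c \<noteq> 0" using c \<open>\<sigma> \<noteq> 0\<close> by auto
  then have "s = ext_scale (d / c) \<sigma>" by (simp add: c d)
  then show "\<exists>c. s = ext_scale c \<sigma>" by blast
qed

lemma H_02: "H 0 2 = ext_cnj ` H 2 0"
  using polarized by (simp add: polarized_K3_type_def hodge_structure_def)

text \<open>The product of two classes of type (2,0) has type (4,0), while \<rat>(-2) is
  concentrated in type (2,2).\<close>

lemma form_20:
  assumes "\<sigma> \<in> H 2 0"
  shows "ext_form qform \<sigma> \<sigma> = 0"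
proof -
  have "ext_form qform \<sigma> \<sigma> \<in> tate (- 2) (2 + 2) (0 + 0)"
    using polarized assms unfolding polarized_K3_type_def hodge_pairing_def by blast
  then show ?thesis by (simp add: tate_def)
qed

lemma hodge_plane_negative: "x \<in> hodge_plane H \<Longrightarrow> x \<noteq> 0 \<Longrightarrow> ext_form qform x x < 0"
  using polarized by (simp add: polarized_K3_type_def)

lemma hodge_plane_eq:
  assumes \<sigma>: "real_to_complex a + ext_scale \<i> (real_to_complex b) \<in> H 2 0"
    and nz: "real_to_complex a + ext_scale \<i> (real_to_complex b) \<noteq> 0" (is "?\<sigma> \<noteq> 0")
  shows "ext.span {a, b} = hodge_plane H"
proof (intro equalityI subsetI)
  fix x assume "x \<in> ext.span {a, b}"
  then obtain c d where x: "x = ext_scale c a + ext_scale d b"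
    by (auto simp: ext.span_breakdown_eq diff_eq_eq add.commute)
  \<comment> \<open>Chosen so that z \<sigma> plus its conjugate, twice the real part of z \<sigma>,
    is c a + d b.\<close>
  define z where "z = Complex (c / 2) (- d / 2)"
  have "ext_scale z ?\<sigma> \<in> H 2 0" using \<sigma> subspace_20 by (rule ext.subspace_scale[rotated])
  moreover have "ext_cnj (ext_scale z ?\<sigma>) \<in> H 0 2" using calculation H_02 by blast
  moreover have "real_to_complex x = ext_scale z ?\<sigma> + ext_cnj (ext_scale z ?\<sigma>)"
  proof -
    have "ext_scale z ?\<sigma> + ext_cnj (ext_scale z ?\<sigma>) =
        real_to_complex (ext_scale (Re z) a - ext_scale (Im z) b) +
        real_to_complex (ext_scale (Re z) a - ext_scale (Im z) b)"
      unfolding ext_scale_rectangular ext_cnj_rectangular by simp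
    also have "\<dots> = real_to_complex (ext_scale (Re z + Re z) a - ext_scale (Im z + Im z) b)"
      unfolding ext.scale_left_distrib real_to_complex_add[symmetric]
      by (rule arg_cong[of _ _ real_to_complex]) (simp add: algebra_simps)
    also have "ext_scale (Re z + Re z) a - ext_scale (Im z + Im z) b = x"
      by (simp add: z_def x)
    finally show ?thesis by simp
  qed
  ultimately show "x \<in> hodge_plane H" unfolding hodge_plane_def by blast
next
  fix x assume "x \<in> hodge_plane H"
  then obtain s t where st: "s \<in> H 2 0" "t \<in> H 0 2" "real_to_complex x = s + t"
    unfolding hodge_plane_def by blast
  obtain t' where t': "t' \<in> H 2 0" "t = ext_cnj t'" using st(2) H_02 by blast
  obtain c d where c: "s = ext_scale c ?\<sigma>" and d: "t' = ext_scale d ?\<sigma>"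
    using line_20_eq[OF \<sigma> nz] st(1) t'(1) by meson
  \<comment> \<open>The zero imaginary part is written out so that real parts can be compared on
    both sides.\<close>
  have "real_to_complex x + ext_scale \<i> (real_to_complex 0) =
    real_to_complex ((ext_scale (Re c) a - ext_scale (Im c) b) + (ext_scale (Re d) a - ext_scale (Im d) b)) +
    ext_scale \<i> (real_to_complex ((ext_scale (Im c) a + ext_scale (Re c) b) - (ext_scale (Im d) a + ext_scale (Re d) b)))"
    unfolding st(3) t'(2) c d ext_scale_rectangular ext_cnj_rectangular
    by (simp add: Q_linear_diff[OF ext_real_complex_linear(1)] Q_linear_zero[OF ext_real_complex_linear(1)]
        real_to_complex_add ext_scale_add ext.scale_right_diff_distrib)
  then have "x = (ext_scale (Re c) a - ext_scale (Im c) b) + (ext_scale (Re d) a - ext_scale (Im d) b)"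
    unfolding rectangular_inject by blast
  then show "x \<in> ext.span {a, b}"
    by (auto intro!: ext.span_add ext.span_diff ext.span_scale intro: ext.span_base)
qed

lemma hodge_frameI:
  assumes "real_to_complex a + ext_scale \<i> (real_to_complex b) \<in> H 2 0"
    and "ext_form qform a b = 0" "ext_form qform a a = - 1" "ext_form qform b b = - 1"
  shows "hodge_frame H a b"
proof -
  have "real_to_complex a + ext_scale \<i> (real_to_complex b) \<noteq> 0"
  proof
    assume "real_to_complex a + ext_scale \<i> (real_to_complex b) = 0"
    then have "a = 0"
      using rectangular_inject[of a b 0 0] by (simp add: Q_linear_zero[OF ext_real_complex_linear(1)])
    then show False using assms(3) ext_qform_props(7)[of "0 :: 'v real_ext"] by simp
  qed
  from hodge_plane_eq[OF assms(1) this] show ?thesis using assms by (simp add: hodge_frame_def)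
qed

text \<open>For a period \<sigma> = a + \<i> b the equation q(\<sigma>, \<sigma>) = 0 says that a
  and b are orthogonal of equal norm. That norm is negative, so one real rescaling, which keeps
  \<sigma> in \<open>H 2 0\<close>, normalizes both.\<close>

lemma ex_hodge_frame: "\<exists>e1 e2. hodge_frame H e1 e2"
proof -
  obtain \<sigma> where \<sigma>: "\<sigma> \<noteq> 0" "\<sigma> \<in> H 2 0" using line_20 by blast
  define a where "a = ext_Re \<sigma>"
  define b where "b = ext_Im \<sigma>"
  have ab: "\<sigma> = real_to_complex a + ext_scale \<i> (real_to_complex b)"
    unfolding a_def b_def by (rule complex_ext_decompose)
  have "ext_form qform \<sigma> \<sigma> =
      Complex (ext_form qform a a - ext_form qform b b) (2 * ext_form qform a b)"
    unfolding ab
    by (simp add: ext_qform_props ext_qform_scale ext_form_real_to_complex[OF Q_bilinear_qform]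
        ext_qform_sym[of b a] complex_eq_iff)
  then have q: "ext_form qform a a = ext_form qform b b" "ext_form qform a b = 0"
    using form_20[OF \<sigma>(2)] by (simp_all add: complex_eq_iff)
  have span: "ext.span {a, b} = hodge_plane H" using hodge_plane_eq \<sigma> unfolding ab by blast
  then have plane: "a \<in> hodge_plane H" "b \<in> hodge_plane H"
    by (metis ext.span_base insertI1, metis ext.span_base insertI1 insertI2)
  have "a \<noteq> 0"
  proof
    assume a: "a = 0"
    then have "ext_form qform b b = 0" using q(1) ext_qform_props(7)[of "0 :: 'v real_ext"] by simp
    then have "b = 0" using hodge_plane_negative[OF plane(2)] by fastforce
    then show False using \<sigma>(1) ab a by (simp add: Q_linear_zero[OF ext_real_complex_linear(1)])
  qed
  then have neg: "ext_form qform a a < 0" using hodge_plane_negative[OF plane(1)] by blast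
  define s where "s = inverse (sqrt (- ext_form qform a a))"
  have s: "s * s * ext_form qform a a = - 1"
    using neg by (simp add: s_def field_simps flip: real_sqrt_mult)
  have "hodge_frame H (ext_scale s a) (ext_scale s b)"
  proof (rule hodge_frameI)
    have "ext_scale (complex_of_real s) \<sigma> \<in> H 2 0"
      using \<sigma>(2) subspace_20 by (rule ext.subspace_scale[rotated])
    then show "real_to_complex (ext_scale s a) + ext_scale \<i> (real_to_complex (ext_scale s b)) \<in> H 2 0"
      unfolding ab ext_scale_rectangular by simp
  qed (use s q in \<open>simp_all add: ext_qform_scale mult.assoc\<close>)
  then show ?thesis by blast
qed

text \<open>Two frames differ by a complex scalar c, since \<open>H 2 0\<close> is a line, and the
  norms force |c| = 1. The product of an orthonormal pair is invariant under rotation because the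
  squares of a and b agree and b a = - a b.\<close>

lemma hodge_frame_product_unique:
  assumes "hodge_frame H a b" "hodge_frame H a' b'"
  shows "ext_bilin vec_mult a' b' = ext_bilin vec_mult a b"
proof -
  let ?\<sigma> = "real_to_complex a + ext_scale \<i> (real_to_complex b)"
  note q = assms(1)[unfolded hodge_frame_def] and q' = assms(2)[unfolded hodge_frame_def]
  have "?\<sigma> \<noteq> 0"
  proof
    assume "?\<sigma> = 0"
    then have "a = 0"
      using rectangular_inject[of a b 0 0] by (simp add: Q_linear_zero[OF ext_real_complex_linear(1)])
    then show False using q ext_qform_props(7)[of "0 :: 'v real_ext"] by simp
  qed
  then obtain c where "real_to_complex a' + ext_scale \<i> (real_to_complex b') = ext_scale c ?\<sigma>"
    using line_20_eq q q' by blast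
  then have eq: "a' = ext_scale (Re c) a - ext_scale (Im c) b" "b' = ext_scale (Im c) a + ext_scale (Re c) b"
    unfolding ext_scale_rectangular rectangular_inject by blast+
  have norm: "Re c * Re c + Im c * Im c = 1"
  proof -
    have "ext_form qform a' a' = - (Re c * Re c + Im c * Im c)"
      using q unfolding eq by (simp add: ext_qform_props ext_qform_scale ext_qform_sym[of b a])
    then show ?thesis using q' by simp
  qed
  have ba: "ext_bilin vec_mult b a = - ext_bilin vec_mult a b"
    using ext_vec_mult_anticommute[of b a] q by (simp add: ext_qform_sym[of b a] eq_neg_iff_add_eq_0)
  have "ext_bilin vec_mult x x = ext_scale (ext_form qform x x) (pure_tensor 1 1)"
    for x :: "'v real_ext"
  proof -
    have "ext_scale 2 (ext_bilin vec_mult x x) =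
        ext_scale 2 (ext_scale (ext_form qform x x) (pure_tensor 1 1))"
      using ext_vec_mult_anticommute[of x x] ext.scale_left_distrib[of 1 1 "ext_bilin vec_mult x x"]
      by simp
    then show ?thesis by (simp only: ext.scale_cancel_left) simp
  qed
  then have sq: "ext_bilin vec_mult a a = ext_bilin vec_mult b b" using q by simp
  have "ext_bilin vec_mult a' b' = ext_scale (Re c * Re c + Im c * Im c) (ext_bilin vec_mult a b)"
    unfolding eq
    by (simp add: ext_vec_mult_props ext_bilin_scale[OF Q_bilinear_vec_mult] ba sq
        ext.scale_left_distrib ext.scale_right_diff_distrib ext_scale_add algebra_simps)
  then show ?thesis by (simp add: norm)
qed

lemma KS_J_eq: "hodge_frame H a b \<Longrightarrow> KS_J H = ext_bilin vec_mult a b"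
  unfolding KS_J_def using hodge_frame_product_unique by (intro the_equality) blast+

end

section \<open>Hodge similarities and the complex structure\<close>

locale hodge_sim = quadratic_similarity \<psi> \<mu> + V: K3_type HV + W: K3_type HW
  for \<psi> :: "'v::quadratic_space \<Rightarrow> 'w::quadratic_space" and \<mu> HV HW +
  assumes image_20: "\<And>x. x \<in> HV 2 0 \<Longrightarrow> ext_map \<psi> x \<in> HW 2 0"
begin

lemma image_frame:
  assumes "hodge_frame HV a b"
  shows "real_to_complex (ext_map \<psi> a) + ext_scale \<i> (real_to_complex (ext_map \<psi> b)) \<in> HW 2 0"
proof -
  have "ext_map \<psi> (real_to_complex a + ext_scale \<i> (real_to_complex b)) \<in> HW 2 0"
    using assms image_20 by (auto simp: hodge_frame_def)
  then show ?thesis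
    by (simp add: Q_linear_add[OF Q_linear_ext_map[OF linear]] ext_map_scale[OF linear]
        ext_map_real_to_complex[OF linear])
qed

lemma ext_form_image:
  "ext_form qform (ext_map \<psi> x) (ext_map \<psi> y) = of_rat \<mu> * (ext_form qform x y :: real)"
  by (simp add: ext_form_map[OF Q_bilinear_qform Q_bilinear_qform linear linear qform_image]
      scaleQ_real_def)

text \<open>The image of the first frame vector is non-zero, lies in the negative definite plane of
  the target, and has norm -\<mu>.\<close>

lemma multiplier_pos: "\<mu> > 0"
proof -
  obtain a b where ab: "hodge_frame HV a b" using V.ex_hodge_frame by blast
  have q: "ext_form qform (ext_map \<psi> a) (ext_map \<psi> a) = - of_rat \<mu>"
    using ab by (simp add: ext_form_image hodge_frame_def)
  then have nz: "ext_map \<psi> a \<noteq> 0"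
    using multiplier_neq_0 ext_qform_props(7)[of "0 :: 'w real_ext"] by auto
  have "real_to_complex (ext_map \<psi> a) + ext_scale \<i> (real_to_complex (ext_map \<psi> b)) \<noteq> 0"
    using nz rectangular_inject[of "ext_map \<psi> a" "ext_map \<psi> b" 0 0]
    by (auto simp: Q_linear_zero[OF ext_real_complex_linear(1)])
  from W.hodge_plane_eq[OF image_frame[OF ab] this] have "ext_map \<psi> a \<in> hodge_plane HW"
    by (metis ext.span_base insertI1)
  from W.hodge_plane_negative[OF this nz] show ?thesis by (simp add: q)
qed

text \<open>The scalar s may be irrational, but the product of the two frame vectors contains only
  its square 1/\<mu>, which is the factor that \<open>\<Phi>\<close> attaches to a product of two
  vectors.\<close>

lemma KS_J_image: "KS_J HW = ext_map \<Phi> (KS_J HV)"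
proof -
  obtain a b where ab: "hodge_frame HV a b" using V.ex_hodge_frame by blast
  define s where "s = inverse (sqrt (of_rat \<mu>))"
  have s: "s * s * of_rat \<mu> = 1" using multiplier_pos by (simp add: s_def field_simps)
  have frame: "hodge_frame HW (ext_scale s (ext_map \<psi> a)) (ext_scale s (ext_map \<psi> b))"
  proof (rule W.hodge_frameI)
    have "ext_scale (complex_of_real s)
        (real_to_complex (ext_map \<psi> a) + ext_scale \<i> (real_to_complex (ext_map \<psi> b))) \<in> HW 2 0"
      using image_frame[OF ab] W.subspace_20 by (rule ext.subspace_scale[rotated])
    then show "real_to_complex (ext_scale s (ext_map \<psi> a)) +
        ext_scale \<i> (real_to_complex (ext_scale s (ext_map \<psi> b))) \<in> HW 2 0"
      unfolding ext_scale_rectangular by simp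
  qed (use s ab in \<open>simp_all add: ext_qform_scale ext_form_image hodge_frame_def flip: mult.assoc\<close>)
  have bil: "Q_bilinear (\<lambda>a b :: 'w. inverse \<mu> *\<^sub>Q vec_mult a b)"
    using Q_bilinear_vec_mult[where 'a = 'w] by (simp add: Q_bilinear_def Q_linear_iff scaleQ_add_right mult.commute)
  have scale: "ext_bilin (\<lambda>a b. inverse \<mu> *\<^sub>Q vec_mult a b) x y = ext_scale (s * s) (ext_bilin vec_mult x y)"
    for x y :: "'w real_ext"
  proof (rule tensor_bilinear_eqI[OF Q_bilinear_ext_bilin[OF bil]])
    show "Q_bilinear (\<lambda>x y :: 'w real_ext. ext_scale (s * s) (ext_bilin vec_mult x y))"
      by (simp add: Q_bilinear_def Q_linear_iff ext_vec_mult_props ext_scale_add Q_linear_scaleQ[OF Q_linear_ext_scale])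
    have ss: "s * s = of_rat (inverse \<mu>)" using s by (metis of_rat_inverse inverse_unique mult.commute)
    show "ext_bilin (\<lambda>a b. inverse \<mu> *\<^sub>Q vec_mult a b) (pure_tensor a r) (pure_tensor b t) =
        ext_scale (s * s) (ext_bilin vec_mult (pure_tensor a r) (pure_tensor b t))"
      for a b :: 'w and r t :: real
      by (simp add: ext_bilin_pure[OF bil] ext_bilin_pure[OF Q_bilinear_vec_mult] ext_scale_pure ss
          pure_tensor_scaleQ_left scaleQ_real_def flip: pure_tensor_scaleQ_right)
  qed
  have "KS_J HW = ext_scale (s * s) (ext_bilin vec_mult (ext_map \<psi> a) (ext_map \<psi> b))"
    unfolding W.KS_J_eq[OF frame] by (simp add: ext_bilin_scale[OF Q_bilinear_vec_mult])
  also have "\<dots> = ext_bilin (\<lambda>a b. inverse \<mu> *\<^sub>Q vec_mult a b) (ext_map \<psi> a) (ext_map \<psi> b)"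
    by (rule scale[symmetric])
  also have "\<dots> = ext_map \<Phi> (ext_bilin vec_mult a b)"
    by (rule ext_map_bilin[OF Q_bilinear_vec_mult bil linear linear linear_\<Phi> \<Phi>_vec_mult, symmetric])
  finally show ?thesis unfolding V.KS_J_eq[OF ab] .
qed

lemma KS_complex_structure_image:
  "ext_map \<Phi> (KS_complex_structure HV x) = KS_complex_structure HW (ext_map \<Phi> x)"
  unfolding KS_complex_structure_def KS_J_image
  by (rule ext_map_bilin[OF Q_bilinear_mult Q_bilinear_mult linear_\<Phi> linear_\<Phi> linear_\<Phi> \<Phi>_mult])

end

section \<open>Lattices and complex tori\<close>

lemma rat_lattice_basis:
  assumes "rat_lattice L"
  obtains B where "finite B" "rat_vector.independent B" "rat_vector.span B = UNIV"
    "L = {\<Sum>b\<in>B. of_int (n b) *\<^sub>Q b | n. True}"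
  using assms unfolding rat_lattice_def by blast

lemma rat_lattice_closed:
  assumes "rat_lattice L"
  shows rat_lattice_zero: "0 \<in> L"
    and rat_lattice_add: "x \<in> L \<Longrightarrow> y \<in> L \<Longrightarrow> x + y \<in> L"
    and rat_lattice_int: "x \<in> L \<Longrightarrow> of_int k *\<^sub>Q x \<in> L"
proof -
  from assms obtain B where L: "L = {\<Sum>b\<in>B. of_int (n b) *\<^sub>Q b | n. True}"
    by (rule rat_lattice_basis)
  show "0 \<in> L" unfolding L by (intro CollectI exI[of _ "\<lambda>_. 0"]) simp
  {
    assume "x \<in> L" "y \<in> L"
    then obtain n m where nm: "x = (\<Sum>b\<in>B. of_int (n b) *\<^sub>Q b)" "y = (\<Sum>b\<in>B. of_int (m b) *\<^sub>Q b)"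
      unfolding L by blast
    then have "x + y = (\<Sum>b\<in>B. of_int (n b + m b) *\<^sub>Q b)"
      by (simp add: scaleQ_add_left sum.distrib)
    then show "x + y \<in> L" unfolding L by (intro CollectI exI[of _ "\<lambda>b. n b + m b"]) simp
  }
  {
    assume "x \<in> L"
    then obtain n where "x = (\<Sum>b\<in>B. of_int (n b) *\<^sub>Q b)" unfolding L by blast
    then have "of_int k *\<^sub>Q x = (\<Sum>b\<in>B. of_int (k * n b) *\<^sub>Q b)"
      by (simp add: rat_vector.scale_sum_right)
    then show "of_int k *\<^sub>Q x \<in> L" unfolding L by (intro CollectI exI[of _ "\<lambda>b. k * n b"]) simp
  }
qed

lemma rat_lattice_nat: "rat_lattice L \<Longrightarrow> x \<in> L \<Longrightarrow> of_nat k *\<^sub>Q x \<in> L"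
  using rat_lattice_int[of L x "int k"] by simp

lemma rat_lattice_diff: "rat_lattice L \<Longrightarrow> x \<in> L \<Longrightarrow> y \<in> L \<Longrightarrow> x - y \<in> L"
  using rat_lattice_int[of L y "- 1"] rat_lattice_add[of L x "- y"] by simp

lemma rat_lattice_sum:
  "rat_lattice L \<Longrightarrow> (\<And>i. i \<in> S \<Longrightarrow> h i \<in> L) \<Longrightarrow> sum h S \<in> L"
  by (induction S rule: infinite_finite_induct) (auto simp: rat_lattice_zero rat_lattice_add)

lemma rat_lattice_denominator:
  assumes "rat_lattice L"
  shows "\<exists>N :: nat. N > 0 \<and> of_nat N *\<^sub>Q x \<in> L"
proof -
  obtain B where B: "finite B" "rat_vector.span B = UNIV" "L = {\<Sum>b\<in>B. of_int (n b) *\<^sub>Q b | n. True}"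
    using assms by (rule rat_lattice_basis)
  have base: "b \<in> L" if "b \<in> B" for b
  proof -
    have "b = (\<Sum>c\<in>B. if c = b then c else 0)" using that B(1) by simp
    also have "\<dots> = (\<Sum>c\<in>B. of_int (if c = b then 1 else 0) *\<^sub>Q c)"
      by (intro sum.cong) auto
    finally show ?thesis
      unfolding B(3) by (intro CollectI exI[of _ "\<lambda>c. if c = b then 1 else 0"]) simp
  qed
  have "x \<in> rat_vector.span B" using B(2) by simp
  then show ?thesis
  proof (induction rule: rat_vector.span_induct_alt)
    case base
    show ?case using rat_lattice_zero[OF assms] by (intro exI[of _ 1]) simp
  next
    case (step c b y)
    then obtain N :: nat where N: "N > 0" "of_nat N *\<^sub>Q y \<in> L" by blast
    obtain p q where "c = Fract p q" and q: "q > 0" by (cases c)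
    then have pq: "q > 0" "c = of_int p / of_int q" by (simp_all add: Fract_of_int_quotient)
    \<comment> \<open>N clears the denominators of y and q that of the coefficient c, so the product
      clears both.\<close>
    have "of_nat (N * nat q) *\<^sub>Q (c *\<^sub>Q b + y) =
        of_int (int N * p) *\<^sub>Q b + of_int q *\<^sub>Q (of_nat N *\<^sub>Q y)"
      using pq by (simp add: scaleQ_add_right mult.commute)
    also have "\<dots> \<in> L"
      by (intro rat_lattice_add[OF assms] rat_lattice_int[OF assms] base step(1) N(2))
    finally show ?case using N(1) pq(1) by (intro exI[of _ "N * nat q"]) simp
  qed
qed

text \<open>A lattice has a finite integral basis, and the product of denominators of the images of
  its members serves for all of them.\<close>

lemma rat_lattice_map_denominator:
  assumes "rat_lattice L" "rat_lattice L'" "Q_linear g"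
  shows "\<exists>N :: nat. N > 0 \<and> (\<forall>x\<in>L. of_nat N *\<^sub>Q g x \<in> L')"
proof -
  obtain B where B: "finite B" "L = {\<Sum>b\<in>B. of_int (n b) *\<^sub>Q b | n. True}"
    using assms(1) by (rule rat_lattice_basis)
  have "\<exists>N :: nat. N > 0 \<and> (\<forall>b\<in>B. of_nat N *\<^sub>Q g b \<in> L')"
    using B(1)
  proof induction
    case empty
    show ?case by (intro exI[of _ 1]) simp
  next
    case (insert b B)
    then obtain N :: nat where N: "N > 0" "\<forall>b\<in>B. of_nat N *\<^sub>Q g b \<in> L'" by blast
    obtain M :: nat where M: "M > 0" "of_nat M *\<^sub>Q g b \<in> L'"
      using rat_lattice_denominator[OF assms(2)] by blast
    have "of_nat (N * M) *\<^sub>Q g b \<in> L'"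
      using rat_lattice_nat[OF assms(2) M(2), of N] by simp
    moreover have "of_nat (N * M) *\<^sub>Q g c \<in> L'" if "c \<in> B" for c
      using rat_lattice_nat[OF assms(2), of "of_nat N *\<^sub>Q g c" M] N(2) that by (simp add: mult.commute)
    ultimately show ?case using N(1) M(1) by (intro exI[of _ "N * M"]) auto
  qed
  then obtain N :: nat where N: "N > 0" "\<forall>b\<in>B. of_nat N *\<^sub>Q g b \<in> L'" by blast
  have "of_nat N *\<^sub>Q g x \<in> L'" if "x \<in> L" for x
  proof -
    obtain n where "x = (\<Sum>b\<in>B. of_int (n b) *\<^sub>Q b)" using \<open>x \<in> L\<close> unfolding B(2) by blast
    then have "of_nat N *\<^sub>Q g x = (\<Sum>b\<in>B. of_int (n b) *\<^sub>Q (of_nat N *\<^sub>Q g b))"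
      by (simp add: Q_linear_sum[OF assms(3)] Q_linear_scaleQ[OF assms(3)]
          rat_vector.scale_sum_right mult.commute)
    also have "\<dots> \<in> L'" using N(2) by (intro rat_lattice_sum[OF assms(2)] rat_lattice_int[OF assms(2)]) blast
    finally show ?thesis .
  qed
  then show ?thesis using N(1) by blast
qed

lemma rat_lattice_divisible_eq_0:
  assumes "rat_lattice L" "y \<in> L" "\<And>k :: nat. k > 0 \<Longrightarrow> \<exists>z\<in>L. y = of_nat k *\<^sub>Q z"
  shows "y = 0"
proof -
  obtain B where B: "finite B" "rat_vector.independent B" "L = {\<Sum>b\<in>B. of_int (n b) *\<^sub>Q b | n. True}"
    using assms(1) by (rule rat_lattice_basis)
  obtain n where n: "y = (\<Sum>b\<in>B. of_int (n b) *\<^sub>Q b)" using assms(2) unfolding B(3) by blast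
  have "n b = 0" if b: "b \<in> B" for b
  proof -
    \<comment> \<open>A coordinate divisible by a number larger than its absolute value is zero; the
      added 1 also keeps k positive.\<close>
    define k where "k = nat \<bar>n b\<bar> + 1"
    obtain z where z: "z \<in> L" "y = of_nat k *\<^sub>Q z" using assms(3)[of k] by (auto simp: k_def)
    obtain m where m: "z = (\<Sum>b\<in>B. of_int (m b) *\<^sub>Q b)" using z(1) unfolding B(3) by blast
    have "(\<Sum>b\<in>B. (of_int (n b - int k * m b) :: rat) *\<^sub>Q b) = y - of_nat k *\<^sub>Q z"
      unfolding n m
      by (simp add: rat_vector.scale_left_diff_distrib sum_subtractf rat_vector.scale_sum_right)
    then have "(\<Sum>b\<in>B. (of_int (n b - int k * m b) :: rat) *\<^sub>Q b) = 0" using z(2) by simp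
    then have "(of_int (n b - int k * m b) :: rat) = 0"
      using rat_vector.independentD[OF B(2,1) subset_refl, of "\<lambda>b. of_int (n b - int k * m b)" b] b
      by blast
    then have "n b - int k * m b = 0" by (simp only: of_int_eq_0_iff)
    then have "n b = int k * m b" by simp
    then have "int k dvd n b" by simp
    then show ?thesis
      using zdvd_imp_le[of "int k" "\<bar>n b\<bar>"] by (cases "n b = 0") (auto simp: k_def)
  qed
  then show ?thesis unfolding n by simp
qed

lemma lattice_image_mem: "pure_tensor x 1 \<in> lattice_image L \<longleftrightarrow> x \<in> L"
  by (auto simp: lattice_image_def pure_tensor_one_inject)

lemma linear_pure_one: "Q_linear (\<lambda>x. pure_tensor x (1 :: real))"
  by (simp add: Q_linear_iff pure_tensor_add_left pure_tensor_scaleQ_left)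

lemma lattice_image_closed:
  assumes "rat_lattice L"
  shows "0 \<in> lattice_image L"
    and "x \<in> lattice_image L \<Longrightarrow> y \<in> lattice_image L \<Longrightarrow> x + y \<in> lattice_image L"
    and "x \<in> lattice_image L \<Longrightarrow> y \<in> lattice_image L \<Longrightarrow> x - y \<in> lattice_image L"
proof -
  have "pure_tensor 0 1 \<in> lattice_image L"
    unfolding lattice_image_mem by (rule rat_lattice_zero[OF assms])
  then show "0 \<in> lattice_image L" by (simp only: Q_linear_zero[OF linear_pure_one])
  assume "x \<in> lattice_image L" "y \<in> lattice_image L"
  then obtain a b where ab: "x = pure_tensor a 1" "a \<in> L" "y = pure_tensor b 1" "b \<in> L"
    by (auto simp: lattice_image_def)
  have "x + y = pure_tensor (a + b) 1" "x - y = pure_tensor (a - b) 1"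
    by (simp_all add: ab Q_linear_add[OF linear_pure_one] Q_linear_diff[OF linear_pure_one])
  then show "x + y \<in> lattice_image L" "x - y \<in> lattice_image L"
    using ab rat_lattice_add[OF assms] rat_lattice_diff[OF assms] by (simp_all add: lattice_image_mem)
qed

section \<open>Tori as quotient groups and the lifts of their maps\<close>

lemma torus_proj_eq: "torus_proj L x = (\<lambda>h. h + x) ` lattice_image L"
  by (auto simp: torus_proj_def r_coset_def additive_group_def)

lemma torus_proj_eq_iff:
  assumes "rat_lattice L"
  shows "torus_proj L x = torus_proj L y \<longleftrightarrow> x - y \<in> lattice_image L"
proof
  assume "torus_proj L x = torus_proj L y"
  moreover have "x \<in> torus_proj L x"
    using lattice_image_closed(1)[OF assms] by (force simp: torus_proj_eq)
  ultimately show "x - y \<in> lattice_image L" by (auto simp: torus_proj_eq)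
next
  assume d: "x - y \<in> lattice_image L"
  have "h + x \<in> torus_proj L y" "h + y \<in> torus_proj L x" if h: "h \<in> lattice_image L" for h
  proof -
    have "h + x = (h + (x - y)) + y" "h + y = (h - (x - y)) + x" by simp_all
    then show "h + x \<in> torus_proj L y" "h + y \<in> torus_proj L x"
      unfolding torus_proj_eq using lattice_image_closed(2,3)[OF assms h d] by blast+
  qed
  then show "torus_proj L x = torus_proj L y" by (auto simp: torus_proj_eq)
qed

lemma torus_structure:
  assumes "rat_lattice L"
  shows carrier_torus: "carrier (torus L) = range (torus_proj L)"
    and mult_torus: "torus_proj L x \<otimes>\<^bsub>torus L\<^esub> torus_proj L y = torus_proj L (x + y)"
    and one_torus: "\<one>\<^bsub>torus L\<^esub> = torus_proj L 0"
proof -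
  show "carrier (torus L) = range (torus_proj L)"
    by (auto simp: torus_def FactGroup_def RCOSETS_def torus_proj_def additive_group_def)
  show "\<one>\<^bsub>torus L\<^esub> = torus_proj L 0"
    by (simp add: torus_def FactGroup_def torus_proj_eq)
  have "torus_proj L x \<otimes>\<^bsub>torus L\<^esub> torus_proj L y =
      {(h + x) + (k + y) | h k. h \<in> lattice_image L \<and> k \<in> lattice_image L}"
    by (auto simp: torus_def FactGroup_def set_mult_def torus_proj_eq additive_group_def)
  also have "\<dots> = torus_proj L (x + y)"
  proof (intro equalityI subsetI)
    fix z assume "z \<in> {(h + x) + (k + y) | h k. h \<in> lattice_image L \<and> k \<in> lattice_image L}"
    then obtain h k where "z = (h + k) + (x + y)" "h \<in> lattice_image L" "k \<in> lattice_image L"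
      by (auto simp: algebra_simps)
    then show "z \<in> torus_proj L (x + y)"
      unfolding torus_proj_eq using lattice_image_closed(2)[OF assms] by blast
  next
    fix z assume "z \<in> torus_proj L (x + y)"
    then obtain h where "z = (h + x) + (0 + y)" "h \<in> lattice_image L"
      by (auto simp: torus_proj_eq algebra_simps)
    then show "z \<in> {(h + x) + (k + y) | h k. h \<in> lattice_image L \<and> k \<in> lattice_image L}"
      using lattice_image_closed(1)[OF assms] by blast
  qed
  finally show "torus_proj L x \<otimes>\<^bsub>torus L\<^esub> torus_proj L y = torus_proj L (x + y)" .
qed

text \<open>In an integral basis the M-torsion points have coordinates n/M, and reducing every n
  modulo M changes the point by a lattice vector. Finitely many residues remain.\<close>

lemma finite_torsion:
  assumes L: "rat_lattice L" and M: "M > (0 :: nat)"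
  shows "finite ((\<lambda>z. torus_proj L (pure_tensor z 1)) ` {z. of_nat M *\<^sub>Q z \<in> L})"
proof -
  obtain B where B: "finite B" "L = {\<Sum>b\<in>B. of_int (n b) *\<^sub>Q b | n. True}"
    using L by (rule rat_lattice_basis)
  define v where "v r = (\<Sum>b\<in>B. (of_int (r b) / of_nat M) *\<^sub>Q b)" for r :: "'a \<Rightarrow> int"
  have "(\<lambda>z. torus_proj L (pure_tensor z 1)) ` {z. of_nat M *\<^sub>Q z \<in> L} \<subseteq>
      (\<lambda>r. torus_proj L (pure_tensor (v r) 1)) ` (B \<rightarrow>\<^sub>E {0..<int M})"
  proof safe
    fix z assume "of_nat M *\<^sub>Q z \<in> L"
    then obtain n where n: "of_nat M *\<^sub>Q z = (\<Sum>b\<in>B. of_int (n b) *\<^sub>Q b)" unfolding B(2) by blast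
    \<comment> \<open>Restriction to B makes the residues a member of the finite extensional
      function space.\<close>
    define r where "r = restrict (\<lambda>b. n b mod int M) B"
    have r: "r \<in> B \<rightarrow>\<^sub>E {0..<int M}" using M by (auto simp: r_def)
    have "z = (1 / of_nat M) *\<^sub>Q (of_nat M *\<^sub>Q z)" using M by simp
    also have "\<dots> = (\<Sum>b\<in>B. (of_int (n b) / of_nat M) *\<^sub>Q b)"
      unfolding n by (simp add: rat_vector.scale_sum_right)
    finally have "z - v r = (\<Sum>b\<in>B. (of_int (n b) / of_nat M - of_int (r b) / of_nat M) *\<^sub>Q b)"
      by (simp add: v_def rat_vector.scale_left_diff_distrib sum_subtractf)
    also have "\<dots> = (\<Sum>b\<in>B. of_int (n b div int M) *\<^sub>Q b)"
    proof (intro sum.cong refl)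
      fix b assume "b \<in> B"
      have "n b = int M * (n b div int M) + r b" using \<open>b \<in> B\<close> by (simp add: r_def)
      then have "(of_int (n b) :: rat) = of_nat M * of_int (n b div int M) + of_int (r b)"
        by (metis of_int_add of_int_mult of_int_of_nat_eq)
      then show "(of_int (n b) / of_nat M - of_int (r b) / of_nat M) *\<^sub>Q b = of_int (n b div int M) *\<^sub>Q b"
        using M by (simp add: field_simps)
    qed
    finally have "z - v r \<in> L"
      unfolding B(2) by (intro CollectI exI[of _ "\<lambda>b. n b div int M"]) simp
    then have "pure_tensor z 1 - pure_tensor (v r) 1 \<in> lattice_image L"
      by (simp add: lattice_image_mem flip: Q_linear_diff[OF linear_pure_one])
    then have "torus_proj L (pure_tensor z 1) = torus_proj L (pure_tensor (v r) 1)"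
      by (simp add: torus_proj_eq_iff[OF L])
    then show "torus_proj L (pure_tensor z 1) \<in>
        (\<lambda>r. torus_proj L (pure_tensor (v r) 1)) ` (B \<rightarrow>\<^sub>E {0..<int M})"
      using r by blast
  qed
  then show ?thesis by (rule finite_subset) (intro finite_imageI finite_PiE B(1), simp)
qed

text \<open>The difference of two lifts is linear with values in the lattice. Its value at x is k
  times its value at x/k for every positive k, hence divisible by every k inside the lattice, hence
  zero. This replaces the usual continuity argument.\<close>

lemma torus_lift_unique:
  assumes L': "rat_lattice L'"
    and F: "torus_lift L J L' J' f F" and F': "torus_lift L J L' J' f F'"
  shows "F = F'"
proof
  fix x
  interpret F: Vector_Spaces.linear ext_scale ext_scale F using F by (simp add: torus_lift_def)
  interpret F': Vector_Spaces.linear ext_scale ext_scale F' using F' by (simp add: torus_lift_def)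
  have mem: "F x - F' x \<in> lattice_image L'" for x
    using F F' torus_proj_eq_iff[OF L'] unfolding torus_lift_def by metis
  obtain y where y: "y \<in> L'" "F x - F' x = pure_tensor y 1"
    using mem[of x] by (auto simp: lattice_image_def)
  have "\<exists>z\<in>L'. y = of_nat k *\<^sub>Q z" if "k > 0" for k :: nat
  proof -
    obtain z where z: "z \<in> L'" "F (ext_scale (1 / of_nat k) x) - F' (ext_scale (1 / of_nat k) x) = pure_tensor z 1"
      using mem by (auto simp: lattice_image_def)
    have "pure_tensor y (1 :: real) = ext_scale (of_nat k) (pure_tensor z 1)"
      unfolding z(2)[symmetric] y(2)[symmetric]
      using that by (simp add: F.scale F'.scale ext.scale_right_diff_distrib)
    also have "\<dots> = pure_tensor (of_nat k *\<^sub>Q z) 1"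
      by (simp add: ext_scale_pure pure_tensor_scaleQ_left scaleQ_real_def flip: pure_tensor_scaleQ_right)
    finally show ?thesis using z(1) by (auto simp: pure_tensor_one_inject)
  qed
  then have "y = 0" using rat_lattice_divisible_eq_0[OF L' y(1)] by blast
  then show "F x = F' x" using y(2) by (simp add: Q_linear_zero[OF linear_pure_one])
qed

lemma ext_map_linear: "Q_linear g \<Longrightarrow> Vector_Spaces.linear ext_scale ext_scale
    (ext_map g :: ('a::rat_vector, 'k::{rat_algebra,field}) tensor \<Rightarrow> ('b::rat_vector, 'k) tensor)"
  by (simp add: Vector_Spaces.linear_iff ext.vector_space_axioms
      Q_linear_add[OF Q_linear_ext_map] ext_map_scale)

text \<open>The dual of the inverse is the inverse of the dual. The last conclusion is the form in
  which the push-forward on first cohomology is used: it carries h to the functional with value h(y)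
  at g(y).\<close>

lemma bij_dual_map:
  assumes "Q_linear g" "bij g"
  shows "Q_linear (dual_map g)" "bij (dual_map g)"
    "Rep_rat_dual (inv_into UNIV (dual_map g) h) (g y) = Rep_rat_dual h y"
proof -
  have Rep: "Rep_rat_dual (dual_map k h) = (\<lambda>x. Rep_rat_dual h (k x))"
    if "Q_linear k" for k :: "'c::rat_vector \<Rightarrow> 'd::rat_vector" and h
    unfolding dual_map_def using Rep_rat_dual[of h] that
    by (intro Abs_rat_dual_inverse) (simp add: Q_linear_comp)
  show lin: "Q_linear (dual_map g)"
    unfolding Q_linear_iff Rep_rat_dual_inject[symmetric]
    by (simp add: Rep[OF assms(1)] plus_rat_dual.rep_eq scaleQ_rat_dual.rep_eq)
  have inv: "g (inv_into UNIV g y) = y" "inv_into UNIV g (g x) = x" for x y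
    using assms(2) by (simp_all add: bij_is_surj surj_f_inv_f bij_is_inj)
  note lin_inv = Q_linear_inv[OF assms]
  have "dual_map g (dual_map (inv_into UNIV g) h) = h" "dual_map (inv_into UNIV g) (dual_map g k) = k" for h k
    by (simp_all add: Rep_rat_dual_inject[symmetric] Rep[OF assms(1)] Rep[OF lin_inv] inv)
  then show bij: "bij (dual_map g)" by (metis bijI')
  have "dual_map g (inv_into UNIV (dual_map g) h) = h"
    using bij by (simp add: bij_is_surj surj_f_inv_f)
  then show "Rep_rat_dual (inv_into UNIV (dual_map g) h) (g y) = Rep_rat_dual h y"
    using Rep[OF assms(1), of "inv_into UNIV (dual_map g) h"] by metis
qed

section \<open>The isogeny induced by a rational isomorphism\<close>

lemma isogeny_of_linear:
  fixes G :: "'a::rat_vector \<Rightarrow> 'b::rat_vector"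
  assumes L: "rat_lattice L" and L': "rat_lattice L'"
    and G: "Q_linear G" "bij G" "\<And>x. x \<in> L \<Longrightarrow> G x \<in> L'"
    and J: "\<And>x. ext_map G (J x) = J' (ext_map G x)"
  shows "\<exists>f. isogeny L J L' J' f \<and> H1_push L J L' J' f = inv_into UNIV (dual_map G)"
proof -
  define F :: "'a real_ext \<Rightarrow> 'b real_ext" where "F = ext_map G"
  \<comment> \<open>A coset is sent to the image of some representative; off the cosets the value is
    arbitrary, which neither homomorphism nor kernel can see.\<close>
  define f where "f C = torus_proj L' (F (SOME x. torus_proj L x = C))" for C
  have F_pure: "F (pure_tensor a r) = pure_tensor (G a) r" for a r
    unfolding F_def by (rule ext_map_pure[OF G(1)])
  have F_lin: "Q_linear F" unfolding F_def by (rule Q_linear_ext_map[OF G(1)])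
  have F_lattice: "F x \<in> lattice_image L'" if "x \<in> lattice_image L" for x
    using that G(3) by (auto simp: lattice_image_def F_pure)
  have inv: "G (inv_into UNIV G y) = y" "inv_into UNIV G (G x) = x" for x y
    using G(2) by (simp_all add: bij_is_surj surj_f_inv_f bij_is_inj)
  note inv_lin = Q_linear_inv[OF G(1,2)]
  define F' :: "'b real_ext \<Rightarrow> 'a real_ext" where "F' = ext_map (inv_into UNIV G)"
  have F'_pure: "F' (pure_tensor b r) = pure_tensor (inv_into UNIV G b) r" for b r
    unfolding F'_def by (rule ext_map_pure[OF inv_lin])
  have F'_lin: "Q_linear F'" unfolding F'_def by (rule Q_linear_ext_map[OF inv_lin])
  have FF': "F (F' y) = y" for y
    by (induction y rule: tensor_induct)
       (simp_all add: F_pure F'_pure inv Q_linear_add[OF F_lin] Q_linear_add[OF F'_lin])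
  have F'F: "F' (F x) = x" for x
    by (induction x rule: tensor_induct)
       (simp_all add: F_pure F'_pure inv Q_linear_add[OF F_lin] Q_linear_add[OF F'_lin])
  have f_proj: "f (torus_proj L x) = torus_proj L' (F x)" for x
  proof -
    define z where "z = (SOME z. torus_proj L z = torus_proj L x)"
    have "torus_proj L z = torus_proj L x"
      unfolding z_def by (rule someI[of _ x]) (rule refl)
    then have "F (z - x) \<in> lattice_image L'" using F_lattice by (simp add: torus_proj_eq_iff[OF L])
    then have "torus_proj L' (F z) = torus_proj L' (F x)"
      by (simp add: torus_proj_eq_iff[OF L'] Q_linear_diff[OF F_lin])
    then show ?thesis by (simp add: f_def z_def)
  qed
  have lift: "torus_lift L J L' J' f F"
    using ext_map_linear[OF G(1)] J f_proj by (simp add: torus_lift_def F_def)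
  have "isogeny L J L' J' f"
    unfolding isogeny_def
  proof (intro conjI)
    show "f \<in> hom (torus L) (torus L')"
      by (rule homI) (auto simp: carrier_torus L L' f_proj mult_torus Q_linear_add[OF F_lin])
    show "\<exists>F. torus_lift L J L' J' f F" using lift by blast
    show "f ` carrier (torus L) = carrier (torus L')"
    proof -
      have "f ` carrier (torus L) = range (\<lambda>x. torus_proj L' (F x))"
        by (simp add: carrier_torus L image_image f_proj)
      also have "\<dots> = range (torus_proj L')" using FF' by (metis (no_types, lifting) rangeI image_subset_iff subset_antisym)
      finally show ?thesis by (simp add: carrier_torus L')
    qed
    \<comment> \<open>M clears the denominators of the inverse on L'. A kernel element is
      represented by the preimage of a vector of L', so it is M-torsion.\<close>
    obtain M :: nat where M: "M > 0" "\<forall>y\<in>L'. of_nat M *\<^sub>Q inv_into UNIV G y \<in> L"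
      using rat_lattice_map_denominator[OF L' L inv_lin] by blast
    have "kernel (torus L) (torus L') f \<subseteq>
        (\<lambda>z. torus_proj L (pure_tensor z 1)) ` {z. of_nat M *\<^sub>Q z \<in> L}"
    proof
      fix C assume "C \<in> kernel (torus L) (torus L') f"
      then obtain x where x: "C = torus_proj L x" "torus_proj L' (F x) = torus_proj L' 0"
        by (auto simp: kernel_def carrier_torus L L' one_torus f_proj)
      then have "F x \<in> lattice_image L'" by (simp add: torus_proj_eq_iff[OF L'])
      then obtain y where y: "y \<in> L'" "F x = pure_tensor y 1" by (auto simp: lattice_image_def)
      then have "x = pure_tensor (inv_into UNIV G y) 1" using F'F[of x] by (simp add: F'_pure)
      then show "C \<in> (\<lambda>z. torus_proj L (pure_tensor z 1)) ` {z. of_nat M *\<^sub>Q z \<in> L}"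
        using x(1) M(2) y(1) by blast
    qed
    then show "finite (kernel (torus L) (torus L') f)"
      using finite_torsion[OF L M(1)] by (rule finite_subset)
  qed
  moreover have "H1_homology_map L J L' J' f = G"
  proof -
    have "(THE F. torus_lift L J L' J' f F) = F"
      using lift torus_lift_unique[OF L'] by (intro the_equality) blast+
    then show ?thesis
      unfolding H1_homology_map_def
      by (intro the_equality) (simp_all add: F_pure G(1) pure_tensor_one_inject fun_eq_iff)
  qed
  ultimately show ?thesis unfolding H1_push_def by metis
qed

text \<open>The Kuga--Satake variety is an isogeny class, so the lattices are arbitrary, as are the
  auxiliary elements of the source. Those of the target depend on them, on \<psi>, and through N on
  the lattices.\<close>

theorem proposition0p2:
  fixes HV :: "int \<Rightarrow> int \<Rightarrow> 'v::quadratic_space complex_ext set"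
    and HW :: "int \<Rightarrow> int \<Rightarrow> 'w::quadratic_space complex_ext set"
    and \<psi> :: "'v \<Rightarrow> 'w"
    and L :: "'v even_clifford set"
    and L' :: "'w even_clifford set"
    and v0 f1 f2 :: 'v
  assumes "polarized_K3_type HV"
    and "polarized_K3_type HW"
    and "hodge_similarity HV HW \<psi>"
    and "rat_lattice L"
    and "rat_lattice L'"
    and "KS_auxiliary v0 f1 f2"
  shows "inj (kuga_satake v0 f1 f2) \<and>
    (\<exists>v0' f1' f2' :: 'w. KS_auxiliary v0' f1' f2' \<and> inj (kuga_satake v0' f1' f2') \<and>
      (\<exists>\<psi>KS. isogeny L (KS_complex_structure HV) L' (KS_complex_structure HW) \<psi>KS \<and>
        (let push = H1_push L (KS_complex_structure HV) L' (KS_complex_structure HW) \<psi>KS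
         in \<forall>v. tensor_map push push (kuga_satake v0 f1 f2 v) = kuga_satake v0' f1' f2' (\<psi> v))))"
proof -
  obtain \<mu> where \<mu>: "\<mu> \<noteq> 0" "\<And>v w. qform (\<psi> v) (\<psi> w) = \<mu> * qform v w"
    using assms(3) unfolding hodge_similarity_def by blast
  have lin: "Q_linear \<psi>" "bij \<psi>" and img: "\<And>x. x \<in> HV 2 0 \<Longrightarrow> ext_map \<psi> x \<in> HW 2 0"
    using assms(3) unfolding hodge_similarity_def hodge_morphism_def ext_map_def by blast+
  interpret hodge_sim \<psi> \<mu> HV HW
    by (intro hodge_sim.intro hodge_sim_axioms.intro quadratic_similarity.intro K3_type.intro
        assms lin \<mu> img)
  obtain e n where frame: "orthogonal_frame (e :: nat \<Rightarrow> 'v) n"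
    using ex_orthogonal_frame[OF V.finite_dimensional V.nondegenerate] by blast
  obtain e' n' where frame': "orthogonal_frame (e' :: nat \<Rightarrow> 'w) n'"
    using ex_orthogonal_frame[OF W.finite_dimensional W.nondegenerate] by blast
  obtain N :: nat where N: "N > 0" "\<forall>x\<in>L. of_nat N *\<^sub>Q \<Phi> x \<in> L'"
    using rat_lattice_map_denominator[OF assms(4,5) linear_\<Phi>] by blast
  define r :: rat where "r = of_nat N"
  have r: "r \<noteq> 0" using N(1) by (simp add: r_def)
  have N_lattice: "\<forall>x\<in>L. r *\<^sub>Q \<Phi> x \<in> L'" using N(2) by (simp add: r_def)
  let ?v0 = "inverse (\<mu> * r\<^sup>2) *\<^sub>Q \<psi> v0" and ?f1 = "inverse \<mu> *\<^sub>Q \<psi> f1" and ?f2 = "\<psi> f2"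
  \<comment> \<open>The norms become q(f1)/\<mu> and \<mu> q(f2), which stay negative because \<mu>
    > 0.\<close>
  have aux: "KS_auxiliary ?v0 ?f1 ?f2"
    using assms(6) multiplier_pos r
    by (simp add: KS_auxiliary_def qform_scaleQ_left qform_scaleQ_right \<mu>(2) mult_pos_neg)
  interpret KS: kuga_satake_similarity \<psi> \<mu> e n v0 f1 f2 e' n' r
    by (intro kuga_satake_similarity.intro kuga_satake_similarity_axioms.intro
        kuga_satake_space.intro kuga_satake_space_axioms.intro frame frame' aux assms(6) r
        quadratic_similarity_axioms)
  have map_G: "ext_map KS.G x = r *\<^sub>Q ext_map \<Phi> x" for x :: "'v even_clifford real_ext"
  proof (induction x rule: tensor_induct)
    case (pure a c)
    have "ext_map KS.G (pure_tensor a c) = pure_tensor (KS.G a) c" by (rule ext_map_pure[OF KS.linear_G])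
    also have "\<dots> = r *\<^sub>Q ext_map \<Phi> (pure_tensor a c)"
      by (simp only: KS.G_def pure_tensor_scaleQ_left ext_map_pure[OF linear_\<Phi>])
    finally show ?case .
  next
    case (add s t)
    then show ?case
      by (simp only: Q_linear_add[OF Q_linear_ext_map[OF KS.linear_G]]
          Q_linear_add[OF Q_linear_ext_map[OF linear_\<Phi>]] scaleQ_add_right)
  qed
  \<comment> \<open>Multiplication by the rational r commutes with the complex structure, so the
    multiple inherits compatibility from \<open>\<Phi>\<close>.\<close>
  have J: "ext_map KS.G (KS_complex_structure HV x) = KS_complex_structure HW (ext_map KS.G x)" for x
    unfolding map_G KS_complex_structure_image
    by (simp add: KS_complex_structure_def Q_bilinear_props(4)[OF Q_bilinear_ext_bilin[OF Q_bilinear_mult]])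
  have GL: "KS.G x \<in> L'" if "x \<in> L" for x using that N_lattice by (simp add: KS.G_def)
  obtain f where f: "isogeny L (KS_complex_structure HV) L' (KS_complex_structure HW) f"
    "H1_push L (KS_complex_structure HV) L' (KS_complex_structure HW) f = inv_into UNIV (dual_map KS.G)"
    using isogeny_of_linear[where J = "KS_complex_structure HV" and J' = "KS_complex_structure HW",
        OF assms(4,5) KS.linear_G KS.bij_G GL J] by blast
  note dual = bij_dual_map[OF KS.linear_G KS.bij_G]
  have "tensor_map (inv_into UNIV (dual_map KS.G)) (inv_into UNIV (dual_map KS.G)) (kuga_satake v0 f1 f2 v) =
      kuga_satake ?v0 ?f1 ?f2 (\<psi> v)" for v
    by (rule KS.kuga_satake_commutes[OF Q_linear_inv[OF dual(1,2)] dual(3)])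
  then show ?thesis
    using KS.V.inj_kuga_satake KS.W.inj_kuga_satake aux f unfolding Let_def by metis
qed

end
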